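(* Let $M$ be a smooth manifold and let $X$ be an $r$-vector field on $M$. There is a unique $r$-vector field $d_TX$ on $TM$ such that $$\widetilde{d_TX}^{\,i}=(\varepsilon_M^{r-i})'\circ T\widetilde X^{\,i}\circ\varepsilon_M^i:\ \textstyle\bigwedge^iT^*TM\to\bigwedge^{r-i}TTM$$ for all $i=0,1,\dots,r$, where $T\widetilde X^{\,i}:T\bigwedge^iT^*M\to T\bigwedge^{r-i}TM$ is the tangent map of $\widetilde X^{\,i}$.
   Context: Everything is smooth. $\tau_M:TM\to M$ and $\pi_M:T^*M\to M$ are the projections. By convention $\bigwedge^0TM=\bigwedge^0T^*M=M\times\mathbb R$. Contractions: for an $r$-vector field $X$ on a manifold $N$ and $0\le i\le r$, $\widetilde X^{\,i}:\bigwedge^iT^*N\to\bigwedge^{r-i}TN$ is the vector bundle morphism with $\langle\widetilde X^{\,i}(a),b\rangle=\langle X,a\wedge b\rangle$ (so $\widetilde X^{\,0}(x,t)=tX(x)$ and $\widetilde X^{\,r}$ takes values in $N\times\mathbb R$). The flip $\kappa_M:TTM\to TTM$ is the canonical involution, in induced coordinates $(x,\dot x,\delta x,\delta\dot x)\mapsto(x,\delta x,\dot x,\delta\dot x)$; it is an isomorphism from the vector bundle $\tau_{TM}$ to $T\tau_M$ over $TM$. The tangent pairing $\langle\cdot,\cdot\rangle'^{\,r}_{TM}:T\bigwedge^rTM\times_{TM}T\bigwedge^rT^*M\to\mathbb R$ is the tangent map of the canonical pairing $\bigwedge^rTM\times_M\bigwedge^rT^*M\to\mathbb R$ followed by the projection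 of $T\mathbb R=\mathbb R\times\mathbb R$ onto the derivative component. $\alpha_M:TT^*M\to T^*TM$ is the isomorphism from the bundle $T\pi_M:TT^*M\to TM$ to $\pi_{TM}:T^*TM\to TM$ with $\langle v,\alpha_M(w)\rangle=\langle\kappa_M(v),w\rangle'^{\,1}_{TM}$, and $\varepsilon_M=\alpha_M^{-1}:T^*TM\to TT^*M$. In coordinates $(x,p,\dot x,\dot p)$ of $TT^*M$ and $(x,\dot x,\pi,\dot\pi)$ of $T^*TM$ (with $\pi,\dot\pi$ conjugate to $x,\dot x$), $\alpha_M$ is $(x,p,\dot x,\dot p)\mapsto(x,\dot x,\pi=\dot p,\dot\pi=p)$. For $r\ge1$, let $\bigwedge^r$ also denote the wedge map $T^*M\times_M\cdots\times_MT^*M\to\bigwedge^rT^*M$. Then $\varepsilon_M^r:\bigwedge^rT^*TM\to T\bigwedge^rT^*M$ is the vector bundle morphism over $TM$ determined by $\varepsilon_M^r(a_1\wedge\dots\wedge a_r)=T\bigwedge^r(\varepsilon_M(a_1),\dots,\varepsilon_M(a_r))$ for $a_1,\dots,a_r$ in a common fibre of $\pi_{TM}$. For $r=0$, $\varepsilon_M^0:TM\times\mathbb R\to T(M\times\mathbb R)$ maps $(x,\dot x,t)$ to the tangent vector at $(x,t)$ with components $(\dot x,\dot t)=(\dot x,0)$. $(\varepsilon_M^r)':T\bigwedge^rTM\to\bigwedge^rTTM$ is the dual morphism: $\langle(\varepsilon_M^r)'(w),a\rangle=\langle w,\varepsilon_M^r(a)\rangle'^{\,r}_{TM}$; for $r=0$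 it is $(x,\dot x,t,\dot t)\mapsto(x,\dot x,\dot t)$. *)

theory Defs
  imports "HOL-Analysis.Analysis"
begin

section \<open>Smooth maps between relatively open subsets of linear subspaces\<close>

text \<open>
  \<open>W\<close> is meant to be relatively open in the linear subspace \<open>S\<close>. Directional derivatives are
  taken along \<open>S\<close> only, because only there is the derivative within \<open>W\<close> unique.
\<close>

primrec Ck_on ::
  "nat \<Rightarrow> 'x::real_normed_vector set \<Rightarrow> 'x set \<Rightarrow> ('x \<Rightarrow> 'y::real_normed_vector) \<Rightarrow> bool"
where
  "Ck_on 0 S W f \<longleftrightarrow> continuous_on W f"
| "Ck_on (Suc m) S W f \<longleftrightarrow>
     (\<forall>x\<in>W. f differentiable (at x within W)) \<and>
     (\<forall>v\<in>S. Ck_on m S W (\<lambda>x. frechet_derivative f (at x within W) v))"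

definition smooth_on ::
  "'x::real_normed_vector set \<Rightarrow> 'x set \<Rightarrow> ('x \<Rightarrow> 'y::real_normed_vector) \<Rightarrow> bool"
where
  "smooth_on S W f \<longleftrightarrow> (\<forall>m. Ck_on m S W f)"


section \<open>Manifolds\<close>

text \<open>
  A manifold is presented by an atlas \<open>(cdom i, crd i)\<close>, \<open>i \<in> idx\<close>, with values in the coordinate
  space of all \<open>y :: real ^ 'k\<close> whose components outside the label set \<open>lbl\<close> vanish; so the
  dimension is \<open>card lbl\<close>. Label sets are needed because the bundles
  of \<open>r\<close>-forms and of \<open>r\<close>-vectors, whose dimension depends on \<open>r\<close>, have to live in one type for
  all \<open>r\<close>. The bundles below all use the index set of the atlas of their base: their
  charts are the ones induced by the charts of the base.
\<close>

record ('a, 'i, 'k) manifold =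
  pts :: "'a set"
  idx :: "'i set"
  cdom :: "'i \<Rightarrow> 'a set"
  crd :: "'i \<Rightarrow> 'a \<Rightarrow> real ^ 'k"
  lbl :: "'k set"

definition coord_space :: "'k set \<Rightarrow> (real ^ 'k::finite) set" where
  "coord_space K = {y. \<forall>k. k \<notin> K \<longrightarrow> y $ k = 0}"

abbreviation model :: "('a, 'i, 'k::finite) manifold \<Rightarrow> (real ^ 'k) set" where
  "model N \<equiv> coord_space (lbl N)"

definition par :: "('a, 'i, 'k::finite) manifold \<Rightarrow> 'i \<Rightarrow> real ^ 'k \<Rightarrow> 'a" where
  "par N i = inv_into (cdom N i) (crd N i)"

definition manifold_topology :: "('a, 'i, 'k::finite) manifold \<Rightarrow> 'a topology" where
  "manifold_topology N = topology (\<lambda>W. W \<subseteq> pts N \<and>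
     (\<forall>i\<in>idx N. openin (top_of_set (model N)) (crd N i ` (W \<inter> cdom N i))))"

definition smooth_manifold :: "('a, 'i, 'k::finite) manifold \<Rightarrow> bool" where
  "smooth_manifold N \<longleftrightarrow>
     (\<Union>i\<in>idx N. cdom N i) = pts N \<and>
     (\<forall>i\<in>idx N. inj_on (crd N i) (cdom N i) \<and>
        openin (top_of_set (model N)) (crd N i ` cdom N i)) \<and>
     (\<forall>i\<in>idx N. \<forall>j\<in>idx N.
        openin (top_of_set (model N)) (crd N i ` (cdom N i \<inter> cdom N j)) \<and>
        smooth_on (model N) (crd N i ` (cdom N i \<inter> cdom N j)) (crd N j \<circ> par N i)) \<and>
     Hausdorff_space (manifold_topology N) \<and>
     second_countable (manifold_topology N)"

lemma openin_manifold_topology: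
  assumes "smooth_manifold N"
  shows "openin (manifold_topology N) W \<longleftrightarrow> W \<subseteq> pts N \<and>
    (\<forall>i\<in>idx N. openin (top_of_set (model N)) (crd N i ` (W \<inter> cdom N i)))"
proof -
  let ?P = "\<lambda>W. W \<subseteq> pts N \<and>
    (\<forall>i\<in>idx N. openin (top_of_set (model N)) (crd N i ` (W \<inter> cdom N i)))"
  have inj: "inj_on (crd N i) (cdom N i)" if "i \<in> idx N" for i
    using assms that by (auto simp: smooth_manifold_def)
  have "istopology ?P"
    unfolding istopology_def
  proof (intro conjI allI impI)
    fix A B assume "?P A" and "?P B"
    moreover have "crd N i ` (A \<inter> B \<inter> cdom N i)
        = crd N i ` (A \<inter> cdom N i) \<inter> crd N i ` (B \<inter> cdom N i)" if "i \<in> idx N" for i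
      using inj[OF that] by (auto simp: inj_on_def)
    ultimately show "A \<inter> B \<subseteq> pts N"
      and "\<forall>i\<in>idx N. openin (top_of_set (model N)) (crd N i ` (A \<inter> B \<inter> cdom N i))"
      by auto
  next
    fix \<K> assume *: "\<forall>K\<in>\<K>. ?P K"
    then show "\<Union>\<K> \<subseteq> pts N" by auto
    have "crd N i ` (\<Union>\<K> \<inter> cdom N i) = (\<Union>K\<in>\<K>. crd N i ` (K \<inter> cdom N i))" for i
      by auto
    with * show "\<forall>i\<in>idx N. openin (top_of_set (model N)) (crd N i ` (\<Union>\<K> \<inter> cdom N i))"
      by auto
  qed
  then show ?thesis
    by (simp add: manifold_topology_def)
qed

definition smooth_map ::
  "('a, 'i, 'k::finite) manifold \<Rightarrow> ('b, 'j, 'l::finite) manifold \<Rightarrow> ('a \<Rightarrow> 'b) \<Rightarrow> bool"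
where
  "smooth_map N N' f \<longleftrightarrow> f ` pts N \<subseteq> pts N' \<and>
     (\<forall>p\<in>pts N. \<exists>i\<in>idx N. \<exists>j\<in>idx N'. \<exists>W.
        p \<in> cdom N i \<and> f p \<in> cdom N' j \<and>
        crd N i p \<in> W \<and> W \<subseteq> crd N i ` cdom N i \<and> openin (top_of_set (model N)) W \<and>
        (\<forall>y\<in>W. f (par N i y) \<in> cdom N' j) \<and>
        smooth_on (model N) W (\<lambda>y. crd N' j (f (par N i y))))"


section \<open>Tangent vectors and tangent maps\<close>

text \<open>
  Tangent vectors are classes of smooth curves with the same 1-jet at \<open>0\<close>. Only the germ
  at \<open>0\<close> of a curve matters; the function may be arbitrary elsewhere.
\<close>

type_synonym 'a tvec = "(real \<Rightarrow> 'a) set"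

definition curve :: "('a, 'i, 'k::finite) manifold \<Rightarrow> (real \<Rightarrow> 'a) \<Rightarrow> bool" where
  "curve N \<gamma> \<longleftrightarrow> (\<exists>i\<in>idx N. \<exists>\<epsilon>>0. \<gamma> ` {-\<epsilon><..<\<epsilon>} \<subseteq> cdom N i \<and>
     smooth_on UNIV {-\<epsilon><..<\<epsilon>} (crd N i \<circ> \<gamma>))"

definition tangent :: "('a, 'i, 'k::finite) manifold \<Rightarrow> (real \<Rightarrow> 'a) \<Rightarrow> 'a tvec" where
  "tangent N \<gamma> = {\<delta>. curve N \<delta> \<and> \<delta> 0 = \<gamma> 0 \<and>
     (\<forall>i\<in>idx N. \<gamma> 0 \<in> cdom N i \<longrightarrow>
        vector_derivative (crd N i \<circ> \<delta>) (at 0) = vector_derivative (crd N i \<circ> \<gamma>) (at 0))}"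

definition rep :: "'a tvec \<Rightarrow> real \<Rightarrow> 'a" where
  "rep w = (SOME \<gamma>. \<gamma> \<in> w)"

definition foot :: "'a tvec \<Rightarrow> 'a" where
  "foot w = rep w 0"

definition vel :: "('a, 'i, 'k::finite) manifold \<Rightarrow> 'i \<Rightarrow> 'a tvec \<Rightarrow> real ^ 'k" where
  "vel N i w = vector_derivative (crd N i \<circ> rep w) (at 0)"

definition tangent_bundle ::
  "('a, 'i, 'k::finite) manifold \<Rightarrow> ('a tvec, 'i, 'k + 'k) manifold"
where
  "tangent_bundle N = \<lparr>
     pts = {tangent N \<gamma> | \<gamma>. curve N \<gamma>},
     idx = idx N,
     cdom = (\<lambda>i. {tangent N \<gamma> | \<gamma>. curve N \<gamma> \<and> \<gamma> 0 \<in> cdom N i}),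
     crd = (\<lambda>i w. \<chi> s. case s of Inl k \<Rightarrow> crd N i (foot w) $ k | Inr k \<Rightarrow> vel N i w $ k),
     lbl = lbl N <+> lbl N \<rparr>"

definition tangent_space :: "('a, 'i, 'k::finite) manifold \<Rightarrow> 'a \<Rightarrow> 'a tvec set" where
  "tangent_space N p = {w \<in> pts (tangent_bundle N). foot w = p}"

text \<open>The linear combination \<open>a u + b v\<close> of two tangent vectors at the same point.\<close>

definition lincomb ::
  "('a, 'i, 'k::finite) manifold \<Rightarrow> real \<Rightarrow> 'a tvec \<Rightarrow> real \<Rightarrow> 'a tvec \<Rightarrow> 'a tvec"
where
  "lincomb N a u b v = (THE w. w \<in> tangent_space N (foot u) \<and>
     (\<forall>i\<in>idx N. foot u \<in> cdom N i \<longrightarrow> vel N i w = a *\<^sub>R vel N i u + b *\<^sub>R vel N i v))"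

definition tmap ::
  "('b, 'j, 'l::finite) manifold \<Rightarrow> ('a \<Rightarrow> 'b) \<Rightarrow> 'a tvec \<Rightarrow> 'b tvec"
where
  "tmap N' f w = tangent N' (f \<circ> rep w)"

text \<open>The coordinate vector of the \<open>k\<close>-th coordinate of chart \<open>i\<close> at \<open>p\<close>, and its dual 1-form.\<close>

definition coord_vec :: "('a, 'i, 'k::finite) manifold \<Rightarrow> 'i \<Rightarrow> 'a \<Rightarrow> 'k \<Rightarrow> 'a tvec" where
  "coord_vec N i p k = tangent N (\<lambda>t. par N i (crd N i p + t *\<^sub>R axis k 1))"

type_synonym 'a form = "'a tvec list \<Rightarrow> real"

definition coord_covec :: "('a, 'i, 'k::finite) manifold \<Rightarrow> 'i \<Rightarrow> 'a \<Rightarrow> 'k \<Rightarrow> 'a form" where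
  "coord_covec N i p k =
     (\<lambda>vs. if length vs = 1 \<and> set vs \<subseteq> tangent_space N p then vel N i (hd vs) $ k else 0)"


section \<open>Exterior powers\<close>

text \<open>
  \<open>forms N r p\<close> is the \<open>r\<close>-th exterior power of the cotangent space at \<open>p\<close>, realised as the space
  of alternating \<open>r\<close>-linear functions on the tangent space (set to \<open>0\<close> off their domain). A
  0-form is identified with its value at the empty list, and a covector is a 1-form.
\<close>

definition forms :: "('a, 'i, 'k::finite) manifold \<Rightarrow> nat \<Rightarrow> 'a \<Rightarrow> 'a form set" where
  "forms N r p = {\<omega>.
     (\<forall>vs. \<not> (length vs = r \<and> set vs \<subseteq> tangent_space N p) \<longrightarrow> \<omega> vs = 0) \<and>
     (\<forall>vs j a u b v. length vs = r \<and> set vs \<subseteq> tangent_space N p \<and> j < r \<and>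
        u \<in> tangent_space N p \<and> v \<in> tangent_space N p \<longrightarrow>
        \<omega> (vs[j := lincomb N a u b v]) = a * \<omega> (vs[j := u]) + b * \<omega> (vs[j := v])) \<and>
     (\<forall>vs. \<not> distinct vs \<longrightarrow> \<omega> vs = 0)}"

text \<open>
  The wedge product of a \<open>p\<close>-form and a \<open>q\<close>-form, normalised so that
  \<open>(a\<^sub>1 \<and> \<dots> \<and> a\<^sub>r)(v\<^sub>1, \<dots>, v\<^sub>r) = det (a\<^sub>i(v\<^sub>j))\<close>.
\<close>

definition wedge ::
  "nat \<Rightarrow> nat \<Rightarrow> ('v list \<Rightarrow> real) \<Rightarrow> ('v list \<Rightarrow> real) \<Rightarrow> 'v list \<Rightarrow> real"
where
  "wedge p q \<omega> \<eta> = (\<lambda>vs. if length vs = p + q then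
     (\<Sum>\<pi> | \<pi> permutes {..<p + q}. of_int (sign \<pi>) *
        \<omega> (map (\<lambda>j. vs ! \<pi> j) [0..<p]) * \<eta> (map (\<lambda>j. vs ! \<pi> j) [p..<p + q]))
       / (fact p * fact q) else 0)"

primrec wedge_list :: "('v list \<Rightarrow> real) list \<Rightarrow> 'v list \<Rightarrow> real" where
  "wedge_list [] = (\<lambda>vs. if vs = [] then 1 else 0)"
| "wedge_list (a # as) = wedge 1 (length as) a (wedge_list as)"

text \<open>
  Coordinates on exterior powers are labelled by the \<open>r\<close>-element sets of labels, each of which is
  enumerated in some fixed order. Since \<open>'k\<close> carries no linear order,
  this replaces the usual increasing order; it only affects the signs of these coordinates.
\<close>

definition enum :: "'k set \<Rightarrow> 'k list" where
  "enum I = (SOME ks. distinct ks \<and> set ks = I)"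

definition form_bundle ::
  "('a, 'i, 'k::finite) manifold \<Rightarrow> nat \<Rightarrow> ('a \<times> 'a form, 'i, 'k + 'k set) manifold"
where
  "form_bundle N r = \<lparr>
     pts = {(p, \<omega>). p \<in> pts N \<and> \<omega> \<in> forms N r p},
     idx = idx N,
     cdom = (\<lambda>i. {(p, \<omega>). p \<in> cdom N i \<and> \<omega> \<in> forms N r p}),
     crd = (\<lambda>i (p, \<omega>). \<chi> s. case s of
       Inl k \<Rightarrow> crd N i p $ k
     | Inr I \<Rightarrow> if I \<subseteq> lbl N \<and> card I = r then \<omega> (map (coord_vec N i p) (enum I)) else 0),
     lbl = lbl N <+> {I. I \<subseteq> lbl N \<and> card I = r} \<rparr>"

text \<open>
  The \<open>r\<close>-th exterior power of the (finite-dimensional) tangent space at \<open>p\<close> is realised as the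
  dual of the space of \<open>r\<close>-forms at \<open>p\<close>: \<open>v\<^sub>1 \<and> \<dots> \<and> v\<^sub>r\<close> is the functional
  \<open>\<omega> \<mapsto> \<omega> (v\<^sub>1, \<dots>, v\<^sub>r)\<close>, and the canonical pairing of an \<open>r\<close>-vector \<open>X\<close> with an \<open>r\<close>-form \<open>\<omega>\<close>
  is \<open>X \<omega>\<close>. For \<open>r = 0\<close> a functional is identified with its value at the 0-form \<open>1\<close>.
\<close>

type_synonym 'a mvec = "'a form \<Rightarrow> real"

definition mvecs :: "('a, 'i, 'k::finite) manifold \<Rightarrow> nat \<Rightarrow> 'a \<Rightarrow> 'a mvec set" where
  "mvecs N r p = {X.
     (\<forall>\<omega>. \<omega> \<notin> forms N r p \<longrightarrow> X \<omega> = 0) \<and>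
     (\<forall>a b. \<forall>\<omega>\<in>forms N r p. \<forall>\<eta>\<in>forms N r p.
        X (\<lambda>vs. a * \<omega> vs + b * \<eta> vs) = a * X \<omega> + b * X \<eta>)}"

definition mvec_bundle ::
  "('a, 'i, 'k::finite) manifold \<Rightarrow> nat \<Rightarrow> ('a \<times> 'a mvec, 'i, 'k + 'k set) manifold"
where
  "mvec_bundle N r = \<lparr>
     pts = {(p, X). p \<in> pts N \<and> X \<in> mvecs N r p},
     idx = idx N,
     cdom = (\<lambda>i. {(p, X). p \<in> cdom N i \<and> X \<in> mvecs N r p}),
     crd = (\<lambda>i (p, X). \<chi> s. case s of
       Inl k \<Rightarrow> crd N i p $ k
     | Inr I \<Rightarrow> if I \<subseteq> lbl N \<and> card I = r
         then X (wedge_list (map (coord_covec N i p) (enum I))) else 0),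
     lbl = lbl N <+> {I. I \<subseteq> lbl N \<and> card I = r} \<rparr>"

text \<open>Smooth sections; they are \<open>undefined\<close> off the manifold, so that equality is equality on it.\<close>

definition mvec_fields ::
  "('a, 'i, 'k::finite) manifold \<Rightarrow> nat \<Rightarrow> ('a \<Rightarrow> 'a \<times> 'a mvec) set"
where
  "mvec_fields N r = {X \<in> extensional (pts N).
     smooth_map N (mvec_bundle N r) X \<and> (\<forall>p\<in>pts N. fst (X p) = p)}"

definition contraction ::
  "('a, 'i, 'k::finite) manifold \<Rightarrow> nat \<Rightarrow> ('a \<Rightarrow> 'a \<times> 'a mvec) \<Rightarrow> nat \<Rightarrow>
    'a \<times> 'a form \<Rightarrow> 'a \<times> 'a mvec"
where
  "contraction N r X i = (\<lambda>(p, a). (p, \<lambda>b.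
     if b \<in> forms N (r - i) p then snd (X p) (wedge i (r - i) a b) else 0))"


section \<open>The canonical maps\<close>

text \<open>
  The tangent bundle of a fibre product of bundles over \<open>M\<close> is the fibre product over \<open>TM\<close> of
  their tangent bundles: tangent vectors over the same element of \<open>TM\<close> have
  representatives lying over one and the same curve in \<open>M\<close>. The tangent map of a map defined
  on a fibre product is computed below by means of such representatives.
\<close>

definition tangent_pairing ::
  "('a \<times> 'a mvec) tvec \<Rightarrow> ('a \<times> 'a form) tvec \<Rightarrow> real"
where
  "tangent_pairing w z =
     (let (\<gamma>, \<delta>) = (SOME (\<gamma>, \<delta>). \<gamma> \<in> w \<and> \<delta> \<in> z \<and> (\<forall>t. fst (\<gamma> t) = fst (\<delta> t)))
      in vector_derivative (\<lambda>t. snd (\<gamma> t) (snd (\<delta> t))) (at 0))"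

text \<open>The case of degree 1, for the pairing of tangent vectors themselves with covectors.\<close>

definition tangent_pairing1 :: "'a tvec tvec \<Rightarrow> ('a \<times> 'a form) tvec \<Rightarrow> real" where
  "tangent_pairing1 w z =
     (let (\<gamma>, \<delta>) = (SOME (\<gamma>, \<delta>). \<gamma> \<in> w \<and> \<delta> \<in> z \<and> (\<forall>t. foot (\<gamma> t) = fst (\<delta> t)))
      in vector_derivative (\<lambda>t. snd (\<delta> t) [\<gamma> t]) (at 0))"

text \<open>In the labels of the charts of \<open>TTM\<close>, the coordinates \<open>(x, x', \<delta>x, \<delta>x')\<close> are
  \<open>Inl (Inl k)\<close>, \<open>Inl (Inr k)\<close>, \<open>Inr (Inl k)\<close>, \<open>Inr (Inr k)\<close>.\<close>

definition flip_coords ::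
  "real ^ (('k::finite + 'k) + ('k + 'k)) \<Rightarrow> real ^ (('k + 'k) + ('k + 'k))"
where
  "flip_coords y = (\<chi> s. case s of
     Inl (Inl k) \<Rightarrow> y $ Inl (Inl k)
   | Inl (Inr k) \<Rightarrow> y $ Inr (Inl k)
   | Inr (Inl k) \<Rightarrow> y $ Inl (Inr k)
   | Inr (Inr k) \<Rightarrow> y $ Inr (Inr k))"

definition flip_map ::
  "('a, 'i, 'k::finite) manifold \<Rightarrow> 'a tvec tvec \<Rightarrow> 'a tvec tvec"
where
  "flip_map M w = (let TTM = tangent_bundle (tangent_bundle M) in
     THE w'. w' \<in> pts TTM \<and> (\<forall>i\<in>idx M. w \<in> cdom TTM i \<longrightarrow>
       w' \<in> cdom TTM i \<and> crd TTM i w' = flip_coords (crd TTM i w)))"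

definition alpha ::
  "('a, 'i, 'k::finite) manifold \<Rightarrow> ('a \<times> 'a form) tvec \<Rightarrow> 'a tvec \<times> 'a tvec form"
where
  "alpha M w = (let u = tmap M fst w in
     (u, \<lambda>vs. if length vs = 1 \<and> set vs \<subseteq> tangent_space (tangent_bundle M) u
        then tangent_pairing1 (flip_map M (hd vs)) w else 0))"

definition epsilon ::
  "('a, 'i, 'k::finite) manifold \<Rightarrow> 'a tvec \<times> 'a tvec form \<Rightarrow> ('a \<times> 'a form) tvec"
where
  "epsilon M = inv_into (pts (tangent_bundle (form_bundle M 1))) (alpha M)"

text \<open>The tangent map of the \<open>r\<close>-fold wedge map, for \<open>r = length ws \<ge> 1\<close>.\<close>

definition tangent_wedge ::
  "('a, 'i, 'k::finite) manifold \<Rightarrow> ('a \<times> 'a form) tvec list \<Rightarrow> ('a \<times> 'a form) tvec"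
where
  "tangent_wedge M ws =
     (let \<gamma>s = (SOME \<gamma>s. list_all2 (\<in>) \<gamma>s ws \<and>
                  (\<forall>\<gamma>\<in>set \<gamma>s. \<forall>\<delta>\<in>set \<gamma>s. \<forall>t. fst (\<gamma> t) = fst (\<delta> t)))
      in tangent (form_bundle M (length ws))
           (\<lambda>t. (fst (hd \<gamma>s t), wedge_list (map (\<lambda>\<gamma>. snd (\<gamma> t)) \<gamma>s))))"

text \<open>
  The vector bundle structure of \<open>T\<pi>\<close> for the bundle \<open>\<pi>\<close> of \<open>r\<close>-forms over \<open>M\<close>: its fibre over a
  tangent vector \<open>v\<close> of \<open>M\<close>, and the linear combination \<open>a w + b z\<close> in a fibre, which is the
  tangent map of the fibrewise linear combination of forms.
\<close>

definition tangent_fibre ::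
  "('a, 'i, 'k::finite) manifold \<Rightarrow> nat \<Rightarrow> 'a tvec \<Rightarrow> ('a \<times> 'a form) tvec set"
where
  "tangent_fibre M r v = {w \<in> pts (tangent_bundle (form_bundle M r)). tmap M fst w = v}"

definition tangent_lincomb ::
  "('a, 'i, 'k::finite) manifold \<Rightarrow> nat \<Rightarrow> real \<Rightarrow> ('a \<times> 'a form) tvec \<Rightarrow>
    real \<Rightarrow> ('a \<times> 'a form) tvec \<Rightarrow> ('a \<times> 'a form) tvec"
where
  "tangent_lincomb M r a w b z =
     (let (\<gamma>, \<delta>) = (SOME (\<gamma>, \<delta>). \<gamma> \<in> w \<and> \<delta> \<in> z \<and> (\<forall>t. fst (\<gamma> t) = fst (\<delta> t)))
      in tangent (form_bundle M r)
           (\<lambda>t. (fst (\<gamma> t), \<lambda>vs. a * snd (\<gamma> t) vs + b * snd (\<delta> t) vs)))"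

definition epsilon_pow ::
  "('a, 'i, 'k::finite) manifold \<Rightarrow> nat \<Rightarrow> 'a tvec \<times> 'a tvec form \<Rightarrow> ('a \<times> 'a form) tvec"
where
  "epsilon_pow M r = (\<lambda>(v, \<omega>).
     if r = 0 then
       tangent (form_bundle M 0) (\<lambda>t. (rep v t, \<lambda>vs. if vs = [] then \<omega> [] else 0))
     else
       (THE L. L \<in> forms (tangent_bundle M) r v \<rightarrow>\<^sub>E tangent_fibre M r v \<and>
          (\<forall>a b. \<forall>\<omega>\<in>forms (tangent_bundle M) r v. \<forall>\<eta>\<in>forms (tangent_bundle M) r v.
             L (\<lambda>vs. a * \<omega> vs + b * \<eta> vs) = tangent_lincomb M r a (L \<omega>) b (L \<eta>)) \<and>
          (\<forall>as. length as = r \<and> set as \<subseteq> forms (tangent_bundle M) 1 v \<longrightarrow>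
             L (wedge_list as) = tangent_wedge M (map (\<lambda>a. epsilon M (v, a)) as))) \<omega>)"

text \<open>For \<open>r = 0\<close> this is \<open>(x, x', t, t') \<mapsto> (x, x', t')\<close>.\<close>

definition epsilon_dual ::
  "('a, 'i, 'k::finite) manifold \<Rightarrow> nat \<Rightarrow> ('a \<times> 'a mvec) tvec \<Rightarrow> 'a tvec \<times> 'a tvec mvec"
where
  "epsilon_dual M r w = (let v = tmap M fst w in
     (v, \<lambda>a. if a \<in> forms (tangent_bundle M) r v
        then tangent_pairing w (epsilon_pow M r (v, a)) else 0))"

end

theory Submission
  imports Defs
begin

text \<open>
  Fix a chart around the foot of \<open>v \<in> TM\<close>. The coordinate frame of \<open>TM\<close> at \<open>v\<close> consists of the images
  under two maps \<open>H\<close> and \<open>V\<close> of the coordinate frame of \<open>M\<close> (the base and the velocity directions), so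
  \<open>A\<^sub>t = V + t H\<close> maps tangent vectors along the straight line \<open>c\<close> with velocity \<open>v\<close> to tangent vectors
  of \<open>TM\<close> at \<open>v\<close>. Then \<open>\<epsilon>\<^sup>i(\<omega>)\<close> is represented by the curve \<open>t \<mapsto> A\<^sub>t\<^sup>* \<omega>\<close> of forms along \<open>c\<close>. Since
  pullback commutes with wedge products, evaluating the right-hand side of the defining equation at
  forms \<open>\<omega>\<close> and \<open>\<eta>\<close> gives the derivative at \<open>t = 0\<close> of \<open>\<langle>X, A\<^sub>t\<^sup>* (\<omega> \<and> \<eta>)\<rangle>\<close>, which depends on \<open>\<omega> \<and> \<eta>\<close> only.
  Hence the equation for \<open>i = 0\<close> determines the lifted field and implies all the others.
\<close>

section \<open>Calculus on relatively open subsets of subspaces\<close>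

text \<open>In coordinates \<open>epsilon\<close> turns a covector of \<open>TM\<close> with base
  part pi and velocity part pi' into the tangent vector with p = pi' and dp = pi, that is, into the
  1-jet of t -> pi' + t pi. This curve is the pullback of the covector by V + t H, which is the
  origin of A_t; as the power of \<open>epsilon\<close> is fixed by decomposable forms, the same
  pullback serves in every positive degree. The obstacle is that the canonical maps are defined by
  choice: \<open>rep\<close>, representatives over one base curve, inverses, definite descriptions.
  Most of the work shows that these choices do not matter, by two arguments. Pairing, fibrewise
  linear combination and wedge are polynomial in bundle coordinates, hence respect 1-jets. The flip,
  required to exchange coordinates in all charts at once, exists because second derivatives of chart
  transitions are symmetric. The maps A_t do depend on the chart, but independence of the lifted
  field costs no computation, since the right-hand side of the defining equation mentions no
  chart.\<close>

definition rel_open :: "'x::euclidean_space set \<Rightarrow> 'x set \<Rightarrow> bool" where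
  "rel_open S W \<longleftrightarrow> subspace S \<and> openin (top_of_set S) W"

abbreviation dir_deriv ::
  "'x::real_normed_vector set \<Rightarrow> ('x \<Rightarrow> 'y::real_normed_vector) \<Rightarrow> 'x \<Rightarrow> 'x \<Rightarrow> 'y"
where
  "dir_deriv W f v x \<equiv> frechet_derivative f (at x within W) v"

section \<open>Derivatives within relatively open sets\<close>

lemma rel_open_UNIV: "open W \<Longrightarrow> rel_open UNIV W"
  by (simp add: rel_open_def)

lemma rel_open_subset: "rel_open S W \<Longrightarrow> W \<subseteq> S"
  by (auto simp: rel_open_def dest: openin_imp_subset)

lemma rel_open_line:
  assumes "rel_open S W" "x \<in> W" "v \<in> S"
  shows "\<exists>e>0. \<forall>t. \<bar>t\<bar> < e \<longrightarrow> x + t *\<^sub>R v \<in> W"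
proof -
  from assms(1) obtain U where U: "open U" "W = S \<inter> U" and S: "subspace S"
    by (auto simp: rel_open_def openin_open)
  have "\<forall>\<^sub>F t in nhds 0. x + t *\<^sub>R v \<in> U"
  proof -
    have "((\<lambda>t::real. x + t *\<^sub>R v) \<longlongrightarrow> x + 0 *\<^sub>R v) (nhds 0)"
      by (intro tendsto_intros) (auto simp: filterlim_ident)
    then show ?thesis using U assms(2) by (auto dest!: topological_tendstoD[of _ _ _ U])
  qed
  then obtain e where e: "e > 0" "\<And>t. \<bar>t\<bar> < e \<Longrightarrow> x + t *\<^sub>R v \<in> U"
    by (auto simp: eventually_nhds_metric dist_real_def)
  have "x + t *\<^sub>R v \<in> S" for t
    using S assms(2,3) U by (auto intro!: subspace_add subspace_scale)
  with e U show ?thesis by blast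
qed

text \<open>\<open>W\<close> may have empty interior in the ambient space, so a derivative within
  \<open>W\<close> need not be unique as a linear map. Restriction to a line with direction in
  \<open>S\<close> reduces questions about it to a derivative in one real variable.\<close>

lemma has_derivative_within_line:
  assumes "rel_open S W" "x \<in> W" "v \<in> S" "(f has_derivative f') (at x within W)"
  shows "((\<lambda>t. f (x + t *\<^sub>R v)) has_vector_derivative f' v) (at 0)"
proof -
  obtain e where e: "e > 0" "\<And>t. \<bar>t\<bar> < e \<Longrightarrow> x + t *\<^sub>R v \<in> W"
    using rel_open_line[OF assms(1-3)] by blast
  have l: "((\<lambda>t. x + t *\<^sub>R v) has_derivative (\<lambda>t. t *\<^sub>R v)) (at 0 within ball 0 e)"
    by (rule has_derivative_eq_rhs[OF has_derivative_add[OF has_derivative_const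
            has_derivative_scaleR_left[OF has_derivative_ident]]]) simp
  have sub: "(\<lambda>t. x + t *\<^sub>R v) ` ball 0 e \<subseteq> W"
    using e by auto
  have "((\<lambda>t. f (x + t *\<^sub>R v)) has_derivative (\<lambda>t. f' (t *\<^sub>R v))) (at 0 within ball 0 e)"
    using has_derivative_in_compose[OF l, of f f'] has_derivative_subset[OF assms(4) sub] by simp
  then have "((\<lambda>t. f (x + t *\<^sub>R v)) has_derivative (\<lambda>t. f' (t *\<^sub>R v))) (at 0)"
    using e(1) by (simp add: at_within_open[of 0 "ball 0 e"])
  moreover have "f' (t *\<^sub>R v) = t *\<^sub>R f' v" for t
    by (rule linear_cmul[OF has_derivative_linear[OF assms(4)]])
  ultimately show ?thesis by (simp add: has_vector_derivative_def)
qed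

lemma has_derivative_rel_unique:
  assumes "rel_open S W" "x \<in> W" "v \<in> S"
    and "(f has_derivative f') (at x within W)" "(f has_derivative f'') (at x within W)"
  shows "f' v = f'' v"
  using vector_derivative_at[OF has_derivative_within_line[OF assms(1-4)]]
    vector_derivative_at[OF has_derivative_within_line[OF assms(1-3,5)]] by simp

lemma dir_deriv_eq:
  assumes "rel_open S W" "x \<in> W" "v \<in> S" "(f has_derivative f') (at x within W)"
  shows "dir_deriv W f v x = f' v"
  by (rule has_derivative_rel_unique[OF assms(1-3) _ assms(4)])
    (use assms(4) in \<open>auto simp: frechet_derivative_works[symmetric] differentiable_def\<close>)

text \<open>The value is a limit of difference quotients lying in \<open>T\<close>, and a subspace
  is closed. The chain rule needs this: the direction handed to the outer function must again be
  tangent to the domain of that function.\<close>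

lemma has_derivative_rel_mem:
  assumes "rel_open S W" "x \<in> W" "v \<in> S" "(f has_derivative f') (at x within W)"
    and "f ` W \<subseteq> T" "subspace T"
  shows "f' v \<in> (T :: 'b::euclidean_space set)"
proof -
  obtain e where e: "e > 0" "\<And>t. \<bar>t\<bar> < e \<Longrightarrow> x + t *\<^sub>R v \<in> W"
    using rel_open_line[OF assms(1-3)] by blast
  let ?q = "\<lambda>t. (f (x + t *\<^sub>R v) - f x) /\<^sub>R t"
  have "((\<lambda>t. norm (f (x + t *\<^sub>R v) - f x - t *\<^sub>R f' v) / \<bar>t\<bar>) \<longlongrightarrow> 0) (at 0)"
    using has_derivative_within_line[OF assms(1-4)]
    unfolding has_vector_derivative_def has_derivative_iff_norm by simp
  moreover have "norm (f (x + t *\<^sub>R v) - f x - t *\<^sub>R f' v) / \<bar>t\<bar> = norm (?q t - f' v)"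
    if "t \<noteq> 0" for t
  proof -
    have "?q t - f' v = (f (x + t *\<^sub>R v) - f x - t *\<^sub>R f' v) /\<^sub>R t"
      using that by (simp only: scaleR_diff_right) simp
    show ?thesis unfolding \<open>?q t - f' v = _\<close> norm_scaleR by (simp add: divide_inverse)
  qed
  ultimately have "((\<lambda>t. norm (?q t - f' v)) \<longlongrightarrow> 0) (at 0)"
    by (elim Lim_transform_eventually) (auto simp: eventually_at_filter)
  then have "(?q \<longlongrightarrow> f' v) (at 0)"
    by (simp only: tendsto_norm_zero_iff LIM_zero_iff)
  moreover have "\<forall>\<^sub>F t in at 0. (f (x + t *\<^sub>R v) - f x) /\<^sub>R t \<in> T"
    unfolding eventually_at
    by (rule exI[of _ e]) (use e assms in \<open>auto intro!: subspace_scale subspace_diff\<close>)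
  ultimately show ?thesis
    using Lim_in_closed_set[OF closed_subspace[OF assms(6)], of ?q "at 0" "f' v"] trivial_limit_at by simp
qed

lemma has_derivative_within_cong:
  assumes "\<And>y. y \<in> W \<Longrightarrow> f y = g y" "x \<in> W"
  shows "(f has_derivative f') (at x within W) \<longleftrightarrow> (g has_derivative f') (at x within W)"
  using has_derivative_transform[of x W f g f'] has_derivative_transform[of x W g f f'] assms by auto

lemma frechet_derivative_cong:
  assumes "\<And>y. y \<in> W \<Longrightarrow> f y = g y" "x \<in> W"
  shows "frechet_derivative f (at x within W) = frechet_derivative g (at x within W)"
  using has_derivative_within_cong[OF assms] by (simp add: frechet_derivative_def)

section \<open>Finite differentiability classes and the chain rule\<close>

lemma Ck_on_cong:
  assumes "\<And>y. y \<in> W \<Longrightarrow> f y = g y"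
  shows "Ck_on m S W f \<longleftrightarrow> Ck_on m S W g"
  using assms
proof (induction m arbitrary: f g)
  case 0
  then show ?case by (simp cong: continuous_on_cong)
next
  case (Suc m)
  have 1: "f differentiable (at x within W) \<longleftrightarrow> g differentiable (at x within W)" if "x \<in> W" for x
    using has_derivative_within_cong[of W f g x] Suc.prems that by (simp add: differentiable_def)
  have 2: "Ck_on m S W (\<lambda>x. dir_deriv W f v x) \<longleftrightarrow> Ck_on m S W (\<lambda>x. dir_deriv W g v x)" for v
    using frechet_derivative_cong[of W f g] Suc.prems by (intro Suc.IH) auto
  show ?case using 1 2 by auto
qed

text \<open>\<open>frechet_derivative\<close> is a choice among possibly many derivatives, all of
  which agree on \<open>S\<close>. Hence any explicit family \<open>f'\<close> of derivatives can be
  used to gain one order.\<close>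

lemma Ck_on_SucI:
  assumes "rel_open S W" "\<And>x. x \<in> W \<Longrightarrow> (f has_derivative f' x) (at x within W)"
    and "\<And>v. v \<in> S \<Longrightarrow> Ck_on m S W (\<lambda>x. f' x v)"
  shows "Ck_on (Suc m) S W f"
proof -
  have "Ck_on m S W (\<lambda>x. dir_deriv W f v x)" if "v \<in> S" for v
    using assms(3)[OF that] Ck_on_cong[of W "\<lambda>x. dir_deriv W f v x" "\<lambda>x. f' x v" m S]
      dir_deriv_eq[OF assms(1) _ that assms(2)] by auto
  then show ?thesis using assms(2) by (auto simp: differentiable_def)
qed

lemma Ck_on_SucD:
  assumes "Ck_on (Suc m) S W f"
  shows "x \<in> W \<Longrightarrow> (f has_derivative frechet_derivative f (at x within W)) (at x within W)"
    and "v \<in> S \<Longrightarrow> Ck_on m S W (\<lambda>x. dir_deriv W f v x)"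
  using assms by (auto simp: frechet_derivative_works)

lemma Ck_on_lower: "Ck_on (Suc m) S W f \<Longrightarrow> Ck_on m S W f"
proof (induction m arbitrary: f)
  case 0
  then show ?case
    by (auto simp: continuous_on_eq_continuous_within differentiable_imp_continuous_within)
next
  case (Suc m)
  then show ?case by (metis Ck_on.simps(2))
qed

lemma Ck_on_subset:
  assumes "rel_open S W" "rel_open S W'" "W' \<subseteq> W" "Ck_on m S W f"
  shows "Ck_on m S W' f"
  using assms(4)
proof (induction m arbitrary: f)
  case 0
  then show ?case using assms(3) continuous_on_subset by auto
next
  case (Suc m)
  show ?case
    by (rule Ck_on_SucI[OF assms(2), of _ "\<lambda>x. frechet_derivative f (at x within W)"])
      (use Suc.IH Ck_on_SucD[OF Suc.prems] has_derivative_subset[OF _ assms(3)] assms(3) in blast)+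
qed

lemma Ck_on_const: "rel_open S W \<Longrightarrow> Ck_on m S W (\<lambda>x. c)"
proof (induction m arbitrary: c)
  case (Suc m)
  then show ?case by (intro Ck_on_SucI[where f' = "\<lambda>x v. 0"]) auto
qed simp

lemma Ck_on_bounded_linear:
  assumes "rel_open S W" "bounded_linear L" "Ck_on m S W f"
  shows "Ck_on m S W (\<lambda>x. L (f x))"
  using assms(3)
proof (induction m arbitrary: f)
  case 0
  then show ?case by (simp add: bounded_linear.continuous_on[OF assms(2)])
next
  case (Suc m)
  show ?case
    by (rule Ck_on_SucI[OF assms(1), of _ "\<lambda>x v. L (frechet_derivative f (at x within W) v)"])
      (use Suc Ck_on_SucD[OF Suc.prems] in \<open>auto intro: bounded_linear.has_derivative[OF assms(2)]\<close>)
qed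

lemma Ck_on_id:
  assumes "rel_open S W"
  shows "Ck_on m S W (\<lambda>x. x)"
proof (cases m)
  case (Suc n)
  show ?thesis unfolding Suc
    by (rule Ck_on_SucI[OF assms, where f' = "\<lambda>x v. v"]) (use assms Ck_on_const in auto)
qed simp

lemma Ck_on_add:
  assumes "rel_open S W" "Ck_on m S W f" "Ck_on m S W g"
  shows "Ck_on m S W (\<lambda>x. f x + g x)"
  using assms(2,3)
proof (induction m arbitrary: f g)
  case 0
  then show ?case by (auto intro: continuous_intros)
next
  case (Suc m)
  show ?case
    by (rule Ck_on_SucI[OF assms(1),
        of _ "\<lambda>x v. frechet_derivative f (at x within W) v + frechet_derivative g (at x within W) v"])
      (use Suc Ck_on_SucD[OF Suc.prems(1)] Ck_on_SucD[OF Suc.prems(2)] in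
        \<open>auto intro: has_derivative_add\<close>)
qed

lemma Ck_on_scaleR:
  fixes f :: "'x::euclidean_space \<Rightarrow> real"
  assumes "rel_open S W" "Ck_on m S W f" "Ck_on m S W g"
  shows "Ck_on m S W (\<lambda>x. f x *\<^sub>R g x)"
  using assms(2,3)
proof (induction m arbitrary: f g)
  case 0
  then show ?case by (auto intro: continuous_intros)
next
  case (Suc m)
  show ?case
    by (rule Ck_on_SucI[OF assms(1), of _ "\<lambda>x v. f x *\<^sub>R frechet_derivative g (at x within W) v
          + frechet_derivative f (at x within W) v *\<^sub>R g x"])
      (use Suc.IH Ck_on_SucD[OF Suc.prems(1)] Ck_on_SucD[OF Suc.prems(2)]
         Suc.prems[THEN Ck_on_lower] in
        \<open>auto intro: has_derivative_scaleR Ck_on_add[OF assms(1)]\<close>)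
qed

lemma Ck_on_sum:
  assumes "rel_open S W" "\<And>a. a \<in> A \<Longrightarrow> Ck_on m S W (f a)"
  shows "Ck_on m S W (\<lambda>x. \<Sum>a\<in>A. f a x)"
  using assms(2)
  by (induction A rule: infinite_finite_induct) (auto intro: Ck_on_add Ck_on_const assms(1))

text \<open>Orthonormality makes the coefficients inner products, which are bounded linear in the
  vector and therefore inherit its differentiability.\<close>

lemma subspace_orthonormal_expansion:
  assumes "subspace (S::'x::euclidean_space set)"
  shows "\<exists>B. finite B \<and> B \<subseteq> S \<and> (\<forall>v\<in>S. v = (\<Sum>b\<in>B. (v \<bullet> b) *\<^sub>R b))"
proof -
  obtain B where B: "B \<subseteq> S" "pairwise orthogonal B" "\<And>x. x \<in> B \<Longrightarrow> norm x = 1"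
      "independent B" "span B = S"
    using orthonormal_basis_subspace[OF assms] by metis
  then have "finite B" by (simp add: independent_imp_finite)
  then show ?thesis
    using B orthonormal_basis_expand[OF B(2,3)] by (intro exI[of _ B]) simp
qed

text \<open>The derivative of the composite evaluates the outer derivative in the direction
  \<open>?f x v\<close>, which moves with \<open>x\<close>, whereas \<open>Ck_on\<close> controls
  fixed directions only. Expanding that direction in a fixed orthonormal basis of \<open>T\<close>
  leaves a finite sum of products, to which the induction hypothesis and the product rule
  apply.\<close>

lemma Ck_on_compose:
  assumes W: "rel_open S W" and Z: "rel_open T Z" and sub: "f ` W \<subseteq> Z"
    and f: "Ck_on m S W f" and g: "Ck_on m T Z g"
  shows "Ck_on m S W (\<lambda>x. g (f x))"
  using f g
proof (induction m arbitrary: g)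
  case 0
  then show ?case using sub continuous_on_compose2 by auto
next
  case (Suc m)
  have T: "subspace T" using Z by (simp add: rel_open_def)
  then obtain B where B: "finite B" "B \<subseteq> T" "\<And>v. v \<in> T \<Longrightarrow> v = (\<Sum>b\<in>B. (v \<bullet> b) *\<^sub>R b)"
    using subspace_orthonormal_expansion[OF T] by blast
  let ?f = "\<lambda>x v. frechet_derivative f (at x within W) v"
  let ?g = "\<lambda>x v. frechet_derivative g (at x within Z) v"
  have d: "((\<lambda>x. g (f x)) has_derivative (\<lambda>v. ?g (f x) (?f x v))) (at x within W)" if "x \<in> W" for x
    by (rule has_derivative_in_compose2[where g' = "\<lambda>y. ?g y", OF _ sub that])
      (use Ck_on_SucD(1)[OF Suc.prems(1)] Ck_on_SucD(1)[OF Suc.prems(2)] that in auto)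
  have *: "?g (f x) (?f x v) = (\<Sum>b\<in>B. (?f x v \<bullet> b) *\<^sub>R ?g (f x) b)" if "x \<in> W" "v \<in> S" for x v
  proof -
    have "?f x v \<in> T"
      by (rule has_derivative_rel_mem[OF W that Ck_on_SucD(1)[OF Suc.prems(1) that(1)] _ T])
        (use sub rel_open_subset[OF Z] in auto)
    then have "?f x v = (\<Sum>b\<in>B. (?f x v \<bullet> b) *\<^sub>R b)" by (rule B(3))
    moreover have lin: "linear (?g (f x))"
      using Ck_on_SucD(1)[OF Suc.prems(2), of "f x"] sub that has_derivative_linear by blast
    ultimately have "?g (f x) (?f x v) = ?g (f x) (\<Sum>b\<in>B. (?f x v \<bullet> b) *\<^sub>R b)" by simp
    then show ?thesis by (simp only: linear_sum[OF lin] linear_cmul[OF lin])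
  qed
  have c: "Ck_on m S W (\<lambda>x. \<Sum>b\<in>B. (?f x v \<bullet> b) *\<^sub>R ?g (f x) b)" if "v \<in> S" for v
    using B(2) that Ck_on_lower[OF Suc.prems(1)] Ck_on_SucD(2)[OF Suc.prems(1)] Ck_on_SucD(2)[OF Suc.prems(2)]
    by (intro Ck_on_sum W Ck_on_scaleR Suc.IH Ck_on_bounded_linear[OF W bounded_linear_inner_left]) auto
  show ?case
  proof (rule Ck_on_SucI[OF W d])
    show "Ck_on m S W (\<lambda>x. ?g (f x) (?f x v))" if "v \<in> S" for v
      using c[OF that] Ck_on_cong[of W "\<lambda>x. ?g (f x) (?f x v)"
          "\<lambda>x. \<Sum>b\<in>B. (?f x v \<bullet> b) *\<^sub>R ?g (f x) b" m S] * that by auto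
  qed
qed

section \<open>Closure properties of smooth maps\<close>

lemma smooth_on_const: "rel_open S W \<Longrightarrow> smooth_on S W (\<lambda>x. c)"
  by (simp add: smooth_on_def Ck_on_const)

lemma smooth_on_id: "rel_open S W \<Longrightarrow> smooth_on S W (\<lambda>x. x)"
  by (simp add: smooth_on_def Ck_on_id)

lemma smooth_on_add:
  "rel_open S W \<Longrightarrow> smooth_on S W f \<Longrightarrow> smooth_on S W g \<Longrightarrow> smooth_on S W (\<lambda>x. f x + g x)"
  by (simp add: smooth_on_def Ck_on_add)

lemma smooth_on_scaleR:
  fixes f :: "'x::euclidean_space \<Rightarrow> real"
  shows "rel_open S W \<Longrightarrow> smooth_on S W f \<Longrightarrow> smooth_on S W g \<Longrightarrow> smooth_on S W (\<lambda>x. f x *\<^sub>R g x)"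
  by (simp add: smooth_on_def Ck_on_scaleR)

lemma smooth_on_mult:
  fixes f :: "'x::euclidean_space \<Rightarrow> real"
  shows "rel_open S W \<Longrightarrow> smooth_on S W f \<Longrightarrow> smooth_on S W g \<Longrightarrow> smooth_on S W (\<lambda>x. f x * g x)"
  using smooth_on_scaleR[of S W f g] by simp

lemma smooth_on_sum:
  "rel_open S W \<Longrightarrow> (\<And>a. a \<in> A \<Longrightarrow> smooth_on S W (f a)) \<Longrightarrow> smooth_on S W (\<lambda>x. \<Sum>a\<in>A. f a x)"
  by (simp add: smooth_on_def Ck_on_sum)

lemma smooth_on_prod:
  fixes f :: "_ \<Rightarrow> 'x::euclidean_space \<Rightarrow> real"
  assumes "rel_open S W" "\<And>a. a \<in> A \<Longrightarrow> smooth_on S W (f a)"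
  shows "smooth_on S W (\<lambda>x. \<Prod>a\<in>A. f a x)"
  using assms(2)
  by (induction A rule: infinite_finite_induct) (auto intro: smooth_on_mult smooth_on_const assms(1))

lemma smooth_on_bounded_linear:
  "rel_open S W \<Longrightarrow> bounded_linear L \<Longrightarrow> smooth_on S W f \<Longrightarrow> smooth_on S W (\<lambda>x. L (f x))"
  by (simp add: smooth_on_def Ck_on_bounded_linear)

lemma smooth_on_compose:
  assumes "rel_open S W" "rel_open T Z" "f ` W \<subseteq> Z" "smooth_on S W f" "smooth_on T Z g"
  shows "smooth_on S W (\<lambda>x. g (f x))"
  using assms by (auto simp: smooth_on_def intro: Ck_on_compose)

lemma smooth_on_cong:
  "(\<And>y. y \<in> W \<Longrightarrow> f y = g y) \<Longrightarrow> smooth_on S W f \<longleftrightarrow> smooth_on S W g"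
  using Ck_on_cong[of W f g] by (simp add: smooth_on_def)

lemma smooth_on_subset:
  "rel_open S W \<Longrightarrow> rel_open S W' \<Longrightarrow> W' \<subseteq> W \<Longrightarrow> smooth_on S W f \<Longrightarrow> smooth_on S W' f"
  unfolding smooth_on_def by (blast intro: Ck_on_subset)

lemma smooth_on_vec_nth:
  "rel_open S W \<Longrightarrow> smooth_on S W f \<Longrightarrow> smooth_on S W (\<lambda>x. f x $ k)"
  by (rule smooth_on_bounded_linear[OF _ bounded_linear_vec_nth])

lemma smooth_on_componentwise:
  fixes f :: "'x::euclidean_space \<Rightarrow> real ^ 'k::finite"
  assumes "rel_open S W" "\<And>k. smooth_on S W (\<lambda>x. f x $ k)"
  shows "smooth_on S W f"
proof -
  have "smooth_on S W (\<lambda>x. \<Sum>k\<in>UNIV. (f x $ k) *\<^sub>R axis k (1::real))"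
    using assms by (intro smooth_on_sum smooth_on_scaleR smooth_on_const)
  moreover have "(\<lambda>x. \<Sum>k\<in>UNIV. (f x $ k) *\<^sub>R axis k (1::real)) = f"
    by (simp add: fun_eq_iff vec_eq_iff axis_def if_distrib[of "(*) _"] cong: if_cong)
  ultimately show ?thesis by simp
qed

lemma smooth_on_derivative:
  assumes "smooth_on S W f" "x \<in> W"
  shows "(f has_derivative frechet_derivative f (at x within W)) (at x within W)"
  using assms Ck_on_SucD(1)[of 0 S W f] by (auto simp: smooth_on_def)

lemma smooth_on_dir_deriv: "smooth_on S W f \<Longrightarrow> v \<in> S \<Longrightarrow> smooth_on S W (dir_deriv W f v)"
  unfolding smooth_on_def using Ck_on_SucD(2) by blast

lemma smooth_on_continuous: "smooth_on S W f \<Longrightarrow> continuous_on W f"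
  using Ck_on.simps(1) smooth_on_def by blast

lemma linear_dir_deriv:
  "smooth_on S W f \<Longrightarrow> x \<in> W \<Longrightarrow> linear (frechet_derivative f (at x within W))"
  using smooth_on_derivative has_derivative_linear by blast

lemma smooth_curve_derivative:
  fixes \<gamma> :: "real \<Rightarrow> 'y::real_normed_vector"
  assumes "smooth_on UNIV {-e<..<e} \<gamma>" "e > 0"
  shows "(\<gamma> has_vector_derivative vector_derivative \<gamma> (at 0)) (at 0)"
proof -
  have "\<gamma> differentiable (at 0)"
    using smooth_on_derivative[OF assms(1), of 0] assms(2)
    by (auto simp: differentiable_def at_within_open[of 0 "{-e<..<e}"])
  then show ?thesis by (simp add: vector_derivative_works)
qed

lemma has_derivative_along_curve:
  assumes "rel_open S W" "smooth_on S W f" "x \<in> W" "\<gamma> 0 = x"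
    and "(\<gamma> has_vector_derivative v) (at 0)" "\<forall>\<^sub>F t in nhds (0::real). \<gamma> t \<in> W"
  shows "((\<lambda>t. f (\<gamma> t)) has_vector_derivative dir_deriv W f v x) (at 0)"
proof -
  obtain e where e: "e > 0" "\<And>t. \<bar>t\<bar> < e \<Longrightarrow> \<gamma> t \<in> W"
    using assms(6) by (auto simp: eventually_nhds_metric dist_real_def)
  have l: "(\<gamma> has_derivative (\<lambda>t. t *\<^sub>R v)) (at 0 within ball 0 e)"
    using assms(5) by (auto simp: has_vector_derivative_def intro: has_derivative_at_withinI)
  have sub: "\<gamma> ` ball 0 e \<subseteq> W" using e by auto
  let ?D = "frechet_derivative f (at x within W)"
  have D: "(f has_derivative ?D) (at x within W)" using smooth_on_derivative assms by blast
  have "((\<lambda>t. f (\<gamma> t)) has_derivative (\<lambda>t. ?D (t *\<^sub>R v))) (at 0 within ball 0 e)"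
    using has_derivative_in_compose[OF l, of f ?D] has_derivative_subset[OF D sub] assms(4) by simp
  then have "((\<lambda>t. f (\<gamma> t)) has_derivative (\<lambda>t. ?D (t *\<^sub>R v))) (at 0)"
    using e(1) by (simp add: at_within_open[of 0 "ball 0 e"])
  moreover have "?D (t *\<^sub>R v) = t *\<^sub>R ?D v" for t
    by (rule linear_cmul[OF has_derivative_linear[OF D]])
  ultimately show ?thesis by (simp add: has_vector_derivative_def)
qed

lemma dir_deriv_mem:
  assumes "rel_open S W" "smooth_on S W f" "x \<in> W" "v \<in> S" "f ` W \<subseteq> T" "subspace T"
  shows "dir_deriv W f v x \<in> (T :: 'b::euclidean_space set)"
  using has_derivative_rel_mem[OF assms(1,3,4) smooth_on_derivative[OF assms(2,3)] assms(5,6)] .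

text \<open>Both mixed derivatives are limits of the same second difference quotient, by two applications
  of the mean value theorem.\<close>

lemma second_difference:
  fixes f :: "'x::euclidean_space \<Rightarrow> real"
  assumes "rel_open S W" "smooth_on S W f" "u \<in> S" "v \<in> S" "h > 0"
    and sq: "\<And>s t. \<lbrakk>0 \<le> s; s \<le> h; 0 \<le> t; t \<le> h\<rbrakk> \<Longrightarrow> x + s *\<^sub>R u + t *\<^sub>R v \<in> W"
  shows "\<exists>s t. 0 \<le> s \<and> s \<le> h \<and> 0 \<le> t \<and> t \<le> h \<and>
    f (x + h *\<^sub>R u + h *\<^sub>R v) - f (x + h *\<^sub>R u) - f (x + h *\<^sub>R v) + f x
      = h * h * dir_deriv W (dir_deriv W f u) v (x + s *\<^sub>R u + t *\<^sub>R v)"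
proof -
  have D: "((\<lambda>s. g (y + s *\<^sub>R w)) has_field_derivative dir_deriv W g w (y + s *\<^sub>R w)) (at s)"
    if "smooth_on S W g" "y + s *\<^sub>R w \<in> W" "w \<in> S" for g :: "'x \<Rightarrow> real" and y s w
  proof -
    have "((\<lambda>t. g ((y + s *\<^sub>R w) + t *\<^sub>R w)) has_vector_derivative dir_deriv W g w (y + s *\<^sub>R w)) (at 0)"
      using has_derivative_within_line[OF assms(1) that(2,3) smooth_on_derivative[OF that(1,2)]] .
    then have "((\<lambda>t. g (y + (s + t) *\<^sub>R w)) has_field_derivative dir_deriv W g w (y + s *\<^sub>R w)) (at 0)"
      by (simp add: has_real_derivative_iff_has_vector_derivative algebra_simps)
    then show ?thesis
      using DERIV_shift[of "\<lambda>r. g (y + r *\<^sub>R w)" "dir_deriv W g w (y + s *\<^sub>R w)" 0 s]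
      by (simp add: add.commute)
  qed
  let ?G = "\<lambda>s. f (x + h *\<^sub>R v + s *\<^sub>R u) - f (x + s *\<^sub>R u)"
  have "\<exists>z>0. z < h \<and> ?G h - ?G 0 = (h - 0) * (dir_deriv W f u (x + h *\<^sub>R v + z *\<^sub>R u) - dir_deriv W f u (x + z *\<^sub>R u))"
  proof (rule MVT2[OF assms(5)])
    fix s assume s: "0 \<le> s" "s \<le> h"
    have "x + h *\<^sub>R v + s *\<^sub>R u \<in> W" "x + s *\<^sub>R u \<in> W"
      using sq[of s h] sq[of s 0] s assms(5) by (auto simp: algebra_simps)
    then show "(?G has_real_derivative (dir_deriv W f u (x + h *\<^sub>R v + s *\<^sub>R u) - dir_deriv W f u (x + s *\<^sub>R u))) (at s)"
      by (intro DERIV_diff D assms)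
  qed
  then obtain s where s: "0 < s" "s < h" "?G h - ?G 0 =
      h * (dir_deriv W f u (x + h *\<^sub>R v + s *\<^sub>R u) - dir_deriv W f u (x + s *\<^sub>R u))" by auto
  let ?H = "\<lambda>t. dir_deriv W f u ((x + s *\<^sub>R u) + t *\<^sub>R v)"
  have "\<exists>z>0. z < h \<and> ?H h - ?H 0 = (h - 0) * dir_deriv W (dir_deriv W f u) v ((x + s *\<^sub>R u) + z *\<^sub>R v)"
    by (rule MVT2[OF assms(5)], rule D) (use smooth_on_dir_deriv assms sq s in auto)
  then obtain t where t: "0 < t" "t < h" "?H h - ?H 0 =
      h * dir_deriv W (dir_deriv W f u) v ((x + s *\<^sub>R u) + t *\<^sub>R v)" by auto
  have "f (x + h *\<^sub>R u + h *\<^sub>R v) - f (x + h *\<^sub>R u) - f (x + h *\<^sub>R v) + f x = ?G h - ?G 0"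
    by (simp add: algebra_simps)
  also have "\<dots> = h * (?H h - ?H 0)"
    using s(3) by (simp add: algebra_simps)
  finally show ?thesis using s t by (intro exI[of _ s] exI[of _ t]) auto
qed

lemma dir_deriv_symmetric:
  fixes f :: "'x::euclidean_space \<Rightarrow> real"
  assumes W: "rel_open S W" and f: "smooth_on S W f" and x: "x \<in> W" and u: "u \<in> S" and v: "v \<in> S"
  shows "dir_deriv W (dir_deriv W f u) v x = dir_deriv W (dir_deriv W f v) u x"
proof (rule ccontr)
  let ?a = "dir_deriv W (dir_deriv W f u) v" and ?b = "dir_deriv W (dir_deriv W f v) u"
  assume ne: "?a x \<noteq> ?b x"
  \<comment> \<open>Half of the supposed gap: the two functions take a common value at points near
    \<open>x\<close>, so if each of these values is within \<open>e\<close> of the value at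
    \<open>x\<close>, the triangle inequality is violated.\<close>
  define e where "e = dist (?a x) (?b x) / 2"
  have e: "e > 0" using ne by (simp add: e_def)
  have cont: "continuous_on W ?a" "continuous_on W ?b"
    by (rule smooth_on_continuous[OF smooth_on_dir_deriv[OF smooth_on_dir_deriv[OF f]]]; fact)+
  obtain d1 where d1: "d1 > 0" "\<And>y. y \<in> W \<Longrightarrow> dist y x < d1 \<Longrightarrow> dist (?a y) (?a x) < e"
    using cont(1)[unfolded continuous_on_iff, rule_format, OF x e] by auto
  obtain d2 where d2: "d2 > 0" "\<And>y. y \<in> W \<Longrightarrow> dist y x < d2 \<Longrightarrow> dist (?b y) (?b x) < e"
    using cont(2)[unfolded continuous_on_iff, rule_format, OF x e] by auto
  obtain U where U: "open U" "W = S \<inter> U" and S: "subspace S"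
    using W by (auto simp: rel_open_def openin_open)
  obtain d3 where d3: "d3 > 0" "ball x d3 \<subseteq> U" using U x by (metis IntD2 open_contains_ball)
  define d where "d = min (min d1 d2) d3"
  have d: "d > 0" using d1 d2 d3 by (simp add: d_def)
  \<comment> \<open>This step length keeps the parallelogram spanned by \<open>h u\<close> and
    \<open>h v\<close> at \<open>x\<close> within distance \<open>d\<close> of \<open>x\<close>; the
    added 1 avoids a division by zero when \<open>u\<close> and \<open>v\<close> vanish.\<close>
  define h where "h = d / (2 * (norm u + norm v + 1))"
  have nz: "norm u + norm v + 1 > 0" by (simp add: add_nonneg_pos)
  have h: "h > 0" using d nz by (simp add: h_def)
  have hd: "h * (norm u + norm v) < d"
  proof -
    have "h * (norm u + norm v) \<le> h * (norm u + norm v + 1)" using h by simp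
    also have "\<dots> = d / 2" using nz by (simp add: h_def field_simps)
    finally show ?thesis using d by simp
  qed
  have near: "dist (x + s *\<^sub>R u + t *\<^sub>R v) x < d" if "0 \<le> s" "s \<le> h" "0 \<le> t" "t \<le> h" for s t
  proof -
    have "dist (x + s *\<^sub>R u + t *\<^sub>R v) x = norm (s *\<^sub>R u + t *\<^sub>R v)"
      by (simp add: dist_norm add.assoc)
    also have "\<dots> \<le> s * norm u + t * norm v" using norm_triangle_ineq[of "s *\<^sub>R u" "t *\<^sub>R v"] that by simp
    also have "\<dots> \<le> h * norm u + h * norm v" using that by (intro add_mono mult_right_mono) auto
    finally show ?thesis using hd by (simp add: algebra_simps)
  qed
  have inW: "x + s *\<^sub>R u + t *\<^sub>R v \<in> W" if "0 \<le> s" "s \<le> h" "0 \<le> t" "t \<le> h" for s t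
  proof -
    have "x + s *\<^sub>R u + t *\<^sub>R v \<in> S" using S u v x U by (auto intro!: subspace_add subspace_scale)
    moreover have "x + s *\<^sub>R u + t *\<^sub>R v \<in> ball x d3"
      using near[OF that] by (simp add: d_def dist_commute)
    ultimately show ?thesis using d3 U by auto
  qed
  have inW': "x + s *\<^sub>R v + t *\<^sub>R u \<in> W" if "0 \<le> s" "s \<le> h" "0 \<le> t" "t \<le> h" for s t
    using inW[of t s] that by (simp add: algebra_simps)
  obtain s t where st: "0 \<le> s" "s \<le> h" "0 \<le> t" "t \<le> h"
    "f (x + h *\<^sub>R u + h *\<^sub>R v) - f (x + h *\<^sub>R u) - f (x + h *\<^sub>R v) + f x
      = h * h * ?a (x + s *\<^sub>R u + t *\<^sub>R v)"
    using second_difference[OF W f u v h inW] by blast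
  obtain s' t' where st': "0 \<le> s'" "s' \<le> h" "0 \<le> t'" "t' \<le> h"
    "f (x + h *\<^sub>R v + h *\<^sub>R u) - f (x + h *\<^sub>R v) - f (x + h *\<^sub>R u) + f x
      = h * h * ?b (x + s' *\<^sub>R v + t' *\<^sub>R u)"
    using second_difference[OF W f v u h inW'] by blast
  have "h * h * ?a (x + s *\<^sub>R u + t *\<^sub>R v) = h * h * ?b (x + s' *\<^sub>R v + t' *\<^sub>R u)"
    using st(5) st'(5) by (simp add: algebra_simps)
  then have "?a (x + s *\<^sub>R u + t *\<^sub>R v) = ?b (x + s' *\<^sub>R v + t' *\<^sub>R u)" using h by simp
  moreover have "dist (?a (x + s *\<^sub>R u + t *\<^sub>R v)) (?a x) < e"
    using near[OF st(1-4)] inW[OF st(1-4)] by (intro d1) (auto simp: d_def)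
  moreover have "dist (?b (x + s' *\<^sub>R v + t' *\<^sub>R u)) (?b x) < e"
    using near[of t' s'] inW'[OF st'(1-4)] st' by (intro d2) (auto simp: d_def algebra_simps)
  ultimately show False
    using dist_triangle3[of "?a x" "?b x" "?a (x + s *\<^sub>R u + t *\<^sub>R v)"] by (simp add: e_def)
qed

section \<open>Charts, curves and tangent vectors\<close>

lemma subspace_coord_space: "subspace (coord_space K)"
  by (auto simp: coord_space_def subspace_def)

lemma rel_open_model_iff: "rel_open (coord_space K) W \<longleftrightarrow> openin (top_of_set (coord_space K)) W"
  by (simp add: rel_open_def subspace_coord_space)

text \<open>The part of \<^const>\<open>smooth_manifold\<close> that concerns the charts only; unlike the topological
  conditions, it is inherited by the bundles at no cost.\<close>

locale charted =
  fixes N :: "('a, 'i, 'k::finite) manifold"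
  assumes cover: "(\<Union>i\<in>idx N. cdom N i) = pts N"
    and inj_crd: "i \<in> idx N \<Longrightarrow> inj_on (crd N i) (cdom N i)"
    and open_overlap: "i \<in> idx N \<Longrightarrow> j \<in> idx N \<Longrightarrow>
      rel_open (model N) (crd N i ` (cdom N i \<inter> cdom N j))"
    and smooth_transition: "i \<in> idx N \<Longrightarrow> j \<in> idx N \<Longrightarrow>
      smooth_on (model N) (crd N i ` (cdom N i \<inter> cdom N j)) (crd N j \<circ> par N i)"

lemma smooth_manifold_charted: "smooth_manifold N \<Longrightarrow> charted N"
  unfolding smooth_manifold_def charted_def rel_open_model_iff by blast

abbreviation chart_vel :: "('a, 'i, 'k::finite) manifold \<Rightarrow> 'i \<Rightarrow> (real \<Rightarrow> 'a) \<Rightarrow> real ^ 'k" where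
  "chart_vel N i \<gamma> \<equiv> vector_derivative (crd N i \<circ> \<gamma>) (at 0)"

definition transition_jacobian ::
  "('a, 'i, 'k::finite) manifold \<Rightarrow> 'i \<Rightarrow> 'i \<Rightarrow> real ^ 'k \<Rightarrow> real ^ 'k \<Rightarrow> real ^ 'k"
where
  "transition_jacobian N i j v = dir_deriv (crd N i ` (cdom N i \<inter> cdom N j)) (crd N j \<circ> par N i) v"

text \<open>For velocities in the coordinate space this is the inverse of \<open>vel N i\<close> on
  the tangent space at \<open>p\<close>.\<close>

definition line_vec :: "('a, 'i, 'k::finite) manifold \<Rightarrow> 'i \<Rightarrow> 'a \<Rightarrow> real ^ 'k \<Rightarrow> 'a tvec" where
  "line_vec N i p v = tangent N (\<lambda>t. par N i (crd N i p + t *\<^sub>R v))"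

lemma coord_vec_line_vec: "coord_vec N i p k = line_vec N i p (axis k 1)"
  by (simp add: coord_vec_def line_vec_def)

lemma axis_coord_space [simp]: "axis k (1::real) \<in> coord_space K \<longleftrightarrow> k \<in> K"
  by (auto simp: coord_space_def axis_def)

lemma eventually_nhds0_interval:
  "(\<forall>\<^sub>F t in nhds (0::real). P t) \<longleftrightarrow> (\<exists>e>0. \<forall>t. \<bar>t\<bar> < e \<longrightarrow> P t)"
  by (auto simp: eventually_nhds_metric dist_real_def)

lemma image_interval_subset:
  "f ` {-e<..<e::real} \<subseteq> S \<longleftrightarrow> (\<forall>t. \<bar>t\<bar> < e \<longrightarrow> f t \<in> S)"
  by (auto simp: abs_less_iff image_subset_iff)

lemma vector_derivative_eventually_cong:
  assumes "\<forall>\<^sub>F t in nhds 0. f t = g t"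
  shows "vector_derivative f (at 0) = vector_derivative g (at (0::real))"
proof -
  have "(f has_vector_derivative d) (at 0) \<longleftrightarrow> (g has_vector_derivative d) (at 0)" for d
    using assms has_vector_derivative_cong_ev[where x = 0 and S = UNIV and f = f and g = g and f' = d]
    by (simp add: eventually_nhds_x_imp_x[of "\<lambda>t. f t = g t"])
  then show ?thesis by (simp add: vector_derivative_def)
qed

context charted
begin

section \<open>Charts and curves\<close>

lemma open_chart: "i \<in> idx N \<Longrightarrow> rel_open (model N) (crd N i ` cdom N i)"
  using open_overlap[of i i] by simp

lemma par_crd [simp]: "i \<in> idx N \<Longrightarrow> p \<in> cdom N i \<Longrightarrow> par N i (crd N i p) = p"
  by (simp add: par_def inj_crd)

lemma crd_par [simp]: "i \<in> idx N \<Longrightarrow> y \<in> crd N i ` cdom N i \<Longrightarrow> crd N i (par N i y) = y"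
  by (simp add: par_def f_inv_into_f)

lemma par_mem: "i \<in> idx N \<Longrightarrow> y \<in> crd N i ` cdom N i \<Longrightarrow> par N i y \<in> cdom N i"
  by (simp add: par_def inv_into_into)

lemma crd_eqD: "i \<in> idx N \<Longrightarrow> p \<in> cdom N i \<Longrightarrow> q \<in> cdom N i \<Longrightarrow> crd N i p = crd N i q \<Longrightarrow> p = q"
  using inj_crd by (auto dest: inj_onD)

lemma crd_model: "i \<in> idx N \<Longrightarrow> p \<in> cdom N i \<Longrightarrow> crd N i p \<in> model N"
  using rel_open_subset[OF open_chart] by auto

lemma cdom_pts: "i \<in> idx N \<Longrightarrow> p \<in> cdom N i \<Longrightarrow> p \<in> pts N"
  using cover by auto

lemma pts_chart: "p \<in> pts N \<Longrightarrow> \<exists>i\<in>idx N. p \<in> cdom N i"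
  using cover by auto

lemma continuous_in_rel_open:
  fixes y :: "real \<Rightarrow> _"
  assumes "rel_open S W" "continuous_on {-e<..<e} y" "e > 0" "y 0 \<in> W"
    and "y ` {-e<..<e} \<subseteq> S"
  shows "\<exists>d>0. d \<le> e \<and> y ` {-d<..<d} \<subseteq> W"
proof -
  obtain U where U: "open U" "W = S \<inter> U"
    using assms(1) by (auto simp: rel_open_def openin_open)
  have "open (y -` U \<inter> {-e<..<e})"
    using continuous_open_preimage[OF assms(2) _ U(1)] by (simp add: Int_commute del: vimage_Int)
  moreover have "0 \<in> y -` U \<inter> {-e<..<e}" using assms U by auto
  ultimately obtain d where d: "d > 0" "ball 0 d \<subseteq> y -` U \<inter> {-e<..<e}"
    using open_contains_ball by blast
  have "y t \<in> W" if "\<bar>t\<bar> < min d e" for t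
  proof -
    have "t \<in> y -` U \<inter> {-e<..<e}" using that by (intro subsetD[OF d(2)]) simp
    then show ?thesis using U assms(5) by (auto simp: image_subset_iff)
  qed
  then show ?thesis using d assms(3)
    by (intro exI[of _ "min d e"]) (simp add: image_interval_subset)
qed

text \<open>\<open>curve\<close> provides a single chart. Continuity of the coordinates keeps the
  curve for a while in the overlap with any other chart around \<open>\<gamma> 0\<close>, and the
  transition map carries the smoothness over.\<close>

lemma curve_chart:
  assumes "curve N \<gamma>" "i \<in> idx N" "\<gamma> 0 \<in> cdom N i"
  shows "\<exists>e>0. \<gamma> ` {-e<..<e} \<subseteq> cdom N i \<and> smooth_on UNIV {-e<..<e} (crd N i \<circ> \<gamma>)"
proof -
  obtain j e where j: "j \<in> idx N" "e > 0" "\<gamma> ` {-e<..<e} \<subseteq> cdom N j"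
      "smooth_on UNIV {-e<..<e} (crd N j \<circ> \<gamma>)"
    using assms(1) by (auto simp: curve_def)
  let ?W = "crd N j ` (cdom N j \<inter> cdom N i)"
  have W: "rel_open (model N) ?W" by (rule open_overlap[OF j(1) assms(2)])
  have "\<gamma> 0 \<in> cdom N j" using j by auto
  then have "\<exists>d>0. d \<le> e \<and> (crd N j \<circ> \<gamma>) ` {-d<..<d} \<subseteq> ?W"
    using assms j crd_model
    by (intro continuous_in_rel_open[OF W smooth_on_continuous[OF j(4)]]) auto
  then obtain d where d: "d > 0" "d \<le> e" "(crd N j \<circ> \<gamma>) ` {-d<..<d} \<subseteq> ?W" by blast
  \<comment> \<open>Coordinates in the image of the overlap come from some point \<open>q\<close> of
    the overlap; injectivity of the chart identifies \<open>q\<close> with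
    \<open>\<gamma> t\<close>.\<close>
  have mem: "\<gamma> t \<in> cdom N j" "\<gamma> t \<in> cdom N i" if "t \<in> {-d<..<d}" for t
  proof -
    show "\<gamma> t \<in> cdom N j" using j(3) d(2) that by auto
    moreover have "(crd N j \<circ> \<gamma>) t \<in> ?W" using d(3) that by blast
    then obtain q where "q \<in> cdom N j" "q \<in> cdom N i" "crd N j (\<gamma> t) = crd N j q"
      by auto
    ultimately show "\<gamma> t \<in> cdom N i" using crd_eqD[OF j(1), of "\<gamma> t" q] by simp
  qed
  have sm: "smooth_on UNIV {-d<..<d} (crd N j \<circ> \<gamma>)"
    by (rule smooth_on_subset[OF _ _ _ j(4)]) (use d in \<open>auto intro: rel_open_UNIV\<close>)
  have "smooth_on UNIV {-d<..<d} (\<lambda>t. (crd N i \<circ> par N j) ((crd N j \<circ> \<gamma>) t))"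
    by (rule smooth_on_compose[OF _ W d(3) sm smooth_transition[OF j(1) assms(2)]])
      (auto intro: rel_open_UNIV)
  then have "smooth_on UNIV {-d<..<d} (crd N i \<circ> \<gamma>)"
    by (rule smooth_on_cong[THEN iffD1, rotated]) (simp add: j(1) mem)
  then show ?thesis using mem d by auto
qed

lemma curve_eventually_chart:
  assumes "curve N \<gamma>" "i \<in> idx N" "\<gamma> 0 \<in> cdom N i"
  shows "\<forall>\<^sub>F t in nhds 0. \<gamma> t \<in> cdom N i"
proof -
  obtain e where "e > 0" "\<gamma> ` {-e<..<e} \<subseteq> cdom N i"
    using curve_chart[OF assms] by blast
  then show ?thesis
    unfolding eventually_nhds0_interval by (intro exI[of _ e]) (simp add: image_interval_subset)
qed

lemma curve_has_derivative:
  assumes "curve N \<gamma>" "i \<in> idx N" "\<gamma> 0 \<in> cdom N i"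
  shows "((\<lambda>t. crd N i (\<gamma> t)) has_vector_derivative chart_vel N i \<gamma>) (at 0)"
  using curve_chart[OF assms] smooth_curve_derivative by (fastforce simp: comp_def)

lemma curve_pts: "curve N \<gamma> \<Longrightarrow> \<gamma> 0 \<in> pts N"
proof -
  assume "curve N \<gamma>"
  then obtain i e where "i \<in> idx N" "e > 0" "\<gamma> ` {-e<..<e} \<subseteq> cdom N i"
    by (auto simp: curve_def)
  then show ?thesis using cdom_pts[of i "\<gamma> 0"] by (auto simp: image_interval_subset)
qed

lemma curveI:
  assumes "i \<in> idx N" "e > 0" "\<And>t. \<bar>t\<bar> < e \<Longrightarrow> \<gamma> t \<in> cdom N i \<and> crd N i (\<gamma> t) = y t"
    and "smooth_on UNIV {-e<..<e} y"
  shows "curve N \<gamma>" "chart_vel N i \<gamma> = vector_derivative y (at 0)"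
proof -
  have "smooth_on UNIV {-e<..<e} (crd N i \<circ> \<gamma>)"
    by (rule smooth_on_cong[THEN iffD1, OF _ assms(4)]) (use assms(3) in auto)
  moreover have "\<gamma> ` {-e<..<e} \<subseteq> cdom N i" using assms(3) by (auto simp: image_interval_subset)
  ultimately show "curve N \<gamma>" using assms by (auto simp: curve_def)
  show "chart_vel N i \<gamma> = vector_derivative y (at 0)"
    by (rule vector_derivative_eventually_cong)
      (use assms in \<open>auto simp: eventually_nhds0_interval intro!: exI[of _ e]\<close>)
qed

lemma chart_vel_model:
  assumes "curve N \<gamma>" "i \<in> idx N" "\<gamma> 0 \<in> cdom N i"
  shows "chart_vel N i \<gamma> \<in> model N"
proof -
  obtain e where e: "e > 0" "\<gamma> ` {-e<..<e} \<subseteq> cdom N i" "smooth_on UNIV {-e<..<e} (crd N i \<circ> \<gamma>)"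
    using curve_chart[OF assms] by blast
  have R: "rel_open UNIV {-e<..<e}" by (simp add: rel_open_UNIV)
  have "dir_deriv {-e<..<e} (crd N i \<circ> \<gamma>) 1 0 \<in> model N"
    by (rule dir_deriv_mem[OF R e(3)]) (use e assms crd_model subspace_coord_space in auto)
  moreover have "((\<lambda>t. (crd N i \<circ> \<gamma>) (0 + t *\<^sub>R 1)) has_vector_derivative
      dir_deriv {-e<..<e} (crd N i \<circ> \<gamma>) 1 0) (at 0)"
    by (rule has_derivative_within_line[OF R _ _ smooth_on_derivative[OF e(3)]]) (use e in auto)
  then have "chart_vel N i \<gamma> = dir_deriv {-e<..<e} (crd N i \<circ> \<gamma>) 1 0"
    by (intro vector_derivative_at) (simp add: comp_def)
  ultimately show ?thesis by simp
qed

lemma chart_vel_transition: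
  assumes "curve N \<gamma>" "i \<in> idx N" "\<gamma> 0 \<in> cdom N i" "j \<in> idx N" "\<gamma> 0 \<in> cdom N j"
  shows "chart_vel N j \<gamma> = transition_jacobian N i j (chart_vel N i \<gamma>) (crd N i (\<gamma> 0))"
proof -
  let ?W = "crd N i ` (cdom N i \<inter> cdom N j)"
  have ev: "\<forall>\<^sub>F t in nhds 0. \<gamma> t \<in> cdom N i \<and> \<gamma> t \<in> cdom N j"
    using curve_eventually_chart assms by (simp add: eventually_conj)
  have "((\<lambda>t. (crd N j \<circ> par N i) (crd N i (\<gamma> t))) has_vector_derivative
      dir_deriv ?W (crd N j \<circ> par N i) (chart_vel N i \<gamma>) (crd N i (\<gamma> 0))) (at 0)"
    by (rule has_derivative_along_curve[OF open_overlap smooth_transition _ _ curve_has_derivative])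
      (use assms ev in \<open>auto elim: eventually_mono\<close>)
  then have "vector_derivative (\<lambda>t. (crd N j \<circ> par N i) (crd N i (\<gamma> t))) (at 0)
      = transition_jacobian N i j (chart_vel N i \<gamma>) (crd N i (\<gamma> 0))"
    by (simp only: vector_derivative_at transition_jacobian_def)
  moreover have "chart_vel N j \<gamma> = vector_derivative (\<lambda>t. (crd N j \<circ> par N i) (crd N i (\<gamma> t))) (at 0)"
    by (rule vector_derivative_eventually_cong) (use ev assms in \<open>auto elim!: eventually_mono\<close>)
  ultimately show ?thesis by simp
qed

lemma linear_transition_jacobian:
  assumes "i \<in> idx N" "j \<in> idx N" "p \<in> cdom N i" "p \<in> cdom N j"
  shows "linear (\<lambda>v. transition_jacobian N i j v (crd N i p))"
  unfolding transition_jacobian_def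
  by (rule linear_dir_deriv[OF smooth_transition]) (use assms in auto)

section \<open>Tangent vectors as 1-jets of curves\<close>

lemma tangent_self: "curve N \<gamma> \<Longrightarrow> \<gamma> \<in> tangent N \<gamma>"
  by (simp add: tangent_def)

text \<open>Velocities in different charts are related by the transition Jacobian at the common
  foot, so agreement in one chart forces agreement in all the charts that \<open>tangent\<close>
  asks about.\<close>

lemma tangent_eqI:
  assumes "curve N \<gamma>" "curve N \<delta>" "\<gamma> 0 = \<delta> 0" "i \<in> idx N" "\<gamma> 0 \<in> cdom N i"
    and "chart_vel N i \<gamma> = chart_vel N i \<delta>"
  shows "tangent N \<gamma> = tangent N \<delta>"
proof -
  have "chart_vel N j \<gamma> = chart_vel N j \<delta>" if "j \<in> idx N" "\<gamma> 0 \<in> cdom N j" for j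
    using chart_vel_transition[OF assms(1,4,5) that] chart_vel_transition[OF assms(2,4) _ that(1)] assms that
    by simp
  then show ?thesis using assms(3) by (auto simp: tangent_def)
qed

lemma tangent_memD:
  assumes "\<delta> \<in> tangent N \<gamma>"
  shows "curve N \<delta>" "\<delta> 0 = \<gamma> 0" "i \<in> idx N \<Longrightarrow> \<gamma> 0 \<in> cdom N i \<Longrightarrow> chart_vel N i \<delta> = chart_vel N i \<gamma>"
    "tangent N \<delta> = tangent N \<gamma>"
  using assms by (auto simp: tangent_def)

lemma rep_tangent: "curve N \<gamma> \<Longrightarrow> rep (tangent N \<gamma>) \<in> tangent N \<gamma>"
  unfolding rep_def by (rule someI[of _ \<gamma>]) (rule tangent_self)

lemma foot_tangent: "curve N \<gamma> \<Longrightarrow> foot (tangent N \<gamma>) = \<gamma> 0"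
  using tangent_memD(2)[OF rep_tangent] by (simp add: foot_def)

lemma vel_tangent: "curve N \<gamma> \<Longrightarrow> i \<in> idx N \<Longrightarrow> \<gamma> 0 \<in> cdom N i \<Longrightarrow>
    vel N i (tangent N \<gamma>) = chart_vel N i \<gamma>"
  using tangent_memD(3)[OF rep_tangent] by (simp add: vel_def)

lemma tangent_pts: "curve N \<gamma> \<Longrightarrow> tangent N \<gamma> \<in> pts (tangent_bundle N)"
  by (auto simp: tangent_bundle_def)

lemma tangent_bundleE:
  assumes "w \<in> pts (tangent_bundle N)"
  obtains \<gamma> where "curve N \<gamma>" "w = tangent N \<gamma>"
  using assms by (auto simp: tangent_bundle_def)

lemma rep_pts:
  assumes "w \<in> pts (tangent_bundle N)"
  shows "curve N (rep w)" "tangent N (rep w) = w" "rep w 0 = foot w" "foot w \<in> pts N"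
proof -
  obtain \<delta> where \<delta>: "curve N \<delta>" "w = tangent N \<delta>" using assms by (rule tangent_bundleE)
  from tangent_memD[OF rep_tangent[OF \<delta>(1)]]
  show "curve N (rep w)" "tangent N (rep w) = w" "rep w 0 = foot w" "foot w \<in> pts N"
    using \<delta> by (auto simp: foot_tangent curve_pts)
qed

lemma vel_transition:
  assumes "w \<in> pts (tangent_bundle N)" "i \<in> idx N" "foot w \<in> cdom N i" "j \<in> idx N" "foot w \<in> cdom N j"
  shows "vel N j w = transition_jacobian N i j (vel N i w) (crd N i (foot w))"
  using chart_vel_transition[OF rep_pts(1)[OF assms(1)], of i j] assms
  by (simp add: vel_def rep_pts)

lemma vel_model:
  assumes "w \<in> pts (tangent_bundle N)" "i \<in> idx N" "foot w \<in> cdom N i"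
  shows "vel N i w \<in> model N"
  using chart_vel_model[OF rep_pts(1)[OF assms(1)], of i] assms by (simp add: vel_def rep_pts)

lemma tvec_eqI:
  assumes "w \<in> pts (tangent_bundle N)" "w' \<in> pts (tangent_bundle N)" "foot w = foot w'"
    and "i \<in> idx N" "foot w \<in> cdom N i" "vel N i w = vel N i w'"
  shows "w = w'"
  using tangent_eqI[OF rep_pts(1)[OF assms(1)] rep_pts(1)[OF assms(2)], of i] assms
  by (simp add: vel_def rep_pts)

lemma line_eventually:
  assumes "i \<in> idx N" "p \<in> cdom N i" "v \<in> model N"
  shows "\<exists>e>0. \<forall>t. \<bar>t\<bar> < e \<longrightarrow> crd N i p + t *\<^sub>R v \<in> crd N i ` cdom N i"
  using rel_open_line[OF open_chart[OF assms(1)] _ assms(3)] assms(2) by auto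

lemma smooth_on_line: "open W \<Longrightarrow> smooth_on UNIV W (\<lambda>t::real. x + t *\<^sub>R v)"
  by (intro smooth_on_add smooth_on_const smooth_on_scaleR smooth_on_id rel_open_UNIV)

lemma vector_derivative_line: "vector_derivative (\<lambda>t::real. x + t *\<^sub>R v) (at 0) = v"
  by (rule vector_derivative_at) (auto intro!: derivative_eq_intros simp: has_vector_derivative_def)

lemma line_curve:
  assumes "i \<in> idx N" "p \<in> cdom N i" "v \<in> model N"
  shows "curve N (\<lambda>t. par N i (crd N i p + t *\<^sub>R v))"
    and "chart_vel N i (\<lambda>t. par N i (crd N i p + t *\<^sub>R v)) = v"
proof -
  obtain e where e: "e > 0" "\<forall>t. \<bar>t\<bar> < e \<longrightarrow> crd N i p + t *\<^sub>R v \<in> crd N i ` cdom N i"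
    using line_eventually[OF assms] by blast
  show "curve N (\<lambda>t. par N i (crd N i p + t *\<^sub>R v))"
    by (rule curveI(1)[OF assms(1) e(1) _ smooth_on_line[of "{-e<..<e}" "crd N i p" v]])
      (use e assms par_mem in auto)
  show "chart_vel N i (\<lambda>t. par N i (crd N i p + t *\<^sub>R v)) = v"
    by (subst curveI(2)[OF assms(1) e(1) _ smooth_on_line[of "{-e<..<e}" "crd N i p" v]])
      (use e assms par_mem vector_derivative_line in auto)
qed

lemma line_vec:
  assumes "i \<in> idx N" "p \<in> cdom N i" "v \<in> model N"
  shows "line_vec N i p v \<in> tangent_space N p" "vel N i (line_vec N i p v) = v"
    "foot (line_vec N i p v) = p" "line_vec N i p v \<in> pts (tangent_bundle N)"
  using line_curve[OF assms] assms
  by (auto simp: line_vec_def tangent_space_def foot_tangent vel_tangent tangent_pts)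

lemma line_vec_vel:
  assumes "w \<in> tangent_space N p" "i \<in> idx N" "p \<in> cdom N i"
  shows "line_vec N i p (vel N i w) = w"
  using assms line_vec[OF assms(2,3)] vel_model
  by (intro tvec_eqI[where i = i]) (auto simp: tangent_space_def)

lemma tangent_space_eqI:
  assumes "u \<in> tangent_space N p" "v \<in> tangent_space N p" "i \<in> idx N" "p \<in> cdom N i"
    "vel N i u = vel N i v"
  shows "u = v"
  using assms line_vec_vel by metis

text \<open>The definition asks for one vector with the right velocity in every chart at once. It is
  built in one chart \<open>j\<close> by \<open>line_vec\<close>; linearity of the transition
  Jacobians settles the other charts, and one chart already forces uniqueness.\<close>

lemma lincomb:
  assumes "u \<in> tangent_space N p" "v \<in> tangent_space N p"
  shows "lincomb N a u b v \<in> tangent_space N p"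
    and "i \<in> idx N \<Longrightarrow> p \<in> cdom N i \<Longrightarrow> vel N i (lincomb N a u b v) = a *\<^sub>R vel N i u + b *\<^sub>R vel N i v"
proof -
  let ?P = "\<lambda>w. w \<in> tangent_space N (foot u) \<and>
     (\<forall>i\<in>idx N. foot u \<in> cdom N i \<longrightarrow> vel N i w = a *\<^sub>R vel N i u + b *\<^sub>R vel N i v)"
  have u: "u \<in> pts (tangent_bundle N)" "foot u = p" and v: "v \<in> pts (tangent_bundle N)" "foot v = p"
    using assms by (auto simp: tangent_space_def)
  obtain j where j: "j \<in> idx N" "p \<in> cdom N j"
    using pts_chart rep_pts(4)[OF u(1)] u(2) by auto
  define w where "w = line_vec N j p (a *\<^sub>R vel N j u + b *\<^sub>R vel N j v)"
  have m: "a *\<^sub>R vel N j u + b *\<^sub>R vel N j v \<in> model N"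
    using vel_model u v j subspace_coord_space by (auto intro!: subspace_add subspace_scale)
  note w = line_vec[OF j m, folded w_def]
  have Pw: "?P w"
  proof (intro conjI ballI impI)
    show "w \<in> tangent_space N (foot u)" using w u by simp
    fix i assume i: "i \<in> idx N" "foot u \<in> cdom N i"
    have L: "linear (\<lambda>v. transition_jacobian N j i v (crd N j p))"
      using linear_transition_jacobian j i u by simp
    have "vel N i w = transition_jacobian N j i (vel N j w) (crd N j p)"
      using vel_transition[OF w(4) j(1) _ i(1)] w j i u by simp
    then show "vel N i w = a *\<^sub>R vel N i u + b *\<^sub>R vel N i v"
      using vel_transition[OF u(1) j(1) _ i(1)] vel_transition[OF v(1) j(1) _ i(1)] w u v i j
      by (simp add: linear_add[OF L] linear_cmul[OF L])
  qed
  have "w' = w" if "?P w'" for w'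
    by (rule tangent_space_eqI[of _ p _ j]) (use that Pw j u in auto)
  then have "(THE w. ?P w) = w" using Pw by (intro the_equality) blast+
  then have eq: "lincomb N a u b v = w" by (simp add: lincomb_def)
  show "lincomb N a u b v \<in> tangent_space N p" using eq w by simp
  show "i \<in> idx N \<Longrightarrow> p \<in> cdom N i \<Longrightarrow> vel N i (lincomb N a u b v) = a *\<^sub>R vel N i u + b *\<^sub>R vel N i v"
    using Pw eq u by simp
qed

end

section \<open>Tangent maps\<close>

lemma smooth_mapD:
  assumes "smooth_map N N' f" "p \<in> pts N"
  shows "\<exists>i j W. i \<in> idx N \<and> j \<in> idx N' \<and> p \<in> cdom N i \<and> f p \<in> cdom N' j \<and> crd N i p \<in> W \<and>
    W \<subseteq> crd N i ` cdom N i \<and> rel_open (model N) W \<and> (\<forall>y\<in>W. f (par N i y) \<in> cdom N' j) \<and>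
    smooth_on (model N) W (\<lambda>y. crd N' j (f (par N i y)))"
  using conjunct2[OF smooth_map_def[THEN iffD1, OF assms(1)], rule_format, OF assms(2)]
  unfolding rel_open_model_iff Bex_def by (elim exE conjE, intro exI conjI)

text \<open>In charts where \<open>f\<close> is smooth, the velocity of the image curve is the
  derivative of the coordinate expression of \<open>f\<close> in the direction of the velocity of
  the curve. It depends on the 1-jet only, which makes \<open>tmap\<close> independent of the
  representative picked by \<open>rep\<close>.\<close>

lemma smooth_map_curve:
  assumes "charted N" "charted N'" "smooth_map N N' f" "curve N \<gamma>"
  shows "curve N' (f \<circ> \<gamma>)"
    and "curve N \<delta> \<Longrightarrow> tangent N \<gamma> = tangent N \<delta> \<Longrightarrow> tangent N' (f \<circ> \<gamma>) = tangent N' (f \<circ> \<delta>)"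
proof -
  interpret N: charted N by fact
  interpret N': charted N' by fact
  have "\<gamma> 0 \<in> pts N" using N.curve_pts assms(4) .
  then obtain i j W where ij: "i \<in> idx N" "j \<in> idx N'" "\<gamma> 0 \<in> cdom N i" "f (\<gamma> 0) \<in> cdom N' j"
    and W: "crd N i (\<gamma> 0) \<in> W" "W \<subseteq> crd N i ` cdom N i" "rel_open (model N) W"
    and f: "\<And>y. y \<in> W \<Longrightarrow> f (par N i y) \<in> cdom N' j"
      "smooth_on (model N) W (\<lambda>y. crd N' j (f (par N i y)))"
    using smooth_mapD[OF assms(3)] by metis
  let ?F = "\<lambda>y. crd N' j (f (par N i y))"
  have *: "curve N' (f \<circ> \<delta>) \<and> chart_vel N' j (f \<circ> \<delta>) = dir_deriv W ?F (chart_vel N i \<delta>) (crd N i (\<delta> 0))"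
    if \<delta>: "curve N \<delta>" "\<delta> 0 = \<gamma> 0" for \<delta>
  proof -
    obtain e where e: "e > 0" "\<delta> ` {-e<..<e} \<subseteq> cdom N i" "smooth_on UNIV {-e<..<e} (crd N i \<circ> \<delta>)"
      using N.curve_chart[OF \<delta>(1) ij(1)] \<delta>(2) ij(3) by auto
    have "\<exists>d>0. d \<le> e \<and> (crd N i \<circ> \<delta>) ` {-d<..<d} \<subseteq> W"
      using N.crd_model[OF ij(1)] e \<delta>(2) W(1)
      by (intro N.continuous_in_rel_open[OF W(3) smooth_on_continuous[OF e(3)]]) auto
    then obtain d where d: "d > 0" "d \<le> e" "(crd N i \<circ> \<delta>) ` {-d<..<d} \<subseteq> W" by blast
    have sm: "smooth_on UNIV {-d<..<d} (crd N i \<circ> \<delta>)"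
      by (rule smooth_on_subset[OF _ _ _ e(3)]) (use d in \<open>auto intro: rel_open_UNIV\<close>)
    have sm2: "smooth_on UNIV {-d<..<d} (\<lambda>t. ?F ((crd N i \<circ> \<delta>) t))"
      by (rule smooth_on_compose[OF _ W(3) d(3) sm f(2)]) (auto intro: rel_open_UNIV)
    have dl: "\<delta> t \<in> cdom N i" "crd N i (\<delta> t) \<in> W" if "\<bar>t\<bar> < d" for t
      using that d e by (auto simp: image_interval_subset)
    have mem: "(f \<circ> \<delta>) t \<in> cdom N' j \<and> crd N' j ((f \<circ> \<delta>) t) = ?F ((crd N i \<circ> \<delta>) t)" if "\<bar>t\<bar> < d" for t
      using dl[OF that] f(1)[of "crd N i (\<delta> t)"] ij by simp
    note c = N'.curveI[OF ij(2) d(1) mem sm2]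
    have "((\<lambda>t. ?F (crd N i (\<delta> t))) has_vector_derivative
        dir_deriv W ?F (chart_vel N i \<delta>) (crd N i (\<delta> 0))) (at 0)"
      by (rule has_derivative_along_curve[OF W(3) f(2) _ _ N.curve_has_derivative[OF \<delta>(1) ij(1)]])
        (use W ij \<delta> dl d(1) in \<open>auto simp: eventually_nhds0_interval\<close>)
    then show ?thesis using c vector_derivative_at by fastforce
  qed
  show "curve N' (f \<circ> \<gamma>)" using *[OF assms(4)] by simp
  assume \<delta>: "curve N \<delta>" "tangent N \<gamma> = tangent N \<delta>"
  then have "\<gamma> \<in> tangent N \<delta>" using N.tangent_self[OF assms(4)] by simp
  note m = N.tangent_memD[OF this]
  show "tangent N' (f \<circ> \<gamma>) = tangent N' (f \<circ> \<delta>)"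
    by (rule N'.tangent_eqI[where i = j]) (use *[OF assms(4)] *[OF \<delta>(1)] m ij in auto)
qed

lemma tmap_tangent:
  assumes "charted N" "charted N'" "smooth_map N N' f" "curve N \<gamma>"
  shows "tmap N' f (tangent N \<gamma>) = tangent N' (f \<circ> \<gamma>)"
proof -
  interpret N: charted N by fact
  note m = N.tangent_memD[OF N.rep_tangent[OF assms(4)]]
  show ?thesis unfolding tmap_def
    by (rule smooth_map_curve(2)[OF assms(1-3) m(1) assms(4) m(4)])
qed

section \<open>Alternating forms\<close>

abbreviation swap :: "nat \<Rightarrow> nat \<Rightarrow> nat \<Rightarrow> nat" where
  "swap \<equiv> Transposition.transpose"

text \<open>The conditions of \<open>forms\<close>, freed from the manifold. Tangent vectors do not
  form a vector space type, so linearity is relative to a carrier \<open>T\<close> and to an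
  operation \<open>lc\<close> that stands for linear combination.\<close>

definition alt_forms ::
  "'v set \<Rightarrow> (real \<Rightarrow> 'v \<Rightarrow> real \<Rightarrow> 'v \<Rightarrow> 'v) \<Rightarrow> nat \<Rightarrow> ('v list \<Rightarrow> real) set"
where
  "alt_forms T lc r = {\<omega>.
     (\<forall>vs. \<not> (length vs = r \<and> set vs \<subseteq> T) \<longrightarrow> \<omega> vs = 0) \<and>
     (\<forall>vs j a u b v. length vs = r \<and> set vs \<subseteq> T \<and> j < r \<and> u \<in> T \<and> v \<in> T \<longrightarrow>
        \<omega> (vs[j := lc a u b v]) = a * \<omega> (vs[j := u]) + b * \<omega> (vs[j := v])) \<and>
     (\<forall>vs. \<not> distinct vs \<longrightarrow> \<omega> vs = 0)}"

lemma forms_alt_forms: "forms N r p = alt_forms (tangent_space N p) (lincomb N) r"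
  by (simp add: forms_def alt_forms_def)

lemma alt_forms_off: "\<omega> \<in> alt_forms T lc r \<Longrightarrow> \<not> (length vs = r \<and> set vs \<subseteq> T) \<Longrightarrow> \<omega> vs = 0"
  by (simp add: alt_forms_def)

lemma alt_forms_nondistinct: "\<omega> \<in> alt_forms T lc r \<Longrightarrow> \<not> distinct vs \<Longrightarrow> \<omega> vs = 0"
  by (simp add: alt_forms_def)

lemma alt_forms_multilinear:
  "\<omega> \<in> alt_forms T lc r \<Longrightarrow> length vs = r \<Longrightarrow> set vs \<subseteq> T \<Longrightarrow> j < r \<Longrightarrow> u \<in> T \<Longrightarrow> v \<in> T \<Longrightarrow>
    \<omega> (vs[j := lc a u b v]) = a * \<omega> (vs[j := u]) + b * \<omega> (vs[j := v])"
  by (simp add: alt_forms_def)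

lemma alt_formsI:
  assumes "\<And>vs. length vs \<noteq> r \<Longrightarrow> \<omega> vs = 0"
    and "\<And>vs. length vs = r \<Longrightarrow> \<not> set vs \<subseteq> T \<Longrightarrow> \<omega> vs = 0"
    and "\<And>vs j a u b v. length vs = r \<Longrightarrow> set vs \<subseteq> T \<Longrightarrow> j < r \<Longrightarrow> u \<in> T \<Longrightarrow> v \<in> T \<Longrightarrow>
        \<omega> (vs[j := lc a u b v]) = a * \<omega> (vs[j := u]) + b * \<omega> (vs[j := v])"
    and "\<And>vs. length vs = r \<Longrightarrow> \<not> distinct vs \<Longrightarrow> \<omega> vs = 0"
  shows "\<omega> \<in> alt_forms T lc r"
  using assms unfolding alt_forms_def by blast

lemma alt_forms_lincomb:
  assumes "\<omega> \<in> alt_forms T lc r" "\<eta> \<in> alt_forms T lc r"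
  shows "(\<lambda>vs. a * \<omega> vs + b * \<eta> vs) \<in> alt_forms T lc r"
proof (rule alt_formsI)
  fix vs j c u d v
  assume "length vs = r" "set vs \<subseteq> T" "j < r" "u \<in> T" "v \<in> T"
  note alt_forms_multilinear[OF assms(1) this, of c d] alt_forms_multilinear[OF assms(2) this, of c d]
  then show "a * \<omega> (vs[j := lc c u d v]) + b * \<eta> (vs[j := lc c u d v])
      = c * (a * \<omega> (vs[j := u]) + b * \<eta> (vs[j := u])) + d * (a * \<omega> (vs[j := v]) + b * \<eta> (vs[j := v]))"
    by (simp add: algebra_simps)
qed (simp_all add: assms[THEN alt_forms_off] assms[THEN alt_forms_nondistinct])

lemma alt_forms_zero: "(\<lambda>vs. 0) \<in> alt_forms T lc r"
  by (simp add: alt_forms_def)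

lemma alt_forms_sum:
  "(\<And>i. i \<in> I \<Longrightarrow> f i \<in> alt_forms T lc r) \<Longrightarrow> (\<lambda>vs. \<Sum>i\<in>I. c i * f i vs) \<in> alt_forms T lc r"
proof (induction I rule: infinite_finite_induct)
  case (insert i I)
  then show ?case
    using alt_forms_lincomb[of "f i" T lc r "\<lambda>vs. \<Sum>i\<in>I. c i * f i vs" "c i" 1] by simp
qed (simp_all add: alt_forms_zero)

lemma alt_forms_one: "(\<lambda>vs. if vs = [] then 1 else 0) \<in> alt_forms T lc 0"
  by (rule alt_formsI) auto

section \<open>Wedge products of alternating forms\<close>

lemma permutes_lessThan_preimage:
  assumes "\<pi> permutes {..<n::nat}" "i < n"
  shows "\<exists>m<n. \<pi> m = i"
proof -
  have "i \<in> \<pi> ` {..<n}" using permutes_image[OF assms(1)] assms(2) by simp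
  then show ?thesis by auto
qed

lemma permutes_lessThan_mem: "\<pi> permutes {..<n::nat} \<Longrightarrow> m < n \<Longrightarrow> \<pi> m < n"
  using permutes_in_image[of \<pi> "{..<n}" m] by simp

text \<open>The slot \<open>j\<close> is read by exactly one position \<open>m0\<close>, the
  preimage of \<open>j\<close> under the permutation. That position belongs to one of the two
  factors, whose multilinearity gives the claim, while the other factor is unaffected.\<close>

lemma wedge_term_multilinear:
  assumes \<omega>: "\<omega> \<in> alt_forms T lc p" and \<eta>: "\<eta> \<in> alt_forms T lc q"
    and vs: "length vs = p + q" "set vs \<subseteq> T" "j < p + q" "u \<in> T" "v \<in> T"
    and \<pi>: "\<pi> permutes {..<p + q}"
  shows "\<omega> (map (\<lambda>m. vs[j := lc a u b v] ! \<pi> m) [0..<p]) * \<eta> (map (\<lambda>m. vs[j := lc a u b v] ! \<pi> m) [p..<p+q])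
    = a * (\<omega> (map (\<lambda>m. vs[j := u] ! \<pi> m) [0..<p]) * \<eta> (map (\<lambda>m. vs[j := u] ! \<pi> m) [p..<p+q]))
    + b * (\<omega> (map (\<lambda>m. vs[j := v] ! \<pi> m) [0..<p]) * \<eta> (map (\<lambda>m. vs[j := v] ! \<pi> m) [p..<p+q]))"
proof -
  obtain m0 where m0: "m0 < p + q" "\<pi> m0 = j"
    using permutes_lessThan_preimage[OF \<pi> vs(3)] by blast
  have eq: "\<pi> m = j \<longleftrightarrow> m = m0" "j = \<pi> m \<longleftrightarrow> m = m0" for m
    by (auto simp: m0(2)[symmetric] inj_eq[OF permutes_inj[OF \<pi>]])
  have lt: "\<pi> m < p + q" if "m < p + q" for m
    by (rule permutes_lessThan_mem[OF \<pi> that])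
  have mem: "vs ! \<pi> m \<in> T" if "m < p + q" for m
    using nth_mem[of "\<pi> m" vs] lt[OF that] vs(1,2) by auto
  show ?thesis
  proof (cases "m0 < p")
    case True
    have 1: "map (\<lambda>m. vs[j := x] ! \<pi> m) [0..<p] = (map (\<lambda>m. vs ! \<pi> m) [0..<p])[m0 := x]" for x
      using lt vs(1,3) True eq by (auto intro!: nth_equalityI simp: nth_list_update m0)
    have 2: "map (\<lambda>m. vs[j := x] ! \<pi> m) [p..<p+q] = map (\<lambda>m. vs ! \<pi> m) [p..<p+q]" for x
      using lt vs(1,3) eq True by (auto simp: nth_list_update m0)
    have "set (map (\<lambda>m. vs ! \<pi> m) [0..<p]) \<subseteq> T"
      using mem by auto
    then show ?thesis
      unfolding 1 2 using True vs by (subst alt_forms_multilinear[OF \<omega>]) (auto simp: algebra_simps)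
  next
    case False
    have 1: "map (\<lambda>m. vs[j := x] ! \<pi> m) [0..<p] = map (\<lambda>m. vs ! \<pi> m) [0..<p]" for x
      using lt vs(1,3) eq False by (auto simp: nth_list_update m0)
    have 2: "map (\<lambda>m. vs[j := x] ! \<pi> m) [p..<p+q] = (map (\<lambda>m. vs ! \<pi> m) [p..<p+q])[m0 - p := x]" for x
      using lt vs(1,3) eq False m0(1) by (auto intro!: nth_equalityI simp: nth_list_update m0)
    have "set (map (\<lambda>m. vs ! \<pi> m) [p..<p+q]) \<subseteq> T"
      using mem by auto
    then show ?thesis
      unfolding 1 2 using False m0 vs by (subst alt_forms_multilinear[OF \<eta>]) (auto simp: algebra_simps)
  qed
qed

lemma wedge_alt_forms:
  assumes \<omega>: "\<omega> \<in> alt_forms T lc p" and \<eta>: "\<eta> \<in> alt_forms T lc q"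
  shows "wedge p q \<omega> \<eta> \<in> alt_forms T lc (p + q)"
proof (rule alt_formsI)
  show "wedge p q \<omega> \<eta> vs = 0" if "length vs \<noteq> p + q" for vs
    using that by (simp add: wedge_def)
next
  fix vs :: "'a list" assume vs: "length vs = p + q" "\<not> set vs \<subseteq> T"
  then obtain i where i: "i < p + q" "vs ! i \<notin> T" by (metis in_set_conv_nth subsetI)
  have "\<omega> (map (\<lambda>j. vs ! \<pi> j) [0..<p]) * \<eta> (map (\<lambda>j. vs ! \<pi> j) [p..<p + q]) = 0"
    if perm: "\<pi> permutes {..<p + q}" for \<pi>
  proof -
    obtain m where m: "m < p + q" "\<pi> m = i"
      using permutes_lessThan_preimage[OF perm i(1)] by blast
    show ?thesis
    proof (cases "m < p")
      case True
      then have "vs ! i \<in> set (map (\<lambda>j. vs ! \<pi> j) [0..<p])" using m by auto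
      then have "\<omega> (map (\<lambda>j. vs ! \<pi> j) [0..<p]) = 0" using i(2) by (intro alt_forms_off[OF \<omega>]) blast
      then show ?thesis by simp
    next
      case False
      then have "vs ! i \<in> set (map (\<lambda>j. vs ! \<pi> j) [p..<p + q])" using m by auto
      then have "\<eta> (map (\<lambda>j. vs ! \<pi> j) [p..<p + q]) = 0" using i(2) by (intro alt_forms_off[OF \<eta>]) blast
      then show ?thesis by simp
    qed
  qed
  then have "(\<Sum>\<pi> | \<pi> permutes {..<p + q}. of_int (sign \<pi>) * (\<omega> (map (\<lambda>j. vs ! \<pi> j) [0..<p]) *
      \<eta> (map (\<lambda>j. vs ! \<pi> j) [p..<p + q]))) = 0"
    by (intro sum.neutral) simp
  then show "wedge p q \<omega> \<eta> vs = 0" by (simp add: wedge_def mult.assoc)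
next
  fix vs :: "'a list" and j a u b v
  assume vs: "length vs = p + q" "set vs \<subseteq> T" "j < p + q" "u \<in> T" "v \<in> T"
  let ?S = "{\<pi>. \<pi> permutes {..<p + q}}"
  let ?f = "\<lambda>x \<pi>. of_int (sign \<pi>) * (\<omega> (map (\<lambda>m. vs[j := x] ! \<pi> m) [0..<p]) * \<eta> (map (\<lambda>m. vs[j := x] ! \<pi> m) [p..<p+q]))"
  have "(\<Sum>\<pi>\<in>?S. ?f (lc a u b v) \<pi>) = (\<Sum>\<pi>\<in>?S. a * ?f u \<pi> + b * ?f v \<pi>)"
    by (rule sum.cong) (auto simp: wedge_term_multilinear[OF \<omega> \<eta> vs] algebra_simps)
  also have "\<dots> = a * (\<Sum>\<pi>\<in>?S. ?f u \<pi>) + b * (\<Sum>\<pi>\<in>?S. ?f v \<pi>)"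
    by (simp add: sum.distrib sum_distrib_left)
  finally show "wedge p q \<omega> \<eta> (vs[j := lc a u b v]) = a * wedge p q \<omega> \<eta> (vs[j := u]) + b * wedge p q \<omega> \<eta> (vs[j := v])"
    using vs(1) by (simp add: wedge_def mult.assoc add_divide_distrib)
next
  fix vs :: "'a list" assume vs: "length vs = p + q" "\<not> distinct vs"
  then obtain a b where ab: "a < p + q" "b < p + q" "a \<noteq> b" "vs ! a = vs ! b"
    by (auto simp: distinct_conv_nth)
  let ?f = "\<lambda>\<pi>. of_int (sign \<pi>) * \<omega> (map (\<lambda>m. vs ! \<pi> m) [0..<p]) * \<eta> (map (\<lambda>m. vs ! \<pi> m) [p..<p+q])"
  have sw: "swap a b permutes {..<p + q}" using ab by (intro permutes_swap_id) auto
  have nth: "vs ! swap a b i = vs ! i" for i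
    using ab(4) by (simp add: Transposition.transpose_def)
  have neg: "?f (swap a b \<circ> \<pi>) = - ?f \<pi>" if "\<pi> permutes {..<p + q}" for \<pi>
  proof -
    have "sign (swap a b \<circ> \<pi>) = - sign \<pi>"
      using sign_compose[of "swap a b" \<pi>] permutes_imp_permutation[OF _ sw] permutes_imp_permutation[OF _ that] ab(3)
      by (simp add: sign_swap_id)
    then show ?thesis by (simp add: nth)
  qed
  \<comment> \<open>Exchanging the two equal entries keeps all arguments and flips every sign, so
    reindexing by the transposition shows that the sum equals its own negative.\<close>
  have "sum ?f {\<pi>. \<pi> permutes {..<p + q}} = (\<Sum>\<pi> | \<pi> permutes {..<p + q}. ?f (swap a b \<circ> \<pi>))"
    by (rule setum_permutations_compose_left[OF sw])
  also have "\<dots> = - sum ?f {\<pi>. \<pi> permutes {..<p + q}}"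
    by (simp add: neg sum_negf del: comp_apply)
  finally show "wedge p q \<omega> \<eta> vs = 0" using vs(1) by (simp add: wedge_def)
qed

lemma wedge_list_alt_forms:
  "set as \<subseteq> alt_forms T lc 1 \<Longrightarrow> wedge_list as \<in> alt_forms T lc (length as)"
proof (induction as)
  case (Cons a as)
  then show ?case using wedge_alt_forms[of a T lc 1 "wedge_list as" "length as"] by simp
qed (simp add: alt_forms_one)

text \<open>For lists of equal length this is the determinant of the matrix \<open>c\<close> with
  rows \<open>ks\<close> and columns \<open>ls\<close>, by the Leibniz formula. The lists supply the
  ordering that the label type lacks.\<close>

definition minor :: "('a \<Rightarrow> 'b \<Rightarrow> real) \<Rightarrow> 'a list \<Rightarrow> 'b list \<Rightarrow> real" where
  "minor c ks ls = (\<Sum>\<pi> | \<pi> permutes {..<length ks}.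
     of_int (sign \<pi>) * (\<Prod>j<length ks. c (ks ! j) (ls ! \<pi> j)))"

text \<open>Expanding the inner determinant turns the wedge into a double sum over the permutations
  of \<open>n + 1\<close> and of \<open>n\<close> indices. A permutation of the smaller set merely
  reindexes the outer sum, so each one contributes the full determinant, and the resulting
  \<open>fact n\<close> cancels the normalisation in \<open>wedge\<close>.\<close>

lemma wedge_list_eq_minor:
  "length vs = length as \<Longrightarrow> wedge_list as vs = minor (\<lambda>a v. a [v]) as vs"
proof (induction as arbitrary: vs)
  case Nil
  then show ?case by (simp add: minor_def)
next
  case (Cons a as)
  let ?n = "length as"
  let ?S = "{..<1 + ?n}"
  define g where "g \<rho> = of_int (sign \<rho>) * (\<Prod>j<Suc ?n. ((a # as) ! j) [vs ! \<rho> j])" for \<rho>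
  \<comment> \<open>A permutation of the arguments of the tail is made to act on the positions
    \<open>1, ..., n\<close>; position \<open>0\<close> stays fixed, being reserved for
    \<open>a\<close>.\<close>
  have shift: "map_permutation {..<?n} Suc \<sigma> permutes ?S"
      "sign (map_permutation {..<?n} Suc \<sigma>) = sign \<sigma>"
      "map_permutation {..<?n} Suc \<sigma> 0 = 0"
      "\<And>j. j < ?n \<Longrightarrow> map_permutation {..<?n} Suc \<sigma> (Suc j) = Suc (\<sigma> j)"
    if "\<sigma> permutes {..<?n}" for \<sigma>
  proof -
    have "map_permutation {..<?n} Suc \<sigma> permutes Suc ` {..<?n}"
      by (rule map_permutation_permutes[OF _ that]) (simp add: bij_betw_def)
    then show "map_permutation {..<?n} Suc \<sigma> permutes ?S" "map_permutation {..<?n} Suc \<sigma> 0 = 0"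
      by (auto intro: permutes_subset dest: permutes_not_in[of _ _ 0])
    show "sign (map_permutation {..<?n} Suc \<sigma>) = sign \<sigma>"
      using sign_map_permutation[of Suc "{..<?n}" \<sigma>] that by simp
    show "map_permutation {..<?n} Suc \<sigma> (Suc j) = Suc (\<sigma> j)" if "j < ?n" for j
      using map_permutation_apply[of Suc "{..<?n}" j \<sigma>] that by simp
  qed
  have expand: "of_int (sign \<pi>) * a (map (\<lambda>j. vs ! \<pi> j) [0..<1]) * wedge_list as (map (\<lambda>j. vs ! \<pi> j) [1..<1 + ?n])
      = (\<Sum>\<sigma> | \<sigma> permutes {..<?n}. g (\<pi> \<circ> map_permutation {..<?n} Suc \<sigma>))"
    if \<pi>: "\<pi> permutes ?S" for \<pi>
  proof -
    have "map (\<lambda>j. vs ! \<pi> j) [1..<1 + ?n] = map (\<lambda>j. vs ! \<pi> (Suc j)) [0..<?n]"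
      by (rule nth_equalityI) (auto simp del: upt_Suc)
    then have "wedge_list as (map (\<lambda>j. vs ! \<pi> j) [1..<1 + ?n])
        = (\<Sum>\<sigma> | \<sigma> permutes {..<?n}. of_int (sign \<sigma>) * (\<Prod>j<?n. (as ! j) [vs ! \<pi> (Suc (\<sigma> j))]))"
      by (simp only:, subst Cons.IH) (auto simp: minor_def permutes_lessThan_mem intro!: sum.cong prod.cong)
    moreover have "of_int (sign \<pi>) * a [vs ! \<pi> 0] * (of_int (sign \<sigma>) * (\<Prod>j<?n. (as ! j) [vs ! \<pi> (Suc (\<sigma> j))]))
        = g (\<pi> \<circ> map_permutation {..<?n} Suc \<sigma>)" if \<sigma>: "\<sigma> permutes {..<?n}" for \<sigma>
    proof -
      have "sign (\<pi> \<circ> map_permutation {..<?n} Suc \<sigma>) = sign \<pi> * sign \<sigma>"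
        using sign_compose[OF permutes_imp_permutation[OF _ \<pi>] permutes_imp_permutation[OF _ shift(1)[OF \<sigma>]]]
          shift(2)[OF \<sigma>] by simp
      then show ?thesis
        unfolding g_def by (subst prod.lessThan_Suc_shift) (simp add: shift[OF \<sigma>])
    qed
    ultimately show ?thesis by (simp add: sum_distrib_left)
  qed
  have "(\<Sum>\<pi> | \<pi> permutes ?S. \<Sum>\<sigma> | \<sigma> permutes {..<?n}. g (\<pi> \<circ> map_permutation {..<?n} Suc \<sigma>))
      = (\<Sum>\<sigma> | \<sigma> permutes {..<?n}. \<Sum>\<pi> | \<pi> permutes ?S. g (\<pi> \<circ> map_permutation {..<?n} Suc \<sigma>))"
    by (rule sum.swap)
  \<comment> \<open>For fixed \<open>\<sigma>\<close>, composition on the right with the shifted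
    permutation is a bijection of the outer index set.\<close>
  also have "\<dots> = (\<Sum>\<sigma> | \<sigma> permutes {..<?n}. sum g {\<pi>. \<pi> permutes ?S})"
    by (intro sum.cong refl sum_permutations_compose_right[symmetric] shift) simp
  also have "\<dots> = fact ?n * sum g {\<pi>. \<pi> permutes ?S}"
    by (simp add: card_permutations[of "{..<?n}" ?n])
  finally have sum_g: "(\<Sum>\<pi> | \<pi> permutes ?S. of_int (sign \<pi>) * a (map (\<lambda>j. vs ! \<pi> j) [0..<1]) *
      wedge_list as (map (\<lambda>j. vs ! \<pi> j) [1..<1 + ?n])) = fact ?n * sum g {\<pi>. \<pi> permutes ?S}"
    by (subst sum.cong[OF refl expand]) auto
  have "wedge_list (a # as) vs = (\<Sum>\<pi> | \<pi> permutes ?S. of_int (sign \<pi>) * a (map (\<lambda>j. vs ! \<pi> j) [0..<1]) *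
      wedge_list as (map (\<lambda>j. vs ! \<pi> j) [1..<1 + ?n])) / (fact 1 * fact ?n)"
    using Cons.prems by (simp add: wedge_def)
  also have "\<dots> = sum g {\<pi>. \<pi> permutes ?S}" unfolding sum_g by simp
  finally show ?case by (simp add: minor_def g_def)
qed

lemma minor_map: "length ks = length ls \<Longrightarrow> minor c (map f ks) (map g ls) = minor (\<lambda>k l. c (f k) (g l)) ks ls"
  unfolding minor_def
  by (intro sum.cong refl arg_cong[of _ _ "(*) _"]) (auto intro!: prod.cong simp: permutes_lessThan_mem)

lemma minor_cong:
  assumes "length ks = length ls" "\<And>k l. k \<in> set ks \<Longrightarrow> l \<in> set ls \<Longrightarrow> c k l = d k l"
  shows "minor c ks ls = minor d ks ls"
  unfolding minor_def using assms
  by (intro sum.cong refl arg_cong[of _ _ "(*) _"] prod.cong)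
    (auto simp: permutes_lessThan_mem)

text \<open>A permutation other than the identity moves some index \<open>j\<close>, and
  distinctness of \<open>ks\<close> makes the factor at \<open>j\<close> vanish; only the identity
  contributes.\<close>

lemma minor_delta:
  assumes "distinct ks"
  shows "minor (\<lambda>k l. if k = l then 1 else 0) ks ks = 1"
proof -
  let ?f = "\<lambda>\<pi>. of_int (sign \<pi>) * (\<Prod>j<length ks. if ks ! j = ks ! \<pi> j then 1 else 0 :: real)"
  have "?f \<pi> = (if \<pi> = id then 1 else 0)" if \<pi>: "\<pi> permutes {..<length ks}" for \<pi>
  proof (cases "\<pi> = id")
    case False
    then obtain j where j: "\<pi> j \<noteq> j" by (auto simp: fun_eq_iff)
    then have jl: "j < length ks" using permutes_not_in[OF \<pi>, of j] by auto
    then have "\<pi> j < length ks" using permutes_in_image[OF \<pi>, of j] by simp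
    then have "ks ! j \<noteq> ks ! \<pi> j" using assms j jl by (simp add: nth_eq_iff_index_eq)
    then have "(\<Prod>j<length ks. if ks ! j = ks ! \<pi> j then 1 else 0 :: real) = 0"
      using jl by (intro prod_zero) auto
    then show ?thesis using False by simp
  qed simp
  then have "sum ?f {\<pi>. \<pi> permutes {..<length ks}} = (\<Sum>\<pi> | \<pi> permutes {..<length ks}. if \<pi> = id then 1 else 0)"
    by (intro sum.cong) auto
  also have "\<dots> = 1" by (simp add: finite_permutations permutes_id)
  finally show ?thesis by (simp add: minor_def)
qed

lemma minor_zero_row:
  assumes "length ks = length ls" "k \<in> set ks" "\<And>l. l \<in> set ls \<Longrightarrow> c k l = 0"
  shows "minor c ks ls = 0"
proof -
  obtain j where j: "j < length ks" "ks ! j = k" using assms(2) by (metis in_set_conv_nth)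
  have "(\<Prod>j<length ks. c (ks ! j) (ls ! \<pi> j)) = 0" if "\<pi> permutes {..<length ks}" for \<pi>
  proof (rule prod_zero)
    have "\<pi> j < length ks" using permutes_in_image[OF that, of j] j by simp
    then show "\<exists>j\<in>{..<length ks}. c (ks ! j) (ls ! \<pi> j) = 0" using j assms by (intro bexI[of _ j]) auto
  qed simp
  then show ?thesis unfolding minor_def by (intro sum.neutral) simp
qed

lemma enum: "finite I \<Longrightarrow> distinct (enum I)" "finite I \<Longrightarrow> set (enum I) = I"
  "finite I \<Longrightarrow> length (enum I) = card I"
proof -
  assume "finite I"
  then have "\<exists>ks. distinct ks \<and> set ks = I" by (metis finite_distinct_list)
  from someI_ex[OF this] have *: "distinct (enum I) \<and> set (enum I) = I" by (simp add: enum_def)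
  then show "distinct (enum I)" "set (enum I) = I" by auto
  then show "length (enum I) = card I" using distinct_card by fastforce
qed

definition index_sets :: "'k set \<Rightarrow> nat \<Rightarrow> 'k set set" where
  "index_sets K r = {I. I \<subseteq> K \<and> card I = r}"

text \<open>A basis \<open>e\<close> with coordinate functions \<open>co\<close> and dual covectors
  \<open>cov\<close>, for a vector space that is known only through its carrier and its linear
  combinations. The intended instances are tangent spaces with a coordinate frame.\<close>

locale linear_frame =
  fixes T :: "'v set" and lc :: "real \<Rightarrow> 'v \<Rightarrow> real \<Rightarrow> 'v \<Rightarrow> 'v"
    and K :: "'k set" and co :: "'v \<Rightarrow> 'k \<Rightarrow> real" and e :: "'k \<Rightarrow> 'v"
    and cov :: "'k \<Rightarrow> 'v list \<Rightarrow> real"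
  assumes finite_K: "finite K"
    and lc_mem: "u \<in> T \<Longrightarrow> v \<in> T \<Longrightarrow> lc a u b v \<in> T"
    and co_lc: "u \<in> T \<Longrightarrow> v \<in> T \<Longrightarrow> k \<in> K \<Longrightarrow> co (lc a u b v) k = a * co u k + b * co v k"
    and co_inj: "u \<in> T \<Longrightarrow> v \<in> T \<Longrightarrow> (\<And>k. k \<in> K \<Longrightarrow> co u k = co v k) \<Longrightarrow> u = v"
    and e_mem: "k \<in> K \<Longrightarrow> e k \<in> T"
    and co_e: "k \<in> K \<Longrightarrow> l \<in> K \<Longrightarrow> co (e k) l = (if k = l then 1 else 0)"
    and cov_def: "cov k vs = (if length vs = 1 \<and> set vs \<subseteq> T then co (hd vs) k else 0)"
begin

section \<open>Expansion of alternating forms in a frame\<close>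

abbreviation alts :: "nat \<Rightarrow> ('v list \<Rightarrow> real) set" where
  "alts \<equiv> alt_forms T lc"

lemma finite_index_sets: "finite (index_sets K r)"
  using finite_K by (simp add: index_sets_def)

lemma index_set:
  assumes "I \<in> index_sets K r"
  shows "distinct (enum I)" "set (enum I) = I" "length (enum I) = r" "I \<subseteq> K" "finite I"
  using assms enum[of I] finite_K by (auto simp: index_sets_def dest: finite_subset)

text \<open>The induction is on a set \<open>F\<close> outside of which all coordinates of
  \<open>u\<close> vanish; subtracting \<open>co u k\<close> times \<open>e k\<close> removes one
  index from it.\<close>

lemma linear_expansion:
  assumes lin: "\<And>a u b v. u \<in> T \<Longrightarrow> v \<in> T \<Longrightarrow> f (lc a u b v) = a * f u + b * f v"
    and "u \<in> T"
  shows "f u = (\<Sum>k\<in>K. co u k * f (e k))"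
proof -
  have "f u = (\<Sum>k\<in>F. co u k * f (e k))" if "finite F" "F \<subseteq> K" "u \<in> T" "\<And>k. k \<in> K - F \<Longrightarrow> co u k = 0" for F u
    using that
  proof (induction F arbitrary: u)
    case empty
    \<comment> \<open>With no nonzero coordinate left, \<open>u\<close> is the zero vector. Writing
      it as a trivial combination of itself lets \<open>lin\<close> yield
      \<open>f u = 0\<close>.\<close>
    have "u = lc 0 u 0 u" using empty by (intro co_inj) (auto simp: co_lc lc_mem)
    then show ?case using lin[of u u 0 0] empty by simp
  next
    case (insert k F)
    define u' where "u' = lc 1 u (- co u k) (e k)"
    have k: "k \<in> K" "e k \<in> T" using insert e_mem by auto
    have u': "u' \<in> T" using k insert by (simp add: u'_def lc_mem)
    have co': "co u' l = co u l - (if k = l then co u k else 0)" if "l \<in> K" for l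
      using that k insert by (simp add: u'_def co_lc co_e)
    have "u = lc 1 u' (co u k) (e k)"
      using insert k u' by (intro co_inj) (auto simp: co_lc lc_mem co' co_e)
    then have "f u = f u' + co u k * f (e k)" using lin[OF u' k(2), of 1 "co u k"] by simp
    also have "f u' = (\<Sum>l\<in>F. co u' l * f (e l))"
      using insert by (intro insert.IH) (auto simp: co' u')
    also have "\<dots> = (\<Sum>l\<in>F. co u l * f (e l))"
      using insert by (intro sum.cong refl) (auto simp: co' subset_iff)
    finally show ?case using insert by simp
  qed
  from this[of K u] show ?thesis using finite_K assms(2) by simp
qed

text \<open>Polarisation: the form vanishes on a list that has the sum of the two entries in both
  places, and expanding by linearity leaves just the two mixed terms.\<close>

lemma alt_swap:
  assumes \<omega>: "\<omega> \<in> alts r" and vs: "length vs = r" "set vs \<subseteq> T" "i < r" "j < r" "i \<noteq> j"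
  shows "\<omega> (vs[i := vs ! j, j := vs ! i]) = - \<omega> vs"
proof -
  let ?u = "vs ! i" and ?v = "vs ! j"
  let ?s = "lc 1 ?u 1 ?v"
  have T: "?u \<in> T" "?v \<in> T" using vs by auto
  have s: "?s \<in> T" using T lc_mem by simp
  have sub: "set (vs[i := x]) \<subseteq> T" "set (vs[i := x, j := y]) \<subseteq> T" if "x \<in> T" "y \<in> T" for x y
    using vs that by (auto dest!: subsetD[OF set_update_subset_insert])
  have nd: "\<omega> (vs[i := x, j := x]) = 0" for x
    by (rule alt_forms_nondistinct[OF \<omega>]) (use vs nth_eq_iff_index_eq[of "vs[i := x, j := x]" i j] in auto)
  have 1: "\<omega> (vs[i := x, j := ?s]) = \<omega> (vs[i := x, j := ?u]) + \<omega> (vs[i := x, j := ?v])" if "x \<in> T" for x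
    using alt_forms_multilinear[OF \<omega>, of "vs[i := x]" j ?u ?v 1 1] vs T sub that by simp
  have sw: "vs[i := x, j := y] = vs[j := y, i := x]" for x y using vs(5) by (rule list_update_swap)
  have 2: "\<omega> (vs[i := ?s, j := y]) = \<omega> (vs[i := ?u, j := y]) + \<omega> (vs[i := ?v, j := y])" if "y \<in> T" for y
    unfolding sw using alt_forms_multilinear[OF \<omega>, of "vs[j := y]" i ?u ?v 1 1] vs T that
    by (simp add: set_update_subsetI)
  have "0 = \<omega> (vs[i := ?s, j := ?s])" using nd by simp
  also have "\<dots> = \<omega> (vs[i := ?u, j := ?u]) + \<omega> (vs[i := ?v, j := ?u]) + (\<omega> (vs[i := ?u, j := ?v]) + \<omega> (vs[i := ?v, j := ?v]))"
    using 1[OF s] 2[OF T(1)] 2[OF T(2)] by simp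
  also have "\<dots> = \<omega> (vs[i := ?v, j := ?u]) + \<omega> vs" using nd[of ?u] nd[of ?v] by simp
  finally show ?thesis by simp
qed

lemma alt_permute:
  assumes \<omega>: "\<omega> \<in> alts r" and vs: "length vs = r" "set vs \<subseteq> T"
    and "\<pi> permutes {..<r}"
  shows "\<omega> (permute_list \<pi> vs) = of_int (sign \<pi>) * \<omega> vs"
  using finite_lessThan assms(4)
proof (induction rule: permutes_rev_induct)
  case id
  then show ?case by simp
next
  case (swap a b p)
  let ?ws = "permute_list p vs"
  have ws: "length ?ws = r" "set ?ws \<subseteq> T" using swap vs by auto
  have "permute_list (p \<circ> Transposition.transpose a b) vs = permute_list (Transposition.transpose a b) ?ws"
    using swap vs by (intro permute_list_compose permutes_swap_id) auto
  also have "\<dots> = ?ws[a := ?ws ! b, b := ?ws ! a]"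
    using swap ws by (auto intro!: nth_equalityI simp: permute_list_nth permutes_swap_id nth_list_update Transposition.transpose_def)
  finally have eq: "permute_list (p \<circ> Transposition.transpose a b) vs = ?ws[a := ?ws ! b, b := ?ws ! a]" .
  have sg: "sign (p \<circ> Transposition.transpose a b) = - sign p"
    using sign_compose[OF permutes_imp_permutation[OF _ swap(4)] permutation_swap_id, of a b] swap(3)
    by (simp add: sign_swap_id)
  show ?case unfolding eq sg
    using alt_swap[OF \<omega> ws swap(1,2)[unfolded lessThan_iff] swap(3)] swap(5) by simp
qed

text \<open>Linearity replaces the arguments one after the other by basis vectors. On a list of
  basis vectors the form vanishes if a label repeats; otherwise the list rearranges one given by
  \<open>enum\<close>, which changes only the sign.\<close>

lemma alt_eq_zero:
  assumes \<omega>: "\<omega> \<in> alts r" and z: "\<And>I. I \<in> index_sets K r \<Longrightarrow> \<omega> (map e (enum I)) = 0"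
  shows "\<omega> vs = 0"
proof -
  have basis: "\<omega> (map e ks) = 0" if ks: "length ks = r" "set ks \<subseteq> K" for ks
  proof (cases "distinct ks")
    case True
    have I: "set ks \<in> index_sets K r" using ks True by (simp add: index_sets_def distinct_card)
    have "mset ks = mset (enum (set ks))" using index_set[OF I] True by (simp add: set_eq_iff_mset_eq_distinct)
    then obtain p where p: "p permutes {..<length (enum (set ks))}" "permute_list p (enum (set ks)) = ks"
      by (rule mset_eq_permutation)
    have "map e ks = permute_list p (map e (enum (set ks)))"
      using permute_list_map[OF p(1), of e] p(2) by simp
    then show ?thesis
      using alt_permute[OF \<omega>, of "map e (enum (set ks))" p] z[OF I] p index_set[OF I] e_mem by auto
  next
    case False
    then have "\<not> distinct (map e ks)" by (auto simp: distinct_map)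
    then show ?thesis by (rule alt_forms_nondistinct[OF \<omega>])
  qed
  \<comment> \<open>The number \<open>j\<close> counts the leading positions whose arguments may
    still be arbitrary; from position \<open>j\<close> on, the arguments are basis vectors.\<close>
  have "\<omega> vs = 0" if "j \<le> r" "length vs = r" "set vs \<subseteq> T" "\<And>m. j \<le> m \<Longrightarrow> m < r \<Longrightarrow> vs ! m \<in> e ` K" for j vs
    using that
  proof (induction j arbitrary: vs)
    case 0
    then have "vs \<in> map e ` lists K" unfolding lists_image[symmetric] by (auto simp: in_set_conv_nth)
    then obtain ks where "set ks \<subseteq> K" "vs = map e ks" by auto
    then show ?case using basis 0 by simp
  next
    case (Suc j)
    have lin: "\<omega> (vs[j := lc a u b v]) = a * \<omega> (vs[j := u]) + b * \<omega> (vs[j := v])" if "u \<in> T" "v \<in> T" for a u b v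
      using Suc that by (intro alt_forms_multilinear[OF \<omega>]) auto
    have "\<omega> (vs[j := vs ! j]) = (\<Sum>k\<in>K. co (vs ! j) k * \<omega> (vs[j := e k]))"
      using Suc by (intro linear_expansion[where f = "\<lambda>u. \<omega> (vs[j := u])"] lin) auto
    also have "\<dots> = 0"
    proof (intro sum.neutral ballI)
      fix k assume k: "k \<in> K"
      have "\<omega> (vs[j := e k]) = 0"
      proof (rule Suc.IH)
        show "set (vs[j := e k]) \<subseteq> T" using Suc k e_mem by (intro set_update_subsetI) auto
        show "vs[j := e k] ! m \<in> e ` K" if "j \<le> m" "m < r" for m
          using Suc k that by (cases "m = j") auto
      qed (use Suc in auto)
      then show "co (vs ! j) k * \<omega> (vs[j := e k]) = 0" by simp
    qed
    finally show ?case by simp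
  qed
  from this[of r vs] show ?thesis using alt_forms_off[OF \<omega>, of vs] by (cases "length vs = r \<and> set vs \<subseteq> T") auto
qed

lemma alt_eqI:
  assumes "\<omega> \<in> alts r" "\<eta> \<in> alts r"
    and "\<And>I. I \<in> index_sets K r \<Longrightarrow> \<omega> (map e (enum I)) = \<eta> (map e (enum I))"
  shows "\<omega> = \<eta>"
proof
  fix vs
  show "\<omega> vs = \<eta> vs"
    using alt_eq_zero[OF alt_forms_lincomb[OF assms(1,2), of 1 "-1"], of vs] assms(3) by simp
qed

text \<open>Each of the \<open>fact r\<close> permutations contributes the same value, because its
  sign cancels the sign from rearranging the arguments. This makes contraction with the constant
  0-form 1 return the multivector itself.\<close>

lemma wedge_one:
  assumes \<omega>: "\<omega> \<in> alts r"
  shows "wedge 0 r (\<lambda>vs. if vs = [] then 1 else 0) \<omega> = \<omega>"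
proof
  fix vs
  let ?w = "wedge 0 r (\<lambda>vs. if vs = [] then 1 else 0) \<omega>"
  have "?w \<in> alts (0 + r)" by (rule wedge_alt_forms[OF alt_forms_one \<omega>])
  show "?w vs = \<omega> vs"
  proof (cases "length vs = r \<and> set vs \<subseteq> T")
    case True
    have "of_int (sign \<pi>) * \<omega> (map (\<lambda>j. vs ! \<pi> j) [0..<r]) = \<omega> vs" if "\<pi> permutes {..<r}" for \<pi>
    proof -
      have "of_int (sign \<pi>) * of_int (sign \<pi>) = (1 :: real)"
        by (metis of_int_1 of_int_mult sign_idempotent)
      then show ?thesis
        using alt_permute[OF \<omega> _ _ that, of vs] True by (simp add: permute_list_def flip: mult.assoc)
    qed
    then have "?w vs = (\<Sum>\<pi> | \<pi> permutes {..<r}. \<omega> vs) / fact r"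
      using True by (simp add: wedge_def)
    then show ?thesis by (simp add: card_permutations[of "{..<r}" r])
  next
    case False
    then show ?thesis
      using alt_forms_off[OF \<omega>] alt_forms_off[OF \<open>?w \<in> alts (0 + r)\<close>] by simp
  qed
qed

lemma cov_alt: "k \<in> K \<Longrightarrow> cov k \<in> alts 1"
proof (rule alt_formsI)
  fix vs j a u b v
  assume "k \<in> K" "length vs = 1" "set vs \<subseteq> T" "j < (1::nat)" "u \<in> T" "v \<in> T"
  moreover then obtain w where "vs = [w]" by (auto simp: length_Suc_conv)
  ultimately show "cov k (vs[j := lc a u b v]) = a * cov k (vs[j := u]) + b * cov k (vs[j := v])"
    by (simp add: cov_def lc_mem co_lc)
qed (auto simp: cov_def length_Suc_conv)

lemma wedge_cov_alt: "set ks \<subseteq> K \<Longrightarrow> wedge_list (map cov ks) \<in> alts (length ks)"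
  using wedge_list_alt_forms[of "map cov ks" T lc] cov_alt by (auto simp: subset_iff)

lemma wedge_cov_enum:
  assumes "I \<in> index_sets K r" "J \<in> index_sets K r"
  shows "wedge_list (map cov (enum I)) (map e (enum J)) = (if I = J then 1 else 0)"
proof -
  note I = index_set[OF assms(1)] and J = index_set[OF assms(2)]
  have "wedge_list (map cov (enum I)) (map e (enum J)) = minor (\<lambda>k l. cov k [e l]) (enum I) (enum J)"
    using I J by (simp add: wedge_list_eq_minor minor_map)
  also have "\<dots> = minor (\<lambda>k l. if k = l then 1 else 0) (enum I) (enum J)"
  proof (rule minor_cong)
    fix k l assume "k \<in> set (enum I)" "l \<in> set (enum J)"
    then have "k \<in> K" "l \<in> K" using I J by auto
    then show "cov k [e l] = (if k = l then 1 else 0)" by (auto simp: cov_def e_mem co_e)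
  qed (use I J in simp)
  also have "\<dots> = (if I = J then 1 else 0)"
  proof (cases "I = J")
    case True
    then show ?thesis using minor_delta I by simp
  next
    case False
    \<comment> \<open>Equal cardinalities exclude a proper inclusion of \<open>I\<close> in
      \<open>J\<close>; a label of \<open>I\<close> outside \<open>J\<close> produces a row of
      zeros.\<close>
    then obtain k where "k \<in> I" "k \<notin> J"
      using I J card_subset_eq[of J I] assms by (auto simp: index_sets_def)
    then show ?thesis using False I J by (auto intro!: minor_zero_row[of _ _ k])
  qed
  finally show ?thesis .
qed

lemma alt_expansion:
  assumes "\<omega> \<in> alts r"
  shows "\<omega> = (\<lambda>vs. \<Sum>I\<in>index_sets K r. \<omega> (map e (enum I)) * wedge_list (map cov (enum I)) vs)"
proof (rule alt_eqI[OF assms])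
  show "(\<lambda>vs. \<Sum>I\<in>index_sets K r. \<omega> (map e (enum I)) * wedge_list (map cov (enum I)) vs) \<in> alts r"
    using wedge_cov_alt index_set by (intro alt_forms_sum) (metis (no_types, lifting))
  show "\<omega> (map e (enum J)) = (\<Sum>I\<in>index_sets K r. \<omega> (map e (enum I)) * wedge_list (map cov (enum I)) (map e (enum J)))"
    if "J \<in> index_sets K r" for J
    using that finite_index_sets by (simp add: wedge_cov_enum if_distrib[of "(*) _"] cong: if_cong)
qed

end

section \<open>The bundles of tangent vectors, forms and multivectors\<close>

lemma rel_open_coord_space: "rel_open (coord_space K) (coord_space K)"
  by (simp add: rel_open_model_iff)

lemma rel_open_preimage:
  assumes "rel_open S U" "continuous_on U f" "f ` U \<subseteq> T" "rel_open T Z"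
  shows "rel_open S (U \<inter> f -` Z)"
proof -
  have "openin (top_of_set U) (U \<inter> f -` Z)"
    using assms by (intro continuous_openin_preimage[of U f T]) (auto simp: rel_open_def)
  then show ?thesis using assms(1) openin_trans unfolding rel_open_def by metis
qed

definition base_part :: "real ^ ('k::finite + 'm::finite) \<Rightarrow> real ^ 'k" where
  "base_part y = (\<chi> k. y $ Inl k)"

lemma base_part_nth [simp]: "base_part y $ k = y $ Inl k"
  by (simp add: base_part_def)

lemma base_part_mem: "y \<in> coord_space (K <+> L) \<Longrightarrow> base_part y \<in> coord_space K"
  by (auto simp: coord_space_def)

lemma smooth_on_nth: "rel_open S W \<Longrightarrow> smooth_on S W (\<lambda>y. y $ k)"
  by (intro smooth_on_vec_nth smooth_on_id)

lemma smooth_on_base_part: "rel_open S W \<Longrightarrow> smooth_on S W base_part"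
  by (rule smooth_on_componentwise) (simp_all add: smooth_on_nth)

text \<open>The shape of the image of a bundle chart: over each point of the base image
  \<open>U\<close> the fibre coordinates with label in \<open>L\<close> are unrestricted.\<close>

definition over :: "'k set \<Rightarrow> 'm set \<Rightarrow> (real ^ 'k) set \<Rightarrow> (real ^ ('k::finite + 'm::finite)) set" where
  "over K L U = {y \<in> coord_space (K <+> L). base_part y \<in> U}"

lemma rel_open_over:
  assumes "rel_open (coord_space K) U"
  shows "rel_open (coord_space (K <+> L)) (over K L U)"
proof -
  have "rel_open (coord_space (K <+> L)) (coord_space (K <+> L) \<inter> base_part -` U)"
    by (rule rel_open_preimage[OF rel_open_coord_space _ _ assms])
      (use smooth_on_continuous[OF smooth_on_base_part[OF rel_open_coord_space]] base_part_mem in auto)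
  moreover have "coord_space (K <+> L) \<inter> base_part -` U = over K L U" by (auto simp: over_def)
  ultimately show ?thesis by simp
qed

lemma smooth_on_over:
  assumes "rel_open (coord_space K) U" "smooth_on (coord_space K) U g"
  shows "smooth_on (coord_space (K <+> L)) (over K L U) (\<lambda>y. g (base_part y))"
  by (rule smooth_on_compose[OF rel_open_over assms(1) _ smooth_on_base_part assms(2)])
    (use assms rel_open_over in \<open>auto simp: over_def\<close>)

text \<open>A transition between bundle charts is the base transition on the \<open>Inl\<close>
  components and fibrewise linear with smooth coefficients \<open>G\<close> on the
  \<open>Inr\<close> components, hence smooth. Tangent, form and multivector bundles all enter
  through this criterion, each with its own \<open>G\<close>.\<close>

lemma vector_bundle_charted:
  fixes N :: "('a, 'i, 'k::finite) manifold" and N' :: "('e, 'i, 'k + 'm::finite) manifold"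
    and base :: "'e \<Rightarrow> 'a" and E :: "'e set" and L :: "'m set"
  assumes "charted N"
    and idx: "idx N' = idx N" and lbl: "lbl N' = lbl N <+> L"
    and cdom: "\<And>i. i \<in> idx N \<Longrightarrow> cdom N' i = {e \<in> E. base e \<in> cdom N i}"
    and pts: "pts N' = {e \<in> E. base e \<in> pts N}"
    and crd_base: "\<And>i e k. i \<in> idx N \<Longrightarrow> e \<in> E \<Longrightarrow> base e \<in> cdom N i \<Longrightarrow>
      crd N' i e $ Inl k = crd N i (base e) $ k"
    and crd_off: "\<And>i e l. i \<in> idx N \<Longrightarrow> e \<in> E \<Longrightarrow> base e \<in> cdom N i \<Longrightarrow> l \<notin> L \<Longrightarrow> crd N' i e $ Inr l = 0"
    and fibre_ex: "\<And>i p c. i \<in> idx N \<Longrightarrow> p \<in> cdom N i \<Longrightarrow>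
      \<exists>e\<in>E. base e = p \<and> (\<forall>l\<in>L. crd N' i e $ Inr l = c l)"
    and fibre_uniq: "\<And>i e e'. i \<in> idx N \<Longrightarrow> e \<in> E \<Longrightarrow> e' \<in> E \<Longrightarrow> base e \<in> cdom N i \<Longrightarrow>
      base e = base e' \<Longrightarrow> (\<And>l. l \<in> L \<Longrightarrow> crd N' i e $ Inr l = crd N' i e' $ Inr l) \<Longrightarrow> e = e'"
    and G_smooth: "\<And>i j l m. i \<in> idx N \<Longrightarrow> j \<in> idx N \<Longrightarrow> l \<in> L \<Longrightarrow> m \<in> L \<Longrightarrow>
      smooth_on (model N) (crd N i ` (cdom N i \<inter> cdom N j)) (G i j l m)"
    and G: "\<And>i j e l. i \<in> idx N \<Longrightarrow> j \<in> idx N \<Longrightarrow> e \<in> E \<Longrightarrow> base e \<in> cdom N i \<Longrightarrow> base e \<in> cdom N j \<Longrightarrow>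
      l \<in> L \<Longrightarrow> crd N' j e $ Inr l = (\<Sum>m\<in>L. G i j l m (crd N i (base e)) * crd N' i e $ Inr m)"
  shows "charted N'"
    and "\<And>i. i \<in> idx N \<Longrightarrow> crd N' i ` cdom N' i = over (lbl N) L (crd N i ` cdom N i)"
proof -
  interpret N: charted N by fact
  have base_crd: "base_part (crd N' i e) = crd N i (base e)" if "i \<in> idx N" "e \<in> E" "base e \<in> cdom N i" for i e
    using that by (simp add: vec_eq_iff crd_base)
  have inj: "e = e'" if "i \<in> idx N" "e \<in> E" "base e \<in> cdom N i" "e' \<in> E" "base e' \<in> cdom N i"
      "crd N' i e = crd N' i e'" for i e e'
  proof -
    have "crd N i (base e) = crd N i (base e')"
      using that by (simp flip: base_crd)
    then show ?thesis using that fibre_uniq[of i e e'] N.crd_eqD[of i "base e" "base e'"] by simp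
  qed
  have image: "crd N' i ` (cdom N' i \<inter> cdom N' j) = over (lbl N) L (crd N i ` (cdom N i \<inter> cdom N j))"
    if ij: "i \<in> idx N" "j \<in> idx N" for i j
  proof (intro equalityI subsetI)
    fix y assume "y \<in> crd N' i ` (cdom N' i \<inter> cdom N' j)"
    then obtain e where e: "y = crd N' i e" "e \<in> E" "base e \<in> cdom N i" "base e \<in> cdom N j"
      using ij by (auto simp: cdom)
    have "y $ s = 0" if "s \<notin> lbl N <+> L" for s
      using that e ij crd_off[OF ij(1) e(2,3)] crd_base[OF ij(1) e(2,3)] N.crd_model[OF ij(1) e(3)]
      by (cases s) (auto simp: coord_space_def)
    then have "y \<in> coord_space (lbl N <+> L)" by (simp add: coord_space_def)
    then show "y \<in> over (lbl N) L (crd N i ` (cdom N i \<inter> cdom N j))"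
      using e ij by (auto simp: over_def base_crd)
  next
    fix y assume "y \<in> over (lbl N) L (crd N i ` (cdom N i \<inter> cdom N j))"
    then obtain p where y: "y \<in> coord_space (lbl N <+> L)" and p: "p \<in> cdom N i" "p \<in> cdom N j" "base_part y = crd N i p"
      by (auto simp: over_def)
    obtain e where e: "e \<in> E" "base e = p" "\<And>l. l \<in> L \<Longrightarrow> crd N' i e $ Inr l = y $ Inr l"
      using fibre_ex[OF ij(1) p(1), of "\<lambda>l. y $ Inr l"] by blast
    have "crd N' i e $ s = y $ s" for s
    proof (cases s)
      case (Inl k)
      have "crd N i p $ k = y $ Inl k" using base_part_nth[of y k] unfolding p(3) .
      then show ?thesis using crd_base[OF ij(1) e(1)] e p Inl by simp
    next
      case (Inr l)
      then show ?thesis using crd_off[OF ij(1) e(1)] e p y by (cases "l \<in> L") (auto simp: coord_space_def)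
    qed
    then show "y \<in> crd N' i ` (cdom N' i \<inter> cdom N' j)"
      using e p ij by (intro image_eqI[of _ _ e]) (auto simp: vec_eq_iff cdom)
  qed
  show "crd N' i ` cdom N' i = over (lbl N) L (crd N i ` cdom N i)" if "i \<in> idx N" for i
    using image[OF that that] by simp
  show "charted N'"
  proof
    show "(\<Union>i\<in>idx N'. cdom N' i) = pts N'"
      using N.cover by (auto simp: idx cdom pts)
    show "inj_on (crd N' i) (cdom N' i)" if "i \<in> idx N'" for i
      using that inj by (auto simp: inj_on_def idx cdom)
    fix i j assume "i \<in> idx N'" "j \<in> idx N'"
    then have ij: "i \<in> idx N" "j \<in> idx N" by (auto simp: idx)
    let ?U = "crd N i ` (cdom N i \<inter> cdom N j)"
    let ?U' = "crd N' i ` (cdom N' i \<inter> cdom N' j)"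
    show ro: "rel_open (model N') ?U'"
      unfolding image[OF ij] lbl by (intro rel_open_over N.open_overlap ij)
    have trans: "smooth_on (model N') ?U' (\<lambda>y. g (base_part y))" if "smooth_on (model N) ?U g" for g :: "_ \<Rightarrow> real"
      unfolding image[OF ij] lbl by (rule smooth_on_over[OF N.open_overlap[OF ij] that])
    have par: "par N' i y \<in> E \<and> base (par N' i y) \<in> cdom N i \<and> base (par N' i y) \<in> cdom N j
        \<and> crd N' i (par N' i y) = y" if y: "y \<in> ?U'" for y
    proof -
      obtain e where e: "y = crd N' i e" "e \<in> cdom N' i" "e \<in> cdom N' j" using y by auto
      have "inj_on (crd N' i) (cdom N' i)"
        using inj[OF ij(1)] by (auto simp: inj_on_def cdom ij)
      then have "par N' i y = e" using e by (simp add: par_def)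
      then show ?thesis using e by (simp add: cdom ij)
    qed
    show "smooth_on (model N') ?U' (crd N' j \<circ> par N' i)"
    proof (rule smooth_on_componentwise[OF ro])
      fix s :: "'k + 'm"
      show "smooth_on (model N') ?U' (\<lambda>y. (crd N' j \<circ> par N' i) y $ s)"
      proof (cases s)
        case (Inl k)
        have "smooth_on (model N') ?U' (\<lambda>y. (crd N j \<circ> par N i) (base_part y) $ k)"
          by (intro trans smooth_on_vec_nth N.open_overlap N.smooth_transition ij)
        then show ?thesis
        proof (rule smooth_on_cong[THEN iffD1, rotated])
          fix y assume "y \<in> ?U'"
          from par[OF this] show "(crd N j \<circ> par N i) (base_part y) $ k = (crd N' j \<circ> par N' i) y $ s"
            using Inl ij base_crd[OF ij(1), of "par N' i y"] by (simp add: crd_base)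
        qed
      next
        case (Inr l)
        show ?thesis
        proof (cases "l \<in> L")
          case True
          have "smooth_on (model N') ?U' (\<lambda>y. \<Sum>m\<in>L. G i j l m (base_part y) * y $ Inr m)"
            by (intro smooth_on_sum smooth_on_mult smooth_on_nth ro trans G_smooth ij True)
          then show ?thesis
          proof (rule smooth_on_cong[THEN iffD1, rotated])
            fix y assume "y \<in> ?U'"
            from par[OF this] show "(\<Sum>m\<in>L. G i j l m (base_part y) * y $ Inr m) = (crd N' j \<circ> par N' i) y $ s"
              using Inr True ij base_crd[OF ij(1), of "par N' i y"] G[of i j "par N' i y" l] by simp
          qed
        next
          case False
          have "smooth_on (model N') ?U' (\<lambda>y. 0 :: real)" by (rule smooth_on_const[OF ro])
          then show ?thesis
            by (rule smooth_on_cong[THEN iffD1, rotated]) (use par Inr False ij crd_off in auto)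
        qed
      qed
    qed
  qed
qed

lemma smooth_on_minor:
  assumes "rel_open S W" "length ks = length ls"
    and "\<And>k l. k \<in> set ks \<Longrightarrow> l \<in> set ls \<Longrightarrow> smooth_on S W (\<lambda>x. c x k l)"
  shows "smooth_on S W (\<lambda>x. minor (c x) ks ls)"
  unfolding minor_def
  by (intro smooth_on_sum smooth_on_mult smooth_on_prod smooth_on_const assms(1,3))
    (use assms(2) permutes_lessThan_mem in auto)

text \<open>Permuting a list and mapping over it commute. This is the algebra behind the
  compatibility of pullback and wedge.\<close>

lemma wedge_map:
  "length vs = p + q \<Longrightarrow> wedge p q \<omega> \<eta> (map f vs) = wedge p q (\<lambda>us. \<omega> (map f us)) (\<lambda>us. \<eta> (map f us)) vs"
  unfolding wedge_def
  by (intro if_cong arg_cong2[where f = "(/)"] sum.cong refl arg_cong2[where f = "(*)"] arg_cong[where f = \<omega>]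
      arg_cong[where f = \<eta>]) (auto simp: permutes_lessThan_mem)

lemma wedge_cong:
  assumes "\<And>us. length us = p \<Longrightarrow> set us \<subseteq> set vs \<Longrightarrow> \<omega> us = \<omega>' us"
    and "\<And>us. length us = q \<Longrightarrow> set us \<subseteq> set vs \<Longrightarrow> \<eta> us = \<eta>' us"
  shows "wedge p q \<omega> \<eta> vs = wedge p q \<omega>' \<eta>' vs"
proof -
  have "\<omega> (map (\<lambda>j. vs ! \<pi> j) [0..<p]) = \<omega>' (map (\<lambda>j. vs ! \<pi> j) [0..<p])"
    "\<eta> (map (\<lambda>j. vs ! \<pi> j) [p..<p + q]) = \<eta>' (map (\<lambda>j. vs ! \<pi> j) [p..<p + q])"
    if "length vs = p + q" "\<pi> permutes {..<p + q}" for \<pi>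
    using that permutes_lessThan_mem[OF that(2)] by (auto intro!: assms)
  then show ?thesis unfolding wedge_def by (auto intro!: sum.cong)
qed

context charted
begin

definition jac :: "'i \<Rightarrow> 'i \<Rightarrow> 'k \<Rightarrow> 'k \<Rightarrow> real ^ 'k \<Rightarrow> real" where
  "jac i j k l x = transition_jacobian N i j (axis l 1) x $ k"

section \<open>Jacobian matrices of transitions and the tangent bundle\<close>

lemma smooth_on_jac:
  "i \<in> idx N \<Longrightarrow> j \<in> idx N \<Longrightarrow> l \<in> lbl N \<Longrightarrow>
    smooth_on (model N) (crd N i ` (cdom N i \<inter> cdom N j)) (jac i j k l)"
  unfolding jac_def transition_jacobian_def
  by (intro smooth_on_vec_nth open_overlap smooth_on_dir_deriv smooth_transition) auto

lemma coord_space_expansion: "v \<in> coord_space K \<Longrightarrow> v = (\<Sum>l\<in>K. (v $ l) *\<^sub>R axis l 1)"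
proof -
  assume v: "v \<in> coord_space K"
  have "v $ k = (\<Sum>l\<in>K. (v $ l) *\<^sub>R axis l 1) $ k" for k
  proof -
    have "(\<Sum>l\<in>K. (v $ l) *\<^sub>R axis l 1) $ k = (\<Sum>l\<in>K. if l = k then v $ l else 0)"
      unfolding sum_component by (rule sum.cong) (auto simp: axis_def)
    also have "\<dots> = v $ k" using v by (simp add: coord_space_def)
    finally show ?thesis by simp
  qed
  then show ?thesis by (rule vec_eq_iff[THEN iffD2, OF allI])
qed

lemma transition_jacobian_expansion:
  assumes "i \<in> idx N" "j \<in> idx N" "p \<in> cdom N i" "p \<in> cdom N j" "v \<in> model N"
  shows "transition_jacobian N i j v (crd N i p) $ k = (\<Sum>l\<in>lbl N. jac i j k l (crd N i p) * v $ l)"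
proof -
  note L = linear_transition_jacobian[OF assms(1-4)]
  have "transition_jacobian N i j v (crd N i p)
      = transition_jacobian N i j (\<Sum>l\<in>lbl N. (v $ l) *\<^sub>R axis l 1) (crd N i p)"
    using coord_space_expansion[OF assms(5)] by simp
  also have "\<dots> = (\<Sum>l\<in>lbl N. (v $ l) *\<^sub>R transition_jacobian N i j (axis l 1) (crd N i p))"
    by (simp only: linear_sum[OF L] linear_cmul[OF L])
  finally show ?thesis by (simp add: jac_def mult.commute)
qed

lemma vel_jac:
  assumes "w \<in> tangent_space N p" "i \<in> idx N" "j \<in> idx N" "p \<in> cdom N i" "p \<in> cdom N j"
  shows "vel N j w $ k = (\<Sum>l\<in>lbl N. jac i j k l (crd N i p) * vel N i w $ l)"
  using assms vel_transition[of w i j] vel_model[of w i]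
  by (simp add: transition_jacobian_expansion tangent_space_def)

lemma coord_vec:
  assumes "i \<in> idx N" "p \<in> cdom N i" "k \<in> lbl N"
  shows "coord_vec N i p k \<in> tangent_space N p" "vel N i (coord_vec N i p k) = axis k 1"
  using line_vec[OF assms(1,2), of "axis k 1"] assms(3) by (auto simp: coord_vec_line_vec)

lemma vel_coord_vec:
  assumes "i \<in> idx N" "j \<in> idx N" "p \<in> cdom N i" "p \<in> cdom N j" "l \<in> lbl N"
  shows "vel N j (coord_vec N i p l) $ k = jac i j k l (crd N i p)"
  using vel_transition[of "coord_vec N i p l" i j] coord_vec[OF assms(1,3,5)] assms
  by (simp add: jac_def tangent_space_def)

text \<open>Velocities vanish off the labels of \<open>N\<close>, so agreement on the labels gives
  equal velocities and hence equal vectors. Through this instance the algebra of alternating forms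
  becomes available on tangent spaces.\<close>

lemma frame:
  assumes "i \<in> idx N" "p \<in> cdom N i"
  shows "linear_frame (tangent_space N p) (lincomb N) (lbl N) (\<lambda>u k. vel N i u $ k)
    (coord_vec N i p) (coord_covec N i p)"
proof
  fix u v assume u: "u \<in> tangent_space N p" "v \<in> tangent_space N p"
  { fix a b
    show "lincomb N a u b v \<in> tangent_space N p" using lincomb(1)[OF u] .
    show "vel N i (lincomb N a u b v) $ k = a * vel N i u $ k + b * vel N i v $ k" for k
      using lincomb(2)[OF u assms] by simp }
  assume eq: "\<And>k. k \<in> lbl N \<Longrightarrow> vel N i u $ k = vel N i v $ k"
  have "vel N i u \<in> model N" "vel N i v \<in> model N"
    using u assms vel_model by (auto simp: tangent_space_def)
  then have "vel N i u $ k = vel N i v $ k" for k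
    using eq by (cases "k \<in> lbl N") (auto simp: coord_space_def)
  then have "vel N i u = vel N i v" by (simp add: vec_eq_iff)
  then show "u = v" using tangent_space_eqI[OF u assms] by simp
qed (use coord_vec[OF assms] in \<open>auto simp: axis_def coord_covec_def\<close>)

lemma cdom_tangent_bundle:
  "i \<in> idx N \<Longrightarrow> cdom (tangent_bundle N) i = {w \<in> pts (tangent_bundle N). foot w \<in> cdom N i}"
  by (auto simp: tangent_bundle_def foot_tangent)

lemma crd_tangent_bundle:
  "crd (tangent_bundle N) i w $ Inl k = crd N i (foot w) $ k"
  "crd (tangent_bundle N) i w $ Inr k = vel N i w $ k"
  by (simp_all add: tangent_bundle_def)

lemma tangent_bundle_simps [simp]:
  "idx (tangent_bundle N) = idx N" "lbl (tangent_bundle N) = lbl N <+> lbl N"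
  by (simp_all add: tangent_bundle_def)

text \<open>The fibre coordinates are velocities, so the coefficients of the bundle transition are
  the entries \<open>jac\<close>. The conclusion has the form of the locale assumption again, so it
  can be iterated to reach the tangent bundle of the tangent bundle.\<close>

lemma charted_tangent_bundle: "charted (tangent_bundle N)"
  and crd_tangent_bundle_image: "i \<in> idx N \<Longrightarrow>
    crd (tangent_bundle N) i ` cdom (tangent_bundle N) i = over (lbl N) (lbl N) (crd N i ` cdom N i)"
proof -
  have *: "pts (tangent_bundle N) = {e \<in> pts (tangent_bundle N). foot e \<in> pts N}" using rep_pts(4) by auto
  have 1: "crd (tangent_bundle N) i e $ Inr l = 0"
    if "i \<in> idx N" "e \<in> pts (tangent_bundle N)" "foot e \<in> cdom N i" "l \<notin> lbl N" for i e l
    using vel_model[OF that(2,1,3)] that(4) by (simp add: crd_tangent_bundle coord_space_def)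
  have 2: "\<exists>e\<in>pts (tangent_bundle N). foot e = p \<and> (\<forall>l\<in>lbl N. crd (tangent_bundle N) i e $ Inr l = c l)"
    if "i \<in> idx N" "p \<in> cdom N i" for i p c
    using line_vec[OF that, of "\<chi> l. if l \<in> lbl N then c l else 0"]
    by (intro bexI[of _ "line_vec N i p (\<chi> l. if l \<in> lbl N then c l else 0)"])
      (auto simp: coord_space_def crd_tangent_bundle)
  have 3: "e = e'" if "i \<in> idx N" "e \<in> pts (tangent_bundle N)" "e' \<in> pts (tangent_bundle N)" "foot e \<in> cdom N i"
      "foot e = foot e'" "\<And>l. l \<in> lbl N \<Longrightarrow> crd (tangent_bundle N) i e $ Inr l = crd (tangent_bundle N) i e' $ Inr l" for i e e'
  proof -
    interpret linear_frame "tangent_space N (foot e)" "lincomb N" "lbl N" "\<lambda>u k. vel N i u $ k"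
      "coord_vec N i (foot e)" "coord_covec N i (foot e)" by (rule frame) (use that in auto)
    show ?thesis using that co_inj[of e e'] by (simp add: crd_tangent_bundle tangent_space_def)
  qed
  have 4: "crd (tangent_bundle N) j e $ Inr l = (\<Sum>m\<in>lbl N. jac i j l m (crd N i (foot e)) * crd (tangent_bundle N) i e $ Inr m)"
    if "i \<in> idx N" "j \<in> idx N" "e \<in> pts (tangent_bundle N)" "foot e \<in> cdom N i" "foot e \<in> cdom N j" "l \<in> lbl N" for i j e l
    using vel_jac[of e "foot e" i j l] that by (simp add: crd_tangent_bundle tangent_space_def)
  note TB = vector_bundle_charted[where N = N and N' = "tangent_bundle N" and base = foot and E = "pts (tangent_bundle N)"
      and L = "lbl N" and G = jac, OF charted_axioms tangent_bundle_simps cdom_tangent_bundle *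
      crd_tangent_bundle(1) 1 2 3 smooth_on_jac 4]
  show "charted (tangent_bundle N)" by (rule TB(1)) assumption+
  show "i \<in> idx N \<Longrightarrow>
    crd (tangent_bundle N) i ` cdom (tangent_bundle N) i = over (lbl N) (lbl N) (crd N i ` cdom N i)"
    by (rule TB(2)) assumption+
qed

end

abbreviation basis_form :: "('a, 'i, 'k::finite) manifold \<Rightarrow> 'i \<Rightarrow> 'a \<Rightarrow> 'k set \<Rightarrow> 'a form" where
  "basis_form N i p I \<equiv> wedge_list (map (coord_covec N i p) (enum I))"

abbreviation basis_vecs :: "('a, 'i, 'k::finite) manifold \<Rightarrow> 'i \<Rightarrow> 'a \<Rightarrow> 'k set \<Rightarrow> 'a tvec list" where
  "basis_vecs N i p I \<equiv> map (coord_vec N i p) (enum I)"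

section \<open>Coordinates of forms and multivectors\<close>

lemma index_sets_finite: "finite (index_sets (K :: 'k::finite set) r)"
  by simp

lemma enum_index_sets:
  assumes "I \<in> index_sets (K :: 'k::finite set) r"
  shows "distinct (enum I)" "set (enum I) = I" "length (enum I) = r" "I \<subseteq> K"
  using assms enum[of I] by (auto simp: index_sets_def)

lemma mvecs_zero: "X \<in> mvecs N r p \<Longrightarrow> \<omega> \<in> forms N r p \<Longrightarrow> X (\<lambda>vs. 0) = 0"
proof -
  assume X: "X \<in> mvecs N r p" and \<omega>: "\<omega> \<in> forms N r p"
  from X have "\<forall>a b. \<forall>\<omega>\<in>forms N r p. \<forall>\<eta>\<in>forms N r p. X (\<lambda>vs. a * \<omega> vs + b * \<eta> vs) = a * X \<omega> + b * X \<eta>"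
    by (simp add: mvecs_def)
  from this[rule_format, OF \<omega> \<omega>, of 0 0] show ?thesis by simp
qed

lemma mvecs_off: "X \<in> mvecs N r p \<Longrightarrow> \<omega> \<notin> forms N r p \<Longrightarrow> X \<omega> = 0"
  by (simp add: mvecs_def)

lemma mvecs_linear:
  "X \<in> mvecs N r p \<Longrightarrow> \<omega> \<in> forms N r p \<Longrightarrow> \<eta> \<in> forms N r p \<Longrightarrow>
    X (\<lambda>vs. a * \<omega> vs + b * \<eta> vs) = a * X \<omega> + b * X \<eta>"
  by (simp add: mvecs_def)

lemma forms_lincomb:
  "\<omega> \<in> forms N r p \<Longrightarrow> \<eta> \<in> forms N r p \<Longrightarrow> (\<lambda>vs. a * \<omega> vs + b * \<eta> vs) \<in> forms N r p"
  unfolding forms_alt_forms by (rule alt_forms_lincomb)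

lemma forms_zero: "(\<lambda>vs. 0) \<in> forms N r p"
  unfolding forms_alt_forms by (rule alt_forms_zero)

lemma forms_sum: "(\<And>i. i \<in> I \<Longrightarrow> f i \<in> forms N r p) \<Longrightarrow> (\<lambda>vs. \<Sum>i\<in>I. c i * f i vs) \<in> forms N r p"
  unfolding forms_alt_forms by (rule alt_forms_sum)

lemma wedge_forms: "\<omega> \<in> forms N r p \<Longrightarrow> \<eta> \<in> forms N s p \<Longrightarrow> wedge r s \<omega> \<eta> \<in> forms N (r + s) p"
  unfolding forms_alt_forms by (rule wedge_alt_forms)

lemma mvecs_sum:
  assumes "X \<in> mvecs N r p" "\<And>i. i \<in> I \<Longrightarrow> f i \<in> forms N r p"
  shows "X (\<lambda>vs. \<Sum>i\<in>I. c i * f i vs) = (\<Sum>i\<in>I. c i * X (f i))"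
  using assms(2)
proof (induction I rule: infinite_finite_induct)
  case (insert i I)
  have "X (\<lambda>vs. c i * f i vs + 1 * (\<Sum>i\<in>I. c i * f i vs)) = c i * X (f i) + 1 * X (\<lambda>vs. \<Sum>i\<in>I. c i * f i vs)"
    using insert by (intro mvecs_linear[OF assms(1)] forms_sum) auto
  then show ?case using insert by simp
qed (simp_all add: mvecs_zero[OF assms(1) forms_zero])

context charted
begin

lemma form_eqI:
  assumes "i \<in> idx N" "p \<in> cdom N i" "\<omega> \<in> forms N r p" "\<eta> \<in> forms N r p"
    and "\<And>I. I \<in> index_sets (lbl N) r \<Longrightarrow> \<omega> (basis_vecs N i p I) = \<eta> (basis_vecs N i p I)"
  shows "\<omega> = \<eta>"
proof -
  interpret linear_frame "tangent_space N p" "lincomb N" "lbl N" "\<lambda>u k. vel N i u $ k"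
    "coord_vec N i p" "coord_covec N i p" by (rule frame[OF assms(1,2)])
  show ?thesis using alt_eqI[of \<omega> r \<eta>] assms(3-) by (simp add: forms_alt_forms)
qed

lemma form_expansion:
  assumes "i \<in> idx N" "p \<in> cdom N i" "\<omega> \<in> forms N r p"
  shows "\<omega> = (\<lambda>vs. \<Sum>I\<in>index_sets (lbl N) r. \<omega> (basis_vecs N i p I) * basis_form N i p I vs)"
proof -
  interpret linear_frame "tangent_space N p" "lincomb N" "lbl N" "\<lambda>u k. vel N i u $ k"
    "coord_vec N i p" "coord_covec N i p" by (rule frame[OF assms(1,2)])
  show ?thesis using alt_expansion[of \<omega> r] assms(3) unfolding forms_alt_forms .
qed

lemma basis_form:
  assumes "i \<in> idx N" "p \<in> cdom N i" "I \<in> index_sets (lbl N) r"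
  shows "basis_form N i p I \<in> forms N r p"
    and "J \<in> index_sets (lbl N) r \<Longrightarrow> basis_form N i p I (basis_vecs N i p J) = (if I = J then 1 else 0)"
proof -
  interpret linear_frame "tangent_space N p" "lincomb N" "lbl N" "\<lambda>u k. vel N i u $ k"
    "coord_vec N i p" "coord_covec N i p" by (rule frame[OF assms(1,2)])
  show "basis_form N i p I \<in> forms N r p"
    using wedge_cov_alt[of "enum I"] index_set[OF assms(3)] by (simp add: forms_alt_forms)
  show "J \<in> index_sets (lbl N) r \<Longrightarrow> basis_form N i p I (basis_vecs N i p J) = (if I = J then 1 else 0)"
    by (rule wedge_cov_enum[OF assms(3)])
qed

lemma coord_covec_form: "i \<in> idx N \<Longrightarrow> p \<in> cdom N i \<Longrightarrow> k \<in> lbl N \<Longrightarrow> coord_covec N i p k \<in> forms N 1 p"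
  unfolding forms_alt_forms using linear_frame.cov_alt[OF frame] by metis

lemma coord_covec_apply: "u \<in> tangent_space N p \<Longrightarrow> coord_covec N i p k [u] = vel N i u $ k"
  by (simp add: coord_covec_def)

text \<open>Evaluated on the coordinate frame of another chart, coordinate covectors give entries of
  the Jacobian, so their wedges give its minors. These are the transition coefficients of both the
  form and the multivector bundles.\<close>

lemma basis_form_basis_vecs:
  assumes "i \<in> idx N" "p \<in> cdom N i" "j \<in> idx N" "p \<in> cdom N j"
    and "I \<in> index_sets (lbl N) r" "J \<in> index_sets (lbl N) r"
  shows "basis_form N i p I (basis_vecs N j p J) = minor (\<lambda>k l. jac j i k l (crd N j p)) (enum I) (enum J)"
proof -
  note I = enum_index_sets[OF assms(5)] and J = enum_index_sets[OF assms(6)]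
  have "basis_form N i p I (basis_vecs N j p J) = minor (\<lambda>k l. coord_covec N i p k [coord_vec N j p l]) (enum I) (enum J)"
    using I J by (simp add: wedge_list_eq_minor minor_map)
  also have "\<dots> = minor (\<lambda>k l. jac j i k l (crd N j p)) (enum I) (enum J)"
  proof (rule minor_cong)
    fix k l assume "k \<in> set (enum I)" "l \<in> set (enum J)"
    then have l: "l \<in> lbl N" using J by auto
    show "coord_covec N i p k [coord_vec N j p l] = jac j i k l (crd N j p)"
      using coord_covec_apply[OF coord_vec(1)[OF assms(3,4) l]] vel_coord_vec[OF assms(3,1,4,2) l] by simp
  qed (use I J in simp)
  finally show ?thesis .
qed

text \<open>Expanding the form in the basis dual to the frame makes the pairing a bilinear
  expression in bundle coordinates. Smoothness and jet statements about the pairing rest on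
  this.\<close>

lemma mvec_pairing:
  assumes "i \<in> idx N" "p \<in> cdom N i" "X \<in> mvecs N r p" "\<omega> \<in> forms N r p"
  shows "X \<omega> = (\<Sum>I\<in>index_sets (lbl N) r. \<omega> (basis_vecs N i p I) * X (basis_form N i p I))"
proof -
  have "X \<omega> = X (\<lambda>vs. \<Sum>I\<in>index_sets (lbl N) r. \<omega> (basis_vecs N i p I) * basis_form N i p I vs)"
    using form_expansion[OF assms(1,2,4)] by simp
  also have "\<dots> = (\<Sum>I\<in>index_sets (lbl N) r. \<omega> (basis_vecs N i p I) * X (basis_form N i p I))"
    by (rule mvecs_sum[OF assms(3)]) (rule basis_form[OF assms(1,2)])
  finally show ?thesis .
qed

lemma mvec_eqI:
  assumes "i \<in> idx N" "p \<in> cdom N i" "X \<in> mvecs N r p" "Y \<in> mvecs N r p"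
    and "\<And>I. I \<in> index_sets (lbl N) r \<Longrightarrow> X (basis_form N i p I) = Y (basis_form N i p I)"
  shows "X = Y"
proof
  fix \<omega>
  show "X \<omega> = Y \<omega>"
    using mvec_pairing[OF assms(1,2,3), of \<omega>] mvec_pairing[OF assms(1,2,4), of \<omega>] assms(5)
      mvecs_off[OF assms(3)] mvecs_off[OF assms(4)] by (cases "\<omega> \<in> forms N r p") auto
qed

section \<open>Atlases of the bundles of forms and multivectors\<close>

lemma form_bundle_simps [simp]:
  "idx (form_bundle N r) = idx N" "lbl (form_bundle N r) = lbl N <+> index_sets (lbl N) r"
  by (simp_all add: form_bundle_def index_sets_def)

lemma mvec_bundle_simps [simp]:
  "idx (mvec_bundle N r) = idx N" "lbl (mvec_bundle N r) = lbl N <+> index_sets (lbl N) r"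
  by (simp_all add: mvec_bundle_def index_sets_def)

lemma pts_form_bundle: "pts (form_bundle N r) = {(p, \<omega>). p \<in> pts N \<and> \<omega> \<in> forms N r p}"
  by (simp add: form_bundle_def)

lemma pts_mvec_bundle: "pts (mvec_bundle N r) = {(p, X). p \<in> pts N \<and> X \<in> mvecs N r p}"
  by (simp add: mvec_bundle_def)

lemma cdom_form_bundle: "cdom (form_bundle N r) i = {(p, \<omega>). p \<in> cdom N i \<and> \<omega> \<in> forms N r p}"
  by (simp add: form_bundle_def)

lemma cdom_mvec_bundle: "cdom (mvec_bundle N r) i = {(p, X). p \<in> cdom N i \<and> X \<in> mvecs N r p}"
  by (simp add: mvec_bundle_def)

lemma crd_form_bundle:
  "crd (form_bundle N r) i e $ Inl k = crd N i (fst e) $ k"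
  "crd (form_bundle N r) i e $ Inr I =
    (if I \<in> index_sets (lbl N) r then snd e (basis_vecs N i (fst e) I) else 0)"
  by (cases e; simp add: form_bundle_def index_sets_def)+

lemma crd_mvec_bundle:
  "crd (mvec_bundle N r) i e $ Inl k = crd N i (fst e) $ k"
  "crd (mvec_bundle N r) i e $ Inr I =
    (if I \<in> index_sets (lbl N) r then snd e (basis_form N i (fst e) I) else 0)"
  by (cases e; simp add: mvec_bundle_def index_sets_def)+

text \<open>Evaluations at the basis lists are dual to the basis forms, so weighting them by
  \<open>c\<close> produces an \<open>r\<close>-vector with prescribed components.\<close>

lemma basis_functional:
  fixes c :: "'k set \<Rightarrow> real" and r :: nat
  assumes "i \<in> idx N" "p \<in> cdom N i"
  defines "X \<equiv> \<lambda>\<eta>. if \<eta> \<in> forms N r p then \<Sum>I\<in>index_sets (lbl N) r. c I * \<eta> (basis_vecs N i p I) else 0"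
  shows "X \<in> mvecs N r p" "I \<in> index_sets (lbl N) r \<Longrightarrow> X (basis_form N i p I) = c I"
proof -
  show "X \<in> mvecs N r p"
    by (auto simp: X_def mvecs_def forms_lincomb algebra_simps sum.distrib sum_distrib_left)
  assume I: "I \<in> index_sets (lbl N) r"
  have "(\<Sum>J\<in>index_sets (lbl N) r. c J * basis_form N i p I (basis_vecs N i p J))
      = (\<Sum>J\<in>index_sets (lbl N) r. if J = I then c J else 0)"
    by (intro sum.cong refl) (simp add: basis_form[OF assms(1,2) I])
  also have "\<dots> = c I" using I by (simp add: index_sets_finite)
  finally show "X (basis_form N i p I) = c I" using basis_form(1)[OF assms(1,2) I] by (simp add: X_def)
qed

lemma smooth_on_overlap_compose:
  assumes "i \<in> idx N" "j \<in> idx N" "smooth_on (model N) (crd N j ` (cdom N j \<inter> cdom N i)) g"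
  shows "smooth_on (model N) (crd N i ` (cdom N i \<inter> cdom N j)) (\<lambda>x. g ((crd N j \<circ> par N i) x))"
  by (rule smooth_on_compose[OF open_overlap open_overlap[of j i] _ smooth_transition assms(3)])
    (use assms in auto)

lemma charted_form_bundle: "charted (form_bundle N r)"
  and crd_form_bundle_image: "i \<in> idx N \<Longrightarrow>
    crd (form_bundle N r) i ` cdom (form_bundle N r) i
      = over (lbl N) (index_sets (lbl N) r) (crd N i ` cdom N i)"
proof -
  let ?F = "form_bundle N r" and ?L = "index_sets (lbl N) r"
  \<comment> \<open>Forms transform by the Jacobian in the opposite direction, from chart
    \<open>j\<close> back to chart \<open>i\<close>. It is a function of the coordinates in
    \<open>j\<close>, which are therefore expressed through those in \<open>i\<close> by the
    transition map.\<close>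
  let ?G = "\<lambda>i j J I x. minor (\<lambda>k l. jac j i k l ((crd N j \<circ> par N i) x)) (enum I) (enum J)"
  have cd: "cdom ?F i = {e \<in> pts ?F. fst e \<in> cdom N i}" if "i \<in> idx N" for i
    using that cdom_pts by (auto simp: cdom_form_bundle pts_form_bundle)
  have *: "pts ?F = {e \<in> pts ?F. fst e \<in> pts N}" by (auto simp: pts_form_bundle)
  have 2: "\<exists>e\<in>pts ?F. fst e = p \<and> (\<forall>l\<in>?L. crd ?F i e $ Inr l = c l)" if ip: "i \<in> idx N" "p \<in> cdom N i" for i p c
  proof -
    let ?\<omega> = "\<lambda>vs. \<Sum>I\<in>?L. c I * basis_form N i p I vs"
    have \<omega>: "?\<omega> \<in> forms N r p" by (intro forms_sum basis_form[OF ip])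
    have "?\<omega> (basis_vecs N i p J) = c J" if "J \<in> ?L" for J
    proof -
      have "?\<omega> (basis_vecs N i p J) = (\<Sum>I\<in>?L. if I = J then c I else 0)"
        by (intro sum.cong refl) (simp add: basis_form[OF ip] that)
      then show ?thesis using that by (simp add: index_sets_finite)
    qed
    then show ?thesis using \<omega> ip cdom_pts
      by (intro bexI[of _ "(p, ?\<omega>)"]) (auto simp: crd_form_bundle pts_form_bundle)
  qed
  have 3: "e = e'" if "i \<in> idx N" "e \<in> pts ?F" "e' \<in> pts ?F" "fst e \<in> cdom N i"
      "fst e = fst e'" "\<And>l. l \<in> ?L \<Longrightarrow> crd ?F i e $ Inr l = crd ?F i e' $ Inr l" for i e e'
    using that form_eqI[of i "fst e" "snd e" r "snd e'"] by (auto simp: pts_form_bundle crd_form_bundle)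
  have 4: "smooth_on (model N) (crd N i ` (cdom N i \<inter> cdom N j)) (?G i j l m)"
    if "i \<in> idx N" "j \<in> idx N" "l \<in> ?L" "m \<in> ?L" for i j l m
    using that enum_index_sets[OF that(3)] enum_index_sets[OF that(4)]
    by (intro smooth_on_minor open_overlap smooth_on_overlap_compose smooth_on_jac) auto
  have 5: "crd ?F j e $ Inr J = (\<Sum>I\<in>?L. ?G i j J I (crd N i (fst e)) * crd ?F i e $ Inr I)"
    if "i \<in> idx N" "j \<in> idx N" "e \<in> pts ?F" "fst e \<in> cdom N i" "fst e \<in> cdom N j" "J \<in> ?L" for i j e J
  proof -
    have "snd e \<in> forms N r (fst e)" using that by (auto simp: pts_form_bundle)
    from fun_cong[OF form_expansion[OF that(1,4) this], of "basis_vecs N j (fst e) J"] show ?thesis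
      using that by (simp add: crd_form_bundle basis_form_basis_vecs mult.commute)
  qed
  note FB = vector_bundle_charted[where N = N and N' = ?F and base = fst and E = "pts ?F"
      and L = ?L and G = ?G, OF charted_axioms form_bundle_simps cd *
      crd_form_bundle(1) _ 2 3 4 5]
  show "charted ?F" by (rule FB(1)) (assumption | simp add: crd_form_bundle)+
  show "i \<in> idx N \<Longrightarrow> crd ?F i ` cdom ?F i = over (lbl N) ?L (crd N i ` cdom N i)"
    by (rule FB(2)) (assumption | simp add: crd_form_bundle)+
qed

lemma charted_mvec_bundle: "charted (mvec_bundle N r)"
proof -
  let ?F = "mvec_bundle N r" and ?L = "index_sets (lbl N) r"
  \<comment> \<open>In contrast to forms, multivectors are pushed forward: the Jacobian from
    \<open>i\<close> to \<open>j\<close> enters, with the labels of the new index set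
    \<open>J\<close> as rows.\<close>
  let ?G = "\<lambda>i j J I x. minor (\<lambda>k l. jac i j k l x) (enum J) (enum I)"
  have cd: "cdom ?F i = {e \<in> pts ?F. fst e \<in> cdom N i}" if "i \<in> idx N" for i
    using that cdom_pts by (auto simp: cdom_mvec_bundle pts_mvec_bundle)
  have *: "pts ?F = {e \<in> pts ?F. fst e \<in> pts N}" by (auto simp: pts_mvec_bundle)
  have 2: "\<exists>e\<in>pts ?F. fst e = p \<and> (\<forall>l\<in>?L. crd ?F i e $ Inr l = c l)" if ip: "i \<in> idx N" "p \<in> cdom N i" for i p c
    using basis_functional[OF ip, where r = r and c = c] ip cdom_pts
    by (intro bexI[of _ "(p, \<lambda>\<eta>. if \<eta> \<in> forms N r p then \<Sum>I\<in>?L. c I * \<eta> (basis_vecs N i p I) else 0)"])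
      (simp_all add: crd_mvec_bundle pts_mvec_bundle)
  have 3: "e = e'" if "i \<in> idx N" "e \<in> pts ?F" "e' \<in> pts ?F" "fst e \<in> cdom N i"
      "fst e = fst e'" "\<And>l. l \<in> ?L \<Longrightarrow> crd ?F i e $ Inr l = crd ?F i e' $ Inr l" for i e e'
    using that mvec_eqI[of i "fst e" "snd e" r "snd e'"] by (auto simp: pts_mvec_bundle crd_mvec_bundle)
  have 4: "smooth_on (model N) (crd N i ` (cdom N i \<inter> cdom N j)) (?G i j l m)"
    if "i \<in> idx N" "j \<in> idx N" "l \<in> ?L" "m \<in> ?L" for i j l m
    using that enum_index_sets[OF that(3)] enum_index_sets[OF that(4)]
    by (intro smooth_on_minor open_overlap smooth_on_jac) auto
  have 5: "crd ?F j e $ Inr J = (\<Sum>I\<in>?L. ?G i j J I (crd N i (fst e)) * crd ?F i e $ Inr I)"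
    if "i \<in> idx N" "j \<in> idx N" "e \<in> pts ?F" "fst e \<in> cdom N i" "fst e \<in> cdom N j" "J \<in> ?L" for i j e J
  proof -
    have "snd e \<in> mvecs N r (fst e)" using that by (auto simp: pts_mvec_bundle)
    from mvec_pairing[OF that(1,4) this basis_form(1)[OF that(2,5,6)]] show ?thesis
      using that by (simp add: crd_mvec_bundle basis_form_basis_vecs)
  qed
  note MB = vector_bundle_charted[where N = N and N' = ?F and base = fst and E = "pts ?F"
      and L = ?L and G = ?G, OF charted_axioms mvec_bundle_simps cd *
      crd_mvec_bundle(1) _ 2 3 4 5]
  show "charted ?F" by (rule MB(1)) (assumption | simp add: crd_mvec_bundle)+
qed

text \<open>Read in charts with the same index, the projection is the linear map
  \<open>base_part\<close>.\<close>

lemma smooth_map_base: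
  assumes "charted N'" "idx N' = idx N" "lbl N' = lbl N <+> L"
    and mem: "\<And>i e. i \<in> idx N \<Longrightarrow> e \<in> cdom N' i \<Longrightarrow> base e \<in> cdom N i"
    and crd: "\<And>i e k. i \<in> idx N \<Longrightarrow> e \<in> cdom N' i \<Longrightarrow> crd N' i e $ Inl k = crd N i (base e) $ k"
  shows "smooth_map N' N base"
  unfolding smooth_map_def
proof (intro conjI ballI)
  interpret N': charted N' by fact
  show "base ` pts N' \<subseteq> pts N"
    using N'.pts_chart mem cdom_pts assms(2) by fastforce
  fix e assume "e \<in> pts N'"
  then obtain i where i: "i \<in> idx N" "e \<in> cdom N' i" using N'.pts_chart assms(2) by auto
  have i': "i \<in> idx N'" using i assms by simp
  let ?W = "crd N' i ` cdom N' i"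
  have ro: "rel_open (model N') ?W" using N'.open_chart[OF i'] .
  have "smooth_on (model N') ?W (\<lambda>y. crd N i (base (par N' i y)))"
  proof (rule smooth_on_cong[THEN iffD1, OF _ smooth_on_base_part])
    show "rel_open (model N') ?W" by (rule ro)
    show "base_part y = crd N i (base (par N' i y))" if "y \<in> ?W" for y
      using N'.crd_par[OF i' that] crd[OF i(1) N'.par_mem[OF i' that]] by (simp add: vec_eq_iff)
  qed
  moreover have "base (par N' i y) \<in> cdom N i" if "y \<in> ?W" for y
    using mem[OF i(1) N'.par_mem[OF i' that]] .
  ultimately show "\<exists>i\<in>idx N'. \<exists>j\<in>idx N. \<exists>W. e \<in> cdom N' i \<and> base e \<in> cdom N j \<and> crd N' i e \<in> W \<and>
      W \<subseteq> crd N' i ` cdom N' i \<and> openin (top_of_set (model N')) W \<and>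
      (\<forall>y\<in>W. base (par N' i y) \<in> cdom N j) \<and> smooth_on (model N') W (\<lambda>y. crd N j (base (par N' i y)))"
    using i i' mem ro by (intro bexI[of _ i] exI[of _ ?W]) (auto simp: rel_open_def)
qed

lemma smooth_map_fst_form_bundle: "smooth_map (form_bundle N r) N fst"
  by (rule smooth_map_base[OF charted_form_bundle form_bundle_simps])
    (auto simp: cdom_form_bundle crd_form_bundle)

lemma smooth_map_fst_mvec_bundle: "smooth_map (mvec_bundle N r) N fst"
  by (rule smooth_map_base[OF charted_mvec_bundle mvec_bundle_simps])
    (auto simp: cdom_mvec_bundle crd_mvec_bundle)

end

section \<open>Contractions\<close>

context charted
begin

section \<open>Multivector fields in coordinates\<close>

lemma mvec_field_mem:
  assumes "X \<in> mvec_fields N r" "p \<in> pts N"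
  shows "fst (X p) = p" "snd (X p) \<in> mvecs N r p"
proof -
  show "fst (X p) = p" using assms by (simp add: mvec_fields_def)
  moreover have "X p \<in> pts (mvec_bundle N r)"
    using assms by (auto simp: mvec_fields_def smooth_map_def)
  ultimately show "snd (X p) \<in> mvecs N r p" by (auto simp: pts_mvec_bundle)
qed

text \<open>Smoothness as a map may be witnessed by different charts of the base for source and
  target. A transition moves the source to the chart \<open>j\<close> of the target, so that a
  single chart describes both.\<close>

lemma mvec_field_smooth:
  assumes X: "X \<in> mvec_fields N r" and p: "p \<in> pts N"
  shows "\<exists>j W. j \<in> idx N \<and> p \<in> cdom N j \<and> crd N j p \<in> W \<and> W \<subseteq> crd N j ` cdom N j \<and> rel_open (model N) W \<and>
    (\<forall>I\<in>index_sets (lbl N) r. smooth_on (model N) W (\<lambda>y. snd (X (par N j y)) (basis_form N j (par N j y) I)))"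
proof -
  have sm: "smooth_map N (mvec_bundle N r) X" using X by (simp add: mvec_fields_def)
  obtain i j W where ij: "i \<in> idx N" "j \<in> idx N" "p \<in> cdom N i" "X p \<in> cdom (mvec_bundle N r) j"
    and W: "crd N i p \<in> W" "W \<subseteq> crd N i ` cdom N i" "rel_open (model N) W"
    and s: "smooth_on (model N) W (\<lambda>y. crd (mvec_bundle N r) j (X (par N i y)))"
    using smooth_mapD[OF sm p] unfolding mvec_bundle_simps by metis
  have pj: "p \<in> cdom N j" using ij(4) mvec_field_mem(1)[OF X p] by (auto simp: cdom_mvec_bundle)
  let ?U = "crd N j ` (cdom N j \<inter> cdom N i)"
  let ?\<phi> = "crd N i \<circ> par N j"
  let ?W = "?U \<inter> ?\<phi> -` W"
  have U: "rel_open (model N) ?U" by (rule open_overlap[OF ij(2,1)])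
  have sub: "?\<phi> ` ?U \<subseteq> model N" using ij crd_model by auto
  have ro: "rel_open (model N) ?W"
    by (rule rel_open_preimage[OF U smooth_on_continuous[OF smooth_transition[OF ij(2,1)]] sub W(3)])
  have s\<phi>: "smooth_on (model N) ?W ?\<phi>"
    by (rule smooth_on_subset[OF U ro _ smooth_transition[OF ij(2,1)]]) auto
  have "smooth_on (model N) ?W (\<lambda>y. snd (X (par N j y)) (basis_form N j (par N j y) I))"
    if I: "I \<in> index_sets (lbl N) r" for I
  proof -
    have "smooth_on (model N) ?W (\<lambda>y. crd (mvec_bundle N r) j (X (par N i (?\<phi> y))) $ Inr I)"
      by (intro smooth_on_vec_nth ro smooth_on_compose[OF ro W(3) _ s\<phi> s]) auto
    then show ?thesis
    proof (rule smooth_on_cong[THEN iffD1, rotated])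
      fix y assume "y \<in> ?W"
      then obtain q where q: "y = crd N j q" "q \<in> cdom N j" "q \<in> cdom N i" by auto
      then have "fst (X q) = q" using mvec_field_mem(1)[OF X] cdom_pts ij by auto
      then show "crd (mvec_bundle N r) j (X (par N i (?\<phi> y))) $ Inr I
          = snd (X (par N j y)) (basis_form N j (par N j y) I)"
        using q ij I by (simp add: crd_mvec_bundle)
    qed
  qed
  then show ?thesis using ro ij pj W by (intro exI[of _ j] exI[of _ ?W]) auto
qed

text \<open>Read in one chart for source and target, the base components of a section are the
  identity, so only its fibre components have to be checked.\<close>

lemma mvec_fieldI:
  assumes "Y \<in> extensional (pts N)" "\<And>p. p \<in> pts N \<Longrightarrow> fst (Y p) = p"
    and "\<And>p. p \<in> pts N \<Longrightarrow> snd (Y p) \<in> mvecs N r p"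
    and "\<And>p. p \<in> pts N \<Longrightarrow> \<exists>j W. j \<in> idx N \<and> p \<in> cdom N j \<and> crd N j p \<in> W \<and> W \<subseteq> crd N j ` cdom N j \<and>
      rel_open (model N) W \<and>
      (\<forall>I\<in>index_sets (lbl N) r. smooth_on (model N) W (\<lambda>y. snd (Y (par N j y)) (basis_form N j (par N j y) I)))"
  shows "Y \<in> mvec_fields N r"
proof -
  have mem: "Y q \<in> cdom (mvec_bundle N r) j" if "j \<in> idx N" "q \<in> cdom N j" for j q
    using that assms(2,3)[of q] cdom_pts by (cases "Y q") (auto simp: cdom_mvec_bundle)
  have "smooth_map N (mvec_bundle N r) Y"
    unfolding smooth_map_def
  proof (intro conjI ballI)
    show "Y ` pts N \<subseteq> pts (mvec_bundle N r)"
    proof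
      fix e assume "e \<in> Y ` pts N"
      then obtain p where "p \<in> pts N" "e = Y p" by auto
      then show "e \<in> pts (mvec_bundle N r)" using assms(2,3)[of p] by (cases e) (auto simp: pts_mvec_bundle)
    qed
    fix p assume p: "p \<in> pts N"
    obtain j W where j: "j \<in> idx N" "p \<in> cdom N j" and W: "crd N j p \<in> W" "W \<subseteq> crd N j ` cdom N j" "rel_open (model N) W"
      and s: "\<forall>I\<in>index_sets (lbl N) r. smooth_on (model N) W (\<lambda>y. snd (Y (par N j y)) (basis_form N j (par N j y) I))"
      using assms(4)[OF p] by (elim exE conjE)
    have par: "par N j y \<in> cdom N j" "crd N j (par N j y) = y" if "y \<in> W" for y
      using that W(2) j par_mem crd_par by auto
    have fst: "fst (Y (par N j y)) = par N j y" if "y \<in> W" for y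
      using assms(2) cdom_pts[OF j(1)] par[OF that] by auto
    have "smooth_on (model N) W (\<lambda>y. crd (mvec_bundle N r) j (Y (par N j y)))"
    proof (rule smooth_on_componentwise[OF W(3)])
      fix s :: "'k + 'k set"
      show "smooth_on (model N) W (\<lambda>y. crd (mvec_bundle N r) j (Y (par N j y)) $ s)"
      proof (cases s)
        case (Inl k)
        have "smooth_on (model N) W (\<lambda>y. y $ k)" by (rule smooth_on_nth[OF W(3)])
        then show ?thesis
          by (rule smooth_on_cong[THEN iffD1, rotated]) (simp add: Inl crd_mvec_bundle fst par)
      next
        case (Inr I)
        show ?thesis
        proof (cases "I \<in> index_sets (lbl N) r")
          case True
          from s[rule_format, OF this] show ?thesis
            by (rule smooth_on_cong[THEN iffD1, rotated]) (simp add: Inr True crd_mvec_bundle fst)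
        next
          case False
          have "smooth_on (model N) W (\<lambda>y. 0 :: real)" by (rule smooth_on_const[OF W(3)])
          then show ?thesis
            by (rule smooth_on_cong[THEN iffD1, rotated]) (simp add: Inr False crd_mvec_bundle)
        qed
      qed
    qed
    moreover have "Y (par N j y) \<in> cdom (mvec_bundle N r) j" if "y \<in> W" for y
      using mem j par that by auto
    ultimately show "\<exists>i\<in>idx N. \<exists>j\<in>idx (mvec_bundle N r). \<exists>W. p \<in> cdom N i \<and> Y p \<in> cdom (mvec_bundle N r) j \<and>
        crd N i p \<in> W \<and> W \<subseteq> crd N i ` cdom N i \<and> openin (top_of_set (model N)) W \<and>
        (\<forall>y\<in>W. Y (par N i y) \<in> cdom (mvec_bundle N r) j) \<and>
        smooth_on (model N) W (\<lambda>y. crd (mvec_bundle N r) j (Y (par N i y)))"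
      using j W mem by (intro bexI[of _ j] exI[of _ W]) (auto simp: rel_open_def)
  qed
  then show ?thesis using assms(1,2) by (simp add: mvec_fields_def)
qed

section \<open>Smoothness of contractions\<close>

lemma fst_contraction [simp]: "fst (contraction N r X i e) = fst e"
  by (cases e) (simp add: contraction_def)

lemma snd_contraction: "b \<in> forms N (r - i) (fst e) \<Longrightarrow>
    snd (contraction N r X i e) b = snd (X (fst e)) (wedge i (r - i) (snd e) b)"
  by (cases e) (simp add: contraction_def)

lemma wedge_add: "wedge p q \<omega> (\<lambda>vs. a * \<eta> vs + b * \<eta>' vs) vs = a * wedge p q \<omega> \<eta> vs + b * wedge p q \<omega> \<eta>' vs"
  by (simp add: wedge_def sum.distrib sum_distrib_left add_divide_distrib algebra_simps)

lemma contraction_mem: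
  assumes X: "X \<in> mvec_fields N r" and e: "e \<in> pts (form_bundle N i)" and i: "i \<le> r"
  shows "contraction N r X i e \<in> pts (mvec_bundle N (r - i))"
proof -
  obtain p a where pa: "e = (p, a)" "p \<in> pts N" "a \<in> forms N i p"
    using e by (auto simp: pts_form_bundle)
  have w: "wedge i (r - i) a b \<in> forms N r p" if "b \<in> forms N (r - i) p" for b
    using wedge_forms[OF pa(3) that] i by simp
  have "snd (X p) (wedge i (r - i) a (\<lambda>vs. c * \<omega> vs + d * \<eta> vs))
      = c * snd (X p) (wedge i (r - i) a \<omega>) + d * snd (X p) (wedge i (r - i) a \<eta>)"
    if "\<omega> \<in> forms N (r - i) p" "\<eta> \<in> forms N (r - i) p" for \<omega> \<eta> c d
    unfolding wedge_add using mvecs_linear[OF mvec_field_mem(2)[OF X pa(2)] w[OF that(1)] w[OF that(2)]] .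
  then show ?thesis
    using pa by (auto simp: contraction_def pts_mvec_bundle mvecs_def forms_lincomb)
qed

lemma basis_form_indices:
  assumes "i \<in> idx N" "p \<in> cdom N i" "I \<in> index_sets (lbl N) r" "length ls = r" "set ls \<subseteq> lbl N"
  shows "basis_form N i p I (map (coord_vec N i p) ls) = minor (\<lambda>k l. if k = l then 1 else 0) (enum I) ls"
proof -
  note I = enum_index_sets[OF assms(3)]
  have "basis_form N i p I (map (coord_vec N i p) ls) = minor (\<lambda>k l. coord_covec N i p k [coord_vec N i p l]) (enum I) ls"
    using I assms by (simp add: wedge_list_eq_minor minor_map)
  also have "\<dots> = minor (\<lambda>k l. if k = l then 1 else 0) (enum I) ls"
    by (rule minor_cong) (use I assms coord_vec[OF assms(1,2)] in \<open>auto simp: coord_covec_apply axis_def subset_iff\<close>)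
  finally show ?thesis .
qed

text \<open>In a chart, the component \<open>J\<close> of the contraction is a combination of the
  components of \<open>X\<close> whose coefficients are linear in the fibre coordinates of the form
  and do not involve the base point.\<close>

lemma smooth_map_contraction:
  assumes X: "X \<in> mvec_fields N r" and i: "i \<le> r"
  shows "smooth_map (form_bundle N i) (mvec_bundle N (r - i)) (contraction N r X i)"
  unfolding smooth_map_def
proof (intro conjI ballI)
  let ?F = "form_bundle N i" and ?V = "mvec_bundle N (r - i)" and ?C = "contraction N r X i"
  let ?L = "index_sets (lbl N) i"
  interpret F: charted ?F by (rule charted_form_bundle)
  show "?C ` pts ?F \<subseteq> pts ?V" using contraction_mem[OF X _ i] by auto
  fix e assume e: "e \<in> pts ?F"
  have p: "fst e \<in> pts N" using e by (auto simp: pts_form_bundle)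
  obtain j W where j: "j \<in> idx N" "fst e \<in> cdom N j" and W: "crd N j (fst e) \<in> W" "W \<subseteq> crd N j ` cdom N j" "rel_open (model N) W"
    and s: "\<forall>I\<in>index_sets (lbl N) r. smooth_on (model N) W (\<lambda>y. snd (X (par N j y)) (basis_form N j (par N j y) I))"
    using mvec_field_smooth[OF X p] by (elim exE conjE)
  let ?W = "over (lbl N) ?L W :: (real ^ ('k + 'k set)) set"
  have ro: "rel_open (model ?F) ?W" using rel_open_over[OF W(3)] by simp
  have sub: "?W \<subseteq> crd ?F j ` cdom ?F j"
    using W(2) unfolding crd_form_bundle_image[OF j(1)] by (auto simp: over_def)
  have par: "par ?F j y \<in> cdom ?F j" "crd ?F j (par ?F j y) = y" if "y \<in> ?W" for y
    using that sub j F.par_mem[of j y] F.crd_par[of j y] by auto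
  have q: "fst (par ?F j y) \<in> cdom N j" "snd (par ?F j y) \<in> forms N i (fst (par ?F j y))"
      "crd N j (fst (par ?F j y)) = base_part y" "par N j (base_part y) = fst (par ?F j y)"
      "\<And>I. I \<in> ?L \<Longrightarrow> snd (par ?F j y) (basis_vecs N j (fst (par ?F j y)) I) = y $ Inr I" if "y \<in> ?W" for y
  proof -
    show 1: "fst (par ?F j y) \<in> cdom N j" "snd (par ?F j y) \<in> forms N i (fst (par ?F j y))"
      using par(1)[OF that] by (auto simp: cdom_form_bundle)
    show 2: "crd N j (fst (par ?F j y)) = base_part y"
      using par(2)[OF that] crd_form_bundle(1)[of i j "par ?F j y"] by (simp add: vec_eq_iff)
    show "par N j (base_part y) = fst (par ?F j y)" using 1 by (simp add: 2[symmetric] j)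
    show "snd (par ?F j y) (basis_vecs N j (fst (par ?F j y)) I) = y $ Inr I" if "I \<in> ?L" for I
      using par(2)[OF \<open>y \<in> ?W\<close>] crd_form_bundle(2)[of i j "par ?F j y" I] that by simp
  qed
  let ?\<delta> = "minor (\<lambda>k l. if k = l then 1 else 0 :: real) :: 'k list \<Rightarrow> 'k list \<Rightarrow> real"
  \<comment> \<open>The wedge of the form with a basis form, evaluated on lists of labels instead of
    lists of coordinate vectors; this removes the base point from the coefficients.\<close>
  let ?c = "\<lambda>J K y. wedge i (r - i) (\<lambda>ls. \<Sum>I\<in>?L. y $ Inr I * ?\<delta> (enum I) ls) (?\<delta> (enum J)) (enum K)"
  have coord: "crd ?V j (?C (par ?F j y)) $ Inr J = (\<Sum>K\<in>index_sets (lbl N) r.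
      ?c J K y * snd (X (par N j (base_part y))) (basis_form N j (par N j (base_part y)) K))"
    if y: "y \<in> ?W" and J: "J \<in> index_sets (lbl N) (r - i)" for y J
  proof -
    let ?p = "fst (par ?F j y)" and ?a = "snd (par ?F j y)"
    note q = q[OF y]
    have bJ: "basis_form N j ?p J \<in> forms N (r - i) ?p" by (rule basis_form(1)[OF j(1) q(1) J])
    have w: "wedge i (r - i) ?a (basis_form N j ?p J) \<in> forms N r ?p"
      using wedge_forms[OF q(2) bJ] i by simp
    have c: "wedge i (r - i) ?a (basis_form N j ?p J) (basis_vecs N j ?p K) = ?c J K y"
      if K: "K \<in> index_sets (lbl N) r" for K
    proof -
      note K = enum_index_sets[OF K]
      have "wedge i (r - i) ?a (basis_form N j ?p J) (basis_vecs N j ?p K)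
        = wedge i (r - i) (\<lambda>ls. ?a (map (coord_vec N j ?p) ls)) (\<lambda>ls. basis_form N j ?p J (map (coord_vec N j ?p) ls)) (enum K)"
        using K i by (intro wedge_map) simp
      also have "\<dots> = ?c J K y"
      proof (rule wedge_cong)
        fix ls assume ls: "length ls = i" "set ls \<subseteq> set (enum K)"
        have "?a (map (coord_vec N j ?p) ls) = (\<Sum>I\<in>?L. ?a (basis_vecs N j ?p I) * basis_form N j ?p I (map (coord_vec N j ?p) ls))"
          using fun_cong[OF form_expansion[OF j(1) q(1,2)]] .
        also have "\<dots> = (\<Sum>I\<in>?L. y $ Inr I * ?\<delta> (enum I) ls)"
          using ls K by (intro sum.cong refl) (simp add: q(5) basis_form_indices[OF j(1) q(1)])
        finally show "?a (map (coord_vec N j ?p) ls) = (\<Sum>I\<in>?L. y $ Inr I * ?\<delta> (enum I) ls)" .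
      next
        fix ls assume ls: "length ls = r - i" "set ls \<subseteq> set (enum K)"
        then show "basis_form N j ?p J (map (coord_vec N j ?p) ls) = ?\<delta> (enum J) ls"
          using K by (intro basis_form_indices[OF j(1) q(1) J]) auto
      qed
      finally show ?thesis .
    qed
    have "crd ?V j (?C (par ?F j y)) $ Inr J = snd (X ?p) (wedge i (r - i) ?a (basis_form N j ?p J))"
      using J bJ by (simp add: crd_mvec_bundle snd_contraction)
    also have "\<dots> = (\<Sum>K\<in>index_sets (lbl N) r. ?c J K y * snd (X ?p) (basis_form N j ?p K))"
      using mvec_pairing[OF j(1) q(1) mvec_field_mem(2)[OF X] w] cdom_pts[OF j(1) q(1)] c by simp
    finally show ?thesis unfolding q(4) .
  qed
  have "smooth_on (model ?F) ?W (\<lambda>y. crd ?V j (?C (par ?F j y)))"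
  proof (rule smooth_on_componentwise[OF ro])
    fix t :: "'k + 'k set"
    show "smooth_on (model ?F) ?W (\<lambda>y. crd ?V j (?C (par ?F j y)) $ t)"
    proof (cases t)
      case (Inl k)
      have "smooth_on (model ?F) ?W (\<lambda>y. y $ Inl k)" by (rule smooth_on_nth[OF ro])
      then show ?thesis
        by (rule smooth_on_cong[THEN iffD1, rotated]) (simp add: Inl crd_mvec_bundle q(3))
    next
      case (Inr J)
      show ?thesis
      proof (cases "J \<in> index_sets (lbl N) (r - i)")
        case True
        have "smooth_on (model ?F) ?W (\<lambda>y. snd (X (par N j (base_part y))) (basis_form N j (par N j (base_part y)) K))"
          if "K \<in> index_sets (lbl N) r" for K
          using smooth_on_over[OF W(3) s[rule_format, OF that]] by simp
        moreover have "smooth_on (model ?F) ?W (?c J K)" if "K \<in> index_sets (lbl N) r" for K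
        proof -
          \<comment> \<open>Once the length condition inside \<open>wedge\<close> is settled, the
            coefficient is an explicit polynomial in \<open>y\<close>.\<close>
          have "length (enum K) = i + (r - i)" using enum_index_sets[OF that] i by simp
          then have "?c J K = (\<lambda>y. (\<Sum>\<pi> | \<pi> permutes {..<i + (r - i)}. of_int (sign \<pi>) *
              (\<Sum>I\<in>?L. y $ Inr I * ?\<delta> (enum I) (map (\<lambda>j. enum K ! \<pi> j) [0..<i])) *
              ?\<delta> (enum J) (map (\<lambda>j. enum K ! \<pi> j) [i..<i + (r - i)])) * inverse (fact i * fact (r - i)))"
            by (simp only: wedge_def simp_thms if_True divide_inverse)
          show ?thesis
            unfolding \<open>?c J K = _\<close> by (intro smooth_on_mult smooth_on_sum smooth_on_nth smooth_on_const ro)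
        qed
        ultimately have "smooth_on (model ?F) ?W (\<lambda>y. \<Sum>K\<in>index_sets (lbl N) r.
            ?c J K y * snd (X (par N j (base_part y))) (basis_form N j (par N j (base_part y)) K))"
          by (intro smooth_on_sum smooth_on_mult ro)
        then show ?thesis
          by (rule smooth_on_cong[THEN iffD1, rotated]) (simp only: Inr coord True)
      next
        case False
        have "smooth_on (model ?F) ?W (\<lambda>y. 0 :: real)" by (rule smooth_on_const[OF ro])
        then show ?thesis
          by (rule smooth_on_cong[THEN iffD1, rotated]) (simp add: Inr False crd_mvec_bundle)
      qed
    qed
  qed
  moreover have mem: "?C e' \<in> cdom ?V j" if "e' \<in> cdom ?F j" for e'
    using contraction_mem[OF X F.cdom_pts i, of j e'] that j
    by (cases "?C e'") (auto simp: cdom_mvec_bundle cdom_form_bundle pts_mvec_bundle contraction_def)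
  moreover have "e \<in> cdom ?F j" using e j by (auto simp: cdom_form_bundle pts_form_bundle)
  moreover from this have "crd ?F j e \<in> ?W"
  proof -
    have "crd ?F j e \<in> model ?F" by (rule F.crd_model) (use j \<open>e \<in> cdom ?F j\<close> in auto)
    moreover have "base_part (crd ?F j e) = crd N j (fst e)" by (simp add: vec_eq_iff crd_form_bundle)
    ultimately show ?thesis using W by (simp add: over_def)
  qed
  ultimately show "\<exists>i'\<in>idx ?F. \<exists>j\<in>idx ?V. \<exists>W. e \<in> cdom ?F i' \<and> ?C e \<in> cdom ?V j \<and> crd ?F i' e \<in> W \<and>
      W \<subseteq> crd ?F i' ` cdom ?F i' \<and> openin (top_of_set (model ?F)) W \<and>
      (\<forall>y\<in>W. ?C (par ?F i' y) \<in> cdom ?V j) \<and> smooth_on (model ?F) W (\<lambda>y. crd ?V j (?C (par ?F i' y)))"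
    using j ro sub par by (intro bexI[of _ j] exI[of _ ?W] conjI) (auto simp: rel_open_def)
qed

end

section \<open>Maps defined by representatives of tangent vectors\<close>

text \<open>Existence of the common derivative is part of the relation, so that sums and products
  preserve it. Coordinates of two representatives of one tangent vector are related in this
  way.\<close>

definition same_jet :: "(real \<Rightarrow> real) \<Rightarrow> (real \<Rightarrow> real) \<Rightarrow> bool" where
  "same_jet f g \<longleftrightarrow> f 0 = g 0 \<and>
     (\<exists>D. (f has_real_derivative D) (at 0) \<and> (g has_real_derivative D) (at 0))"

lemma same_jet_const: "same_jet (\<lambda>t. c) (\<lambda>t. c)"
  unfolding same_jet_def by (intro conjI exI[of _ 0]) auto

lemma same_jet_add:
  assumes "same_jet f g" "same_jet f' g'"
  shows "same_jet (\<lambda>t. f t + f' t) (\<lambda>t. g t + g' t)"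
proof -
  obtain D D' where "(f has_real_derivative D) (at 0)" "(g has_real_derivative D) (at 0)"
    "(f' has_real_derivative D') (at 0)" "(g' has_real_derivative D') (at 0)"
    using assms by (auto simp: same_jet_def)
  then have "((\<lambda>t. f t + f' t) has_real_derivative D + D') (at 0)"
    "((\<lambda>t. g t + g' t) has_real_derivative D + D') (at 0)"
    by (auto intro: DERIV_add)
  then show ?thesis using assms by (auto simp: same_jet_def)
qed

lemma same_jet_mult:
  assumes "same_jet f g" "same_jet f' g'"
  shows "same_jet (\<lambda>t. f t * f' t) (\<lambda>t. g t * g' t)"
proof -
  obtain D D' where D: "(f has_real_derivative D) (at 0)" "(g has_real_derivative D) (at 0)"
    "(f' has_real_derivative D') (at 0)" "(g' has_real_derivative D') (at 0)"
    using assms by (auto simp: same_jet_def)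
  have "((\<lambda>t. f t * f' t) has_real_derivative D * f' 0 + D' * f 0) (at 0)"
    using DERIV_mult[OF D(1,3)] .
  moreover have "((\<lambda>t. g t * g' t) has_real_derivative D * f' 0 + D' * f 0) (at 0)"
    using DERIV_mult[OF D(2,4)] assms by (simp add: same_jet_def)
  ultimately show ?thesis using assms by (auto simp: same_jet_def)
qed

lemma same_jet_sum:
  "(\<And>i. i \<in> I \<Longrightarrow> same_jet (f i) (g i)) \<Longrightarrow> same_jet (\<lambda>t. \<Sum>i\<in>I. f i t) (\<lambda>t. \<Sum>i\<in>I. g i t)"
  by (induction I rule: infinite_finite_induct) (auto intro: same_jet_const same_jet_add)

lemma same_jet_prod:
  "(\<And>i. i \<in> I \<Longrightarrow> same_jet (f i) (g i)) \<Longrightarrow> same_jet (\<lambda>t. \<Prod>i\<in>I. f i t) (\<lambda>t. \<Prod>i\<in>I. g i t)"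
  by (induction I rule: infinite_finite_induct) (auto intro: same_jet_const same_jet_mult)

lemma same_jet_minor:
  assumes "length ks = length ls"
    and "\<And>j l. j < length ks \<Longrightarrow> l \<in> set ls \<Longrightarrow> same_jet (\<lambda>t. c t (ks ! j) l) (\<lambda>t. d t (ks' ! j) l)"
    and "length ks' = length ks"
  shows "same_jet (\<lambda>t. minor (c t) ks ls) (\<lambda>t. minor (d t) ks' ls)"
  unfolding minor_def assms(3)
  by (intro same_jet_sum same_jet_mult same_jet_const same_jet_prod assms(2))
    (use assms(1) permutes_lessThan_mem in auto)

lemma same_jet_cong:
  assumes "same_jet f g" "\<forall>\<^sub>F t in nhds 0. f' t = f t" "\<forall>\<^sub>F t in nhds 0. g' t = g t"
  shows "same_jet f' g'"
proof -
  obtain D where D: "(f has_real_derivative D) (at 0)" "(g has_real_derivative D) (at 0)"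
    using assms by (auto simp: same_jet_def)
  have "(f' has_real_derivative D) (at 0)" "(g' has_real_derivative D) (at 0)"
    using D DERIV_cong_ev[OF refl assms(2) refl, of D] DERIV_cong_ev[OF refl assms(3) refl, of D] by auto
  moreover have "f' 0 = f 0" "g' 0 = g 0"
    using assms(2,3) by (auto dest: eventually_nhds_x_imp_x)
  ultimately show ?thesis using assms(1) by (auto simp: same_jet_def)
qed

lemma same_jet_derivative:
  "same_jet f g \<Longrightarrow> vector_derivative f (at 0) = vector_derivative g (at 0)"
  by (auto simp: same_jet_def has_real_derivative_iff_has_vector_derivative dest!: vector_derivative_at)

context charted
begin

section \<open>Jets of curves in coordinates\<close>

lemma curve_component_derivative:
  assumes "curve N \<gamma>" "i \<in> idx N" "\<gamma> 0 \<in> cdom N i"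
  shows "((\<lambda>t. crd N i (\<gamma> t) $ s) has_real_derivative chart_vel N i \<gamma> $ s) (at 0)"
  using bounded_linear.has_vector_derivative[OF bounded_linear_vec_nth curve_has_derivative[OF assms], of s]
  by (simp add: has_real_derivative_iff_has_vector_derivative)

lemma tangent_same_jet:
  assumes "\<gamma>' \<in> tangent N \<gamma>" "curve N \<gamma>" "i \<in> idx N" "\<gamma> 0 \<in> cdom N i"
  shows "same_jet (\<lambda>t. crd N i (\<gamma>' t) $ s) (\<lambda>t. crd N i (\<gamma> t) $ s)"
  using curve_component_derivative[OF assms(2-4), of s]
    curve_component_derivative[of \<gamma>' i s] tangent_memD[OF assms(1)] assms
  by (auto simp: same_jet_def intro!: exI[of _ "chart_vel N i \<gamma> $ s"])

lemma tangent_eqI_jet: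
  assumes "curve N \<gamma>" "curve N \<delta>" "\<gamma> 0 = \<delta> 0" "i \<in> idx N" "\<gamma> 0 \<in> cdom N i"
    and "\<And>s. same_jet (\<lambda>t. crd N i (\<gamma> t) $ s) (\<lambda>t. crd N i (\<delta> t) $ s)"
  shows "tangent N \<gamma> = tangent N \<delta>"
proof (rule tangent_eqI[OF assms(1-5)])
  have "chart_vel N i \<gamma> $ s = chart_vel N i \<delta> $ s" for s
    using assms(6)[of s] curve_component_derivative[OF assms(1,4,5), of s]
      curve_component_derivative[OF assms(2,4), of s] assms(3,5) DERIV_unique
    unfolding same_jet_def by metis
  then show "chart_vel N i \<gamma> = chart_vel N i \<delta>" by (simp add: vec_eq_iff)
qed

text \<open>Only the germ at 0 matters to a tangent vector, so a curve may be altered away from 0.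
  This is what permits freezing a line where it would leave its chart.\<close>

lemma curve_cong:
  assumes "curve N \<gamma>" "\<forall>\<^sub>F t in nhds 0. \<gamma>' t = \<gamma> t"
  shows "curve N \<gamma>'" "tangent N \<gamma>' = tangent N \<gamma>"
proof -
  obtain i where i: "i \<in> idx N" "\<gamma> 0 \<in> cdom N i" using pts_chart[OF curve_pts[OF assms(1)]] by blast
  obtain e where e: "e > 0" "\<gamma> ` {-e<..<e} \<subseteq> cdom N i" "smooth_on UNIV {-e<..<e} (crd N i \<circ> \<gamma>)"
    using curve_chart[OF assms(1) i] by blast
  obtain d where d: "d > 0" "\<And>t. \<bar>t\<bar> < d \<Longrightarrow> \<gamma>' t = \<gamma> t"
    using assms(2) unfolding eventually_nhds0_interval by blast
  have sm: "smooth_on UNIV {-min d e<..<min d e} (crd N i \<circ> \<gamma>)"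
    by (rule smooth_on_subset[OF _ _ _ e(3)]) (auto intro: rel_open_UNIV)
  have *: "\<gamma>' t \<in> cdom N i \<and> crd N i (\<gamma>' t) = (crd N i \<circ> \<gamma>) t" if "\<bar>t\<bar> < min d e" for t
    using that d e(2) by (auto simp: image_interval_subset)
  have "min d e > 0" using d e by simp
  note c = curveI[OF i(1) this * sm]
  show "curve N \<gamma>'" by (rule c(1))
  have "\<gamma>' 0 = \<gamma> 0" using d by simp
  then show "tangent N \<gamma>' = tangent N \<gamma>"
    using c(2) i by (intro tangent_eqI[OF c(1) assms(1), of i]) auto
qed

lemma curves_common_interval:
  assumes "\<And>\<gamma>. \<gamma> \<in> set \<gamma>s \<Longrightarrow> curve N \<gamma> \<and> \<gamma> 0 \<in> cdom N i" "i \<in> idx N"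
  shows "\<exists>e>0. \<forall>\<gamma>\<in>set \<gamma>s. (\<forall>t. \<bar>t\<bar> < e \<longrightarrow> \<gamma> t \<in> cdom N i) \<and> smooth_on UNIV {-e<..<e} (\<lambda>t. crd N i (\<gamma> t))"
  using assms(1)
proof (induction \<gamma>s)
  case Nil
  then show ?case by (auto intro: exI[of _ 1])
next
  case (Cons \<gamma> \<gamma>s)
  then obtain e where e: "e > 0" "\<forall>\<gamma>\<in>set \<gamma>s. (\<forall>t. \<bar>t\<bar> < e \<longrightarrow> \<gamma> t \<in> cdom N i) \<and> smooth_on UNIV {-e<..<e} (\<lambda>t. crd N i (\<gamma> t))"
    by (metis list.set_intros(2))
  obtain d where d: "d > 0" "\<gamma> ` {-d<..<d} \<subseteq> cdom N i" "smooth_on UNIV {-d<..<d} (\<lambda>t. crd N i (\<gamma> t))"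
    using curve_chart[of \<gamma> i] Cons.prems[of \<gamma>] assms(2) by (auto simp: comp_def)
  have "smooth_on UNIV {-min d e<..<min d e} f" if "smooth_on UNIV {-d<..<d} f \<or> smooth_on UNIV {-e<..<e} f" for f :: "real \<Rightarrow> real ^ 'k"
  proof -
    have "{-min d e<..<min d e} \<subseteq> {-d<..<d}" "{-min d e<..<min d e} \<subseteq> {-e<..<e}" by auto
    then show ?thesis
      using that smooth_on_subset[of UNIV "{-d<..<d}" "{-min d e<..<min d e}" f]
        smooth_on_subset[of UNIV "{-e<..<e}" "{-min d e<..<min d e}" f] by (auto simp: rel_open_UNIV)
  qed
  then show ?case using e d
    by (intro exI[of _ "min d e"]) (auto simp: image_interval_subset)
qed

lemma curve_form_bundleI:
  assumes "i \<in> idx N" "e > 0"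
    and "\<And>t. \<bar>t\<bar> < e \<Longrightarrow> fst (\<gamma> t) \<in> cdom N i \<and> snd (\<gamma> t) \<in> forms N r (fst (\<gamma> t))"
    and "\<And>k. smooth_on UNIV {-e<..<e} (\<lambda>t. crd N i (fst (\<gamma> t)) $ k)"
    and "\<And>I. I \<in> index_sets (lbl N) r \<Longrightarrow> smooth_on UNIV {-e<..<e} (\<lambda>t. snd (\<gamma> t) (basis_vecs N i (fst (\<gamma> t)) I))"
  shows "curve (form_bundle N r) \<gamma>"
proof -
  interpret F: charted "form_bundle N r" by (rule charted_form_bundle)
  have ro: "rel_open UNIV {-e<..<e}" by (simp add: rel_open_UNIV)
  have "smooth_on UNIV {-e<..<e} (\<lambda>t. crd (form_bundle N r) i (\<gamma> t))"
  proof (rule smooth_on_componentwise[OF ro])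
    show "smooth_on UNIV {-e<..<e} (\<lambda>t. crd (form_bundle N r) i (\<gamma> t) $ s)" for s
    proof (cases s)
      case (Inr I)
      then show ?thesis using assms(5)[of I] smooth_on_const[OF ro, of "0::real"]
        by (cases "I \<in> index_sets (lbl N) r") (simp_all add: crd_form_bundle)
    qed (simp add: crd_form_bundle assms(4))
  qed
  moreover have "\<gamma> t \<in> cdom (form_bundle N r) i" if "\<bar>t\<bar> < e" for t
    using assms(3)[OF that] by (cases "\<gamma> t") (simp add: cdom_form_bundle)
  ultimately show ?thesis using assms(1,2) by (intro F.curveI(1)[of i e]) auto
qed

lemma one_form_expansion:
  assumes "i \<in> idx N" "p \<in> cdom N i" "\<omega> \<in> forms N 1 p" "u \<in> tangent_space N p"
  shows "\<omega> [u] = (\<Sum>k\<in>lbl N. vel N i u $ k * \<omega> [coord_vec N i p k])"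
proof -
  interpret linear_frame "tangent_space N p" "lincomb N" "lbl N" "\<lambda>u k. vel N i u $ k"
    "coord_vec N i p" "coord_covec N i p" by (rule frame[OF assms(1,2)])
  have "\<omega> [lincomb N a u b v] = a * \<omega> [u] + b * \<omega> [v]" if "u \<in> tangent_space N p" "v \<in> tangent_space N p" for a u b v
    using alt_forms_multilinear[OF assms(3)[unfolded forms_alt_forms], of "[u]" 0 u v a b] that by simp
  from linear_expansion[where f = "\<lambda>u. \<omega> [u]", OF this assms(4)] show ?thesis .
qed

lemma enum_singleton [simp]: "enum {k} = [k]"
  using enum(2,3)[of "{k}"] by (auto simp: length_Suc_conv)

lemma crd_one_form:
  "k \<in> lbl N \<Longrightarrow> crd (form_bundle N 1) i e $ Inr {k} = snd e [coord_vec N i (fst e) k]"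
  by (simp add: crd_form_bundle index_sets_def)

text \<open>The given curves show that the choice in the definition is not vacuous. The chosen
  curves have the same 1-jets in bundle coordinates, where the pairing is a sum of products, so the
  derivative is the same.\<close>

lemma tangent_pairing_eq:
  assumes \<gamma>: "curve (mvec_bundle N r) \<gamma>" and \<delta>: "curve (form_bundle N r) \<delta>"
    and eq: "\<And>t. fst (\<gamma> t) = fst (\<delta> t)"
  shows "tangent_pairing (tangent (mvec_bundle N r) \<gamma>) (tangent (form_bundle N r) \<delta>)
    = vector_derivative (\<lambda>t. snd (\<gamma> t) (snd (\<delta> t))) (at 0)"
proof -
  interpret V: charted "mvec_bundle N r" by (rule charted_mvec_bundle)
  interpret F: charted "form_bundle N r" by (rule charted_form_bundle)
  let ?V = "mvec_bundle N r" and ?F = "form_bundle N r"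
  let ?P = "\<lambda>(\<gamma>', \<delta>'). \<gamma>' \<in> tangent ?V \<gamma> \<and> \<delta>' \<in> tangent ?F \<delta> \<and> (\<forall>t. fst (\<gamma>' t) = fst (\<delta>' t))"
  have "?P (\<gamma>, \<delta>)" using V.tangent_self[OF \<gamma>] F.tangent_self[OF \<delta>] eq by simp
  then have "?P (SOME x. ?P x)" by (rule someI)
  then obtain \<gamma>' \<delta>' where some: "(SOME x. ?P x) = (\<gamma>', \<delta>')"
    and *: "\<gamma>' \<in> tangent ?V \<gamma>" "\<delta>' \<in> tangent ?F \<delta>" "\<And>t. fst (\<gamma>' t) = fst (\<delta>' t)"
    by (cases "SOME x. ?P x") auto
  obtain i where i: "i \<in> idx N" "\<delta> 0 \<in> cdom ?F i"
    using F.pts_chart[OF F.curve_pts[OF \<delta>]] by auto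
  have i0: "\<gamma> 0 \<in> cdom ?V i"
    using i eq[of 0] V.curve_pts[OF \<gamma>] by (cases "\<gamma> 0") (auto simp: cdom_form_bundle cdom_mvec_bundle pts_mvec_bundle)
  have ev: "\<forall>\<^sub>F t in nhds 0. snd (g t) (snd (d t)) =
      (\<Sum>I\<in>index_sets (lbl N) r. crd ?F i (d t) $ Inr I * crd ?V i (g t) $ Inr I)"
    if g: "curve ?V g" "g 0 = \<gamma> 0" and d: "curve ?F d" "d 0 = \<delta> 0" and gd: "\<And>t. fst (g t) = fst (d t)" for g d
  proof -
    have "\<forall>\<^sub>F t in nhds 0. g t \<in> cdom ?V i \<and> d t \<in> cdom ?F i"
      using V.curve_eventually_chart[OF g(1), of i] F.curve_eventually_chart[OF d(1), of i] g d i i0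
      by (simp add: eventually_conj)
    then show ?thesis
    proof eventually_elim
      case (elim t)
      then have "fst (d t) \<in> cdom N i" "snd (g t) \<in> mvecs N r (fst (d t))" "snd (d t) \<in> forms N r (fst (d t))"
        using gd[of t] by (cases "g t"; cases "d t"; simp add: cdom_mvec_bundle cdom_form_bundle)+
      from mvec_pairing[OF i(1) this] show ?case
        using gd[of t] by (simp add: crd_form_bundle crd_mvec_bundle)
    qed
  qed
  have "same_jet (\<lambda>t. snd (\<gamma>' t) (snd (\<delta>' t))) (\<lambda>t. snd (\<gamma> t) (snd (\<delta> t)))"
  proof (rule same_jet_cong[OF _ ev ev])
    show "same_jet (\<lambda>t. \<Sum>I\<in>index_sets (lbl N) r. crd ?F i (\<delta>' t) $ Inr I * crd ?V i (\<gamma>' t) $ Inr I)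
       (\<lambda>t. \<Sum>I\<in>index_sets (lbl N) r. crd ?F i (\<delta> t) $ Inr I * crd ?V i (\<gamma> t) $ Inr I)"
      by (intro same_jet_sum same_jet_mult V.tangent_same_jet[OF *(1) \<gamma>] F.tangent_same_jet[OF *(2) \<delta>])
        (use i i0 in auto)
  qed (use * V.tangent_memD[OF *(1)] F.tangent_memD[OF *(2)] \<gamma> \<delta> eq in auto)
  from same_jet_derivative[OF this] show ?thesis
    by (simp add: tangent_pairing_def some)
qed

text \<open>The argument of \<open>tangent_pairing_eq\<close>, with velocities in place of
  multivector components.\<close>

lemma tangent_pairing1_eq:
  assumes \<gamma>: "curve (tangent_bundle N) \<gamma>" and \<delta>: "curve (form_bundle N 1) \<delta>"
    and eq: "\<And>t. foot (\<gamma> t) = fst (\<delta> t)"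
  shows "tangent_pairing1 (tangent (tangent_bundle N) \<gamma>) (tangent (form_bundle N 1) \<delta>)
    = vector_derivative (\<lambda>t. snd (\<delta> t) [\<gamma> t]) (at 0)"
proof -
  interpret V: charted "tangent_bundle N" by (rule charted_tangent_bundle)
  interpret F: charted "form_bundle N 1" by (rule charted_form_bundle)
  let ?V = "tangent_bundle N" and ?F = "form_bundle N 1"
  let ?P = "\<lambda>(\<gamma>', \<delta>'). \<gamma>' \<in> tangent ?V \<gamma> \<and> \<delta>' \<in> tangent ?F \<delta> \<and> (\<forall>t. foot (\<gamma>' t) = fst (\<delta>' t))"
  have "?P (\<gamma>, \<delta>)" using V.tangent_self[OF \<gamma>] F.tangent_self[OF \<delta>] eq by simp
  then have "?P (SOME x. ?P x)" by (rule someI)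
  then obtain \<gamma>' \<delta>' where some: "(SOME x. ?P x) = (\<gamma>', \<delta>')"
    and *: "\<gamma>' \<in> tangent ?V \<gamma>" "\<delta>' \<in> tangent ?F \<delta>" "\<And>t. foot (\<gamma>' t) = fst (\<delta>' t)"
    by (cases "SOME x. ?P x") auto
  obtain i where i: "i \<in> idx N" "\<delta> 0 \<in> cdom ?F i"
    using F.pts_chart[OF F.curve_pts[OF \<delta>]] by auto
  have i0: "\<gamma> 0 \<in> cdom ?V i"
    using i eq[of 0] V.curve_pts[OF \<gamma>] by (auto simp: cdom_form_bundle cdom_tangent_bundle)
  have ev: "\<forall>\<^sub>F t in nhds 0. snd (d t) [g t] =
      (\<Sum>k\<in>lbl N. crd ?V i (g t) $ Inr k * crd ?F i (d t) $ Inr {k})"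
    if g: "curve ?V g" "g 0 = \<gamma> 0" and d: "curve ?F d" "d 0 = \<delta> 0" and gd: "\<And>t. foot (g t) = fst (d t)" for g d
  proof -
    have "\<forall>\<^sub>F t in nhds 0. g t \<in> cdom ?V i \<and> d t \<in> cdom ?F i"
      using V.curve_eventually_chart[OF g(1), of i] F.curve_eventually_chart[OF d(1), of i] g d i i0
      by (simp add: eventually_conj)
    then show ?thesis
    proof eventually_elim
      case (elim t)
      then have "fst (d t) \<in> cdom N i" "snd (d t) \<in> forms N 1 (fst (d t))" "g t \<in> tangent_space N (fst (d t))"
        using gd[of t] i by (cases "d t"; simp add: cdom_tangent_bundle cdom_form_bundle tangent_space_def)+
      from one_form_expansion[OF i(1) this] show ?case
        by (simp add: crd_one_form[unfolded One_nat_def] crd_tangent_bundle)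
    qed
  qed
  have "same_jet (\<lambda>t. snd (\<delta>' t) [\<gamma>' t]) (\<lambda>t. snd (\<delta> t) [\<gamma> t])"
  proof (rule same_jet_cong[OF _ ev ev])
    show "same_jet (\<lambda>t. \<Sum>k\<in>lbl N. crd ?V i (\<gamma>' t) $ Inr k * crd ?F i (\<delta>' t) $ Inr {k})
       (\<lambda>t. \<Sum>k\<in>lbl N. crd ?V i (\<gamma> t) $ Inr k * crd ?F i (\<delta> t) $ Inr {k})"
      by (intro same_jet_sum same_jet_mult V.tangent_same_jet[OF *(1) \<gamma>] F.tangent_same_jet[OF *(2) \<delta>])
        (use i i0 in auto)
  qed (use * V.tangent_memD[OF *(1)] F.tangent_memD[OF *(2)] \<gamma> \<delta> eq in auto)
  from same_jet_derivative[OF this] show ?thesis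
    unfolding tangent_pairing1_def some by simp
qed

text \<open>The fibre components of the combination are linear in those of the two curves, so
  passing to the chosen representatives keeps the 1-jet. That the combination is a curve in the
  bundle is needed for both the given and the chosen pair.\<close>

lemma tangent_lincomb_eq:
  assumes \<gamma>: "curve (form_bundle N r) \<gamma>" and \<delta>: "curve (form_bundle N r) \<delta>"
    and eq: "\<And>t. fst (\<gamma> t) = fst (\<delta> t)"
  shows "tangent_lincomb N r a (tangent (form_bundle N r) \<gamma>) b (tangent (form_bundle N r) \<delta>)
    = tangent (form_bundle N r) (\<lambda>t. (fst (\<gamma> t), \<lambda>vs. a * snd (\<gamma> t) vs + b * snd (\<delta> t) vs))"
proof -
  interpret F: charted "form_bundle N r" by (rule charted_form_bundle)
  let ?F = "form_bundle N r"
  let ?P = "\<lambda>(\<gamma>', \<delta>'). \<gamma>' \<in> tangent ?F \<gamma> \<and> \<delta>' \<in> tangent ?F \<delta> \<and> (\<forall>t. fst (\<gamma>' t) = fst (\<delta>' t))"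
  let ?c = "\<lambda>\<gamma> \<delta> t. (fst (\<gamma> t), \<lambda>vs. a * snd (\<gamma> t) vs + b * snd (\<delta> t) vs)"
  have "?P (\<gamma>, \<delta>)" using F.tangent_self[OF \<gamma>] F.tangent_self[OF \<delta>] eq by simp
  then have "?P (SOME x. ?P x)" by (rule someI)
  then obtain \<gamma>' \<delta>' where some: "(SOME x. ?P x) = (\<gamma>', \<delta>')"
    and *: "\<gamma>' \<in> tangent ?F \<gamma>" "\<delta>' \<in> tangent ?F \<delta>" "\<And>t. fst (\<gamma>' t) = fst (\<delta>' t)"
    by (cases "SOME x. ?P x") auto
  obtain i where i: "i \<in> idx N" "\<delta> 0 \<in> cdom ?F i"
    using F.pts_chart[OF F.curve_pts[OF \<delta>]] by auto
  have i0: "\<gamma> 0 \<in> cdom ?F i"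
    using i eq[of 0] F.curve_pts[OF \<gamma>] by (cases "\<gamma> 0") (auto simp: cdom_form_bundle pts_form_bundle)
  have curve: "curve ?F (?c g d)"
    if g: "curve ?F g" "g 0 = \<gamma> 0" and d: "curve ?F d" "d 0 = \<delta> 0" and gd: "\<And>t. fst (g t) = fst (d t)" for g d
  proof -
    obtain e where e: "e > 0" "\<And>t. \<bar>t\<bar> < e \<Longrightarrow> g t \<in> cdom ?F i \<and> d t \<in> cdom ?F i"
      "smooth_on UNIV {-e<..<e} (\<lambda>t. crd ?F i (g t))" "smooth_on UNIV {-e<..<e} (\<lambda>t. crd ?F i (d t))"
    proof -
      have "curve ?F h \<and> h 0 \<in> cdom ?F i" if "h \<in> set [g, d]" for h
        using that g d i i0 by auto
      from F.curves_common_interval[of "[g, d]", OF this] i(1) show thesis using that by auto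
    qed
    have ro: "rel_open UNIV {-e<..<e}" by (simp add: rel_open_UNIV)
    note sg = smooth_on_vec_nth[OF ro e(3)] and sd = smooth_on_vec_nth[OF ro e(4)]
    show ?thesis
    proof (rule curve_form_bundleI[OF i(1) e(1)])
      show "fst (?c g d t) \<in> cdom N i \<and> snd (?c g d t) \<in> forms N r (fst (?c g d t))" if "\<bar>t\<bar> < e" for t
        using e(2)[OF that] gd[of t] by (cases "g t"; cases "d t") (auto simp: cdom_form_bundle forms_lincomb)
      show "smooth_on UNIV {-e<..<e} (\<lambda>t. crd N i (fst (?c g d t)) $ k)" for k
        using sg[of "Inl k"] by (simp add: crd_form_bundle)
      show "smooth_on UNIV {-e<..<e} (\<lambda>t. snd (?c g d t) (basis_vecs N i (fst (?c g d t)) I))"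
        if "I \<in> index_sets (lbl N) r" for I
        using sg[of "Inr I"] sd[of "Inr I"] that
        by (auto simp: crd_form_bundle gd intro!: smooth_on_add smooth_on_mult smooth_on_const ro)
    qed
  qed
  have "tangent ?F (?c \<gamma>' \<delta>') = tangent ?F (?c \<gamma> \<delta>)"
  proof (rule F.tangent_eqI_jet[where i = i])
    show "?c \<gamma>' \<delta>' 0 = ?c \<gamma> \<delta> 0" "curve ?F (?c \<gamma>' \<delta>')" "curve ?F (?c \<gamma> \<delta>)" "i \<in> idx ?F"
      using * F.tangent_memD[OF *(1)] F.tangent_memD[OF *(2)] curve \<gamma> \<delta> eq i by auto
    have "fst (\<gamma> 0) \<in> cdom N i" "snd (\<gamma> 0) \<in> forms N r (fst (\<gamma> 0))" "snd (\<delta> 0) \<in> forms N r (fst (\<gamma> 0))"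
      using i i0 eq[of 0] by (cases "\<gamma> 0"; cases "\<delta> 0"; simp add: cdom_form_bundle)+
    then show "?c \<gamma>' \<delta>' 0 \<in> cdom ?F i"
      using F.tangent_memD[OF *(1)] F.tangent_memD[OF *(2)] by (simp add: cdom_form_bundle forms_lincomb)
    fix s
    note g = F.tangent_same_jet[OF *(1) \<gamma>, of i s] and d = F.tangent_same_jet[OF *(2) \<delta>, of i s]
    show "same_jet (\<lambda>t. crd ?F i (?c \<gamma>' \<delta>' t) $ s) (\<lambda>t. crd ?F i (?c \<gamma> \<delta> t) $ s)"
    proof (cases s)
      case (Inl k)
      then show ?thesis using g i i0 by (simp add: crd_form_bundle)
    next
      case (Inr I)
      show ?thesis
      proof (cases "I \<in> index_sets (lbl N) r")
        case True
        have "same_jet (\<lambda>t. a * crd ?F i (\<gamma>' t) $ s + b * crd ?F i (\<delta>' t) $ s)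
          (\<lambda>t. a * crd ?F i (\<gamma> t) $ s + b * crd ?F i (\<delta> t) $ s)"
          using g d i i0 by (intro same_jet_add same_jet_mult same_jet_const) auto
        then show ?thesis using Inr True by (simp add: crd_form_bundle eq *(3))
      qed (simp add: Inr crd_form_bundle same_jet_const)
    qed
  qed
  then show ?thesis by (simp add: tangent_lincomb_def some)
qed

lemma wedge_list_forms: "set as \<subseteq> forms N 1 p \<Longrightarrow> wedge_list as \<in> forms N (length as) p"
  unfolding forms_alt_forms by (rule wedge_list_alt_forms)

text \<open>The components of a wedge of covectors are minors of the components of the factors,
  hence polynomial. This yields both the smoothness of the wedge curve and its independence, to
  first order, of the representatives chosen.\<close>

lemma tangent_wedge_eq:
  assumes ne: "\<gamma>s \<noteq> []" and \<gamma>s: "\<And>\<gamma>. \<gamma> \<in> set \<gamma>s \<Longrightarrow> curve (form_bundle N 1) \<gamma>"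
    and eq: "\<And>\<gamma> \<delta> t. \<gamma> \<in> set \<gamma>s \<Longrightarrow> \<delta> \<in> set \<gamma>s \<Longrightarrow> fst (\<gamma> t) = fst (\<delta> t)"
  shows "tangent_wedge N (map (tangent (form_bundle N 1)) \<gamma>s)
    = tangent (form_bundle N (length \<gamma>s)) (\<lambda>t. (fst (hd \<gamma>s t), wedge_list (map (\<lambda>\<gamma>. snd (\<gamma> t)) \<gamma>s)))"
proof -
  let ?r = "length \<gamma>s"
  interpret F: charted "form_bundle N 1" by (rule charted_form_bundle)
  interpret R: charted "form_bundle N ?r" by (rule charted_form_bundle)
  let ?F = "form_bundle N 1" and ?R = "form_bundle N ?r"
  let ?P = "\<lambda>\<delta>s. list_all2 (\<in>) \<delta>s (map (tangent ?F) \<gamma>s) \<and> (\<forall>\<gamma>\<in>set \<delta>s. \<forall>\<delta>\<in>set \<delta>s. \<forall>t. fst (\<gamma> t) = fst (\<delta> t))"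
  let ?c = "\<lambda>\<gamma>s t. (fst (hd \<gamma>s t), wedge_list (map (\<lambda>\<gamma>. snd (\<gamma> t)) \<gamma>s))"
  have eqs: "\<forall>\<gamma>\<in>set \<gamma>s. \<forall>\<delta>\<in>set \<gamma>s. \<forall>t. fst (\<gamma> t) = fst (\<delta> t)" using eq by blast
  have "list_all2 (\<in>) \<gamma>s (map (tangent ?F) \<gamma>s)"
    by (simp add: list_all2_conv_all_nth F.tangent_self \<gamma>s del: One_nat_def)
  then have "?P \<gamma>s" using eqs ..
  then have "?P (SOME x. ?P x)" by (rule someI)
  from \<open>?P (SOME x. ?P x)\<close> obtain \<delta>s where some: "(SOME x. ?P x) = \<delta>s" and P: "?P \<delta>s" by blast
  have len: "length \<delta>s = ?r" using P by (auto dest: list_all2_lengthD)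
  have mem: "\<delta>s ! m \<in> tangent ?F (\<gamma>s ! m)" if "m < ?r" for m
    using P that len by (simp add: list_all2_conv_all_nth)
  have \<delta>s: "curve ?F \<delta>" if "\<delta> \<in> set \<delta>s" for \<delta>
  proof -
    obtain m where "m < ?r" "\<delta> = \<delta>s ! m" using \<open>\<delta> \<in> set \<delta>s\<close> len by (auto simp: in_set_conv_nth)
    then show ?thesis using F.tangent_memD(1)[OF mem] by simp
  qed
  have hd: "hd \<gamma>s = \<gamma>s ! 0" "hd \<delta>s = \<delta>s ! 0" "0 < ?r" "hd \<gamma>s \<in> set \<gamma>s" "hd \<delta>s \<in> set \<delta>s"
    using ne len by (auto simp: hd_conv_nth simp flip: length_greater_0_conv)
  obtain i where i: "i \<in> idx N" "hd \<gamma>s 0 \<in> cdom ?F i"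
    using F.pts_chart[OF F.curve_pts[OF \<gamma>s[OF hd(4)]]] by auto
  have foot: "fst (hd \<gamma>s 0) \<in> cdom N i" using i by (auto simp: cdom_form_bundle)
  have in_i: "\<gamma> 0 \<in> cdom ?F i" if "\<gamma> \<in> set \<gamma>s" for \<gamma>
    using F.curve_pts[OF \<gamma>s[OF that]] eq[OF that hd(4), of 0] foot
    by (cases "\<gamma> 0") (auto simp: cdom_form_bundle pts_form_bundle)
  have zero: "(\<delta>s ! m) 0 = (\<gamma>s ! m) 0" if "m < ?r" for m using F.tangent_memD(2)[OF mem[OF that]] .
  have in_i': "\<delta> 0 \<in> cdom ?F i" if "\<delta> \<in> set \<delta>s" for \<delta>
  proof -
    obtain m where "m < ?r" "\<delta> = \<delta>s ! m" using \<open>\<delta> \<in> set \<delta>s\<close> len by (auto simp: in_set_conv_nth)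
    then show ?thesis using zero in_i[of "\<gamma>s ! m"] by simp
  qed
  have coord: "wedge_list (map (\<lambda>\<gamma>. snd (\<gamma> t)) gs) (basis_vecs N i (fst (hd gs t)) I)
      = minor (\<lambda>\<gamma> k. crd ?F i (\<gamma> t) $ Inr {k}) gs (enum I)"
    if "length gs = ?r" "\<forall>\<gamma>\<in>set gs. \<forall>\<delta>\<in>set gs. \<forall>t. fst (\<gamma> t) = fst (\<delta> t)"
      "I \<in> index_sets (lbl N) ?r" for gs t I
  proof -
    note I = enum_index_sets[OF that(3)]
    have gs: "hd gs \<in> set gs" using that(1) ne by (cases gs) auto
    have "wedge_list (map (\<lambda>\<gamma>. snd (\<gamma> t)) gs) (basis_vecs N i (fst (hd gs t)) I)
        = minor (\<lambda>\<gamma> k. snd (\<gamma> t) [coord_vec N i (fst (hd gs t)) k]) gs (enum I)"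
      using I that by (simp add: wedge_list_eq_minor minor_map)
    also have "\<dots> = minor (\<lambda>\<gamma> k. crd ?F i (\<gamma> t) $ Inr {k}) gs (enum I)"
    proof (rule minor_cong)
      fix \<gamma> k assume "\<gamma> \<in> set gs" "k \<in> set (enum I)"
      then show "snd (\<gamma> t) [coord_vec N i (fst (hd gs t)) k] = crd ?F i (\<gamma> t) $ Inr {k}"
        using that(2)[rule_format, of "hd gs" \<gamma> t] gs I crd_one_form[of k i "\<gamma> t"] by auto
    qed (use I that in simp)
    finally show ?thesis .
  qed
  have curve: "curve ?R (?c gs)"
    if gs: "length gs = ?r" "\<forall>\<gamma>\<in>set gs. \<forall>\<delta>\<in>set gs. \<forall>t. fst (\<gamma> t) = fst (\<delta> t)"
      "\<forall>\<gamma>\<in>set gs. curve ?F \<gamma> \<and> \<gamma> 0 \<in> cdom ?F i" for gs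
  proof -
    have hdg: "hd gs \<in> set gs" using gs(1) ne by (cases gs) auto
    obtain e where e: "e > 0" "\<And>\<gamma> t. \<gamma> \<in> set gs \<Longrightarrow> \<bar>t\<bar> < e \<Longrightarrow> \<gamma> t \<in> cdom ?F i"
      "\<And>\<gamma>. \<gamma> \<in> set gs \<Longrightarrow> smooth_on UNIV {-e<..<e} (\<lambda>t. crd ?F i (\<gamma> t))"
      using F.curves_common_interval[of gs i] gs(3) i by auto
    have ro: "rel_open UNIV {-e<..<e}" by (simp add: rel_open_UNIV)
    note sm = smooth_on_vec_nth[OF ro e(3)]
    show ?thesis
    proof (rule curve_form_bundleI[OF i(1) e(1)])
      fix t assume t: "\<bar>t\<bar> < e"
      have "fst (hd gs t) \<in> cdom N i" using e(2)[OF hdg t] by (auto simp: cdom_form_bundle)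
      moreover have "snd (\<gamma> t) \<in> forms N 1 (fst (hd gs t))" if "\<gamma> \<in> set gs" for \<gamma>
        using e(2)[OF that t] gs(2)[rule_format, OF that hdg, of t] by (auto simp: cdom_form_bundle)
      then have "wedge_list (map (\<lambda>\<gamma>. snd (\<gamma> t)) gs) \<in> forms N ?r (fst (hd gs t))"
        using wedge_list_forms[of "map (\<lambda>\<gamma>. snd (\<gamma> t)) gs"] gs(1) by (auto simp: image_subset_iff)
      ultimately show "fst (?c gs t) \<in> cdom N i \<and> snd (?c gs t) \<in> forms N ?r (fst (?c gs t))" by simp
    next
      show "smooth_on UNIV {-e<..<e} (\<lambda>t. crd N i (fst (?c gs t)) $ k)" for k
        using sm[OF hdg, of "Inl k"] by (simp add: crd_form_bundle)
      show "smooth_on UNIV {-e<..<e} (\<lambda>t. snd (?c gs t) (basis_vecs N i (fst (?c gs t)) I))"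
        if I: "I \<in> index_sets (lbl N) ?r" for I
        unfolding fst_conv snd_conv coord[OF gs(1,2) I]
        using enum_index_sets[OF I] gs(1) by (intro smooth_on_minor[OF ro] sm) auto
    qed
  qed
  have "tangent ?R (?c \<delta>s) = tangent ?R (?c \<gamma>s)"
  proof (rule R.tangent_eqI_jet[where i = i])
    have z: "map (\<lambda>\<gamma>. snd (\<gamma> 0)) \<delta>s = map (\<lambda>\<gamma>. snd (\<gamma> 0)) \<gamma>s"
      using len zero by (intro nth_equalityI) auto
    show 0: "?c \<delta>s 0 = ?c \<gamma>s 0" using hd zero[of 0] z by simp
    show "curve ?R (?c \<delta>s)" by (rule curve[OF len conjunct2[OF P]]) (use \<delta>s in_i' in blast)
    show "curve ?R (?c \<gamma>s)" by (rule curve[OF refl eqs]) (use \<gamma>s in_i in blast)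
    show "i \<in> idx ?R" using i by simp
    have "snd (\<gamma> 0) \<in> forms N 1 (fst (hd \<gamma>s 0))" if "\<gamma> \<in> set \<gamma>s" for \<gamma>
      using in_i[OF that] eq[OF that hd(4), of 0] by (auto simp: cdom_form_bundle)
    then show "?c \<delta>s 0 \<in> cdom ?R i"
      unfolding 0 using foot wedge_list_forms[of "map (\<lambda>\<gamma>. snd (\<gamma> 0)) \<gamma>s"]
      by (auto simp: cdom_form_bundle image_subset_iff)
    fix s
    show "same_jet (\<lambda>t. crd ?R i (?c \<delta>s t) $ s) (\<lambda>t. crd ?R i (?c \<gamma>s t) $ s)"
    proof (cases s)
      case (Inl k)
      then show ?thesis using F.tangent_same_jet[OF mem[OF hd(3)] \<gamma>s, of i "Inl k"] hd i in_i
        by (simp add: crd_form_bundle)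
    next
      case (Inr I)
      show ?thesis
      proof (cases "I \<in> index_sets (lbl N) ?r")
        case True
        have "same_jet (\<lambda>t. minor (\<lambda>\<gamma> k. crd ?F i (\<gamma> t) $ Inr {k}) \<delta>s (enum I))
          (\<lambda>t. minor (\<lambda>\<gamma> k. crd ?F i (\<gamma> t) $ Inr {k}) \<gamma>s (enum I))"
          using enum_index_sets[OF True] len i
          by (intro same_jet_minor F.tangent_same_jet mem \<gamma>s in_i) auto
        moreover have "crd ?R i (?c \<delta>s t) $ s = minor (\<lambda>\<gamma> k. crd ?F i (\<gamma> t) $ Inr {k}) \<delta>s (enum I)" for t
          using coord[OF len conjunct2[OF P] True, of t] by (simp add: Inr True crd_form_bundle(2)[of ?r])
        moreover have "crd ?R i (?c \<gamma>s t) $ s = minor (\<lambda>\<gamma> k. crd ?F i (\<gamma> t) $ Inr {k}) \<gamma>s (enum I)" for t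
          using coord[OF refl eqs True, of t] by (simp add: Inr True crd_form_bundle(2)[of ?r])
        ultimately show ?thesis by simp
      qed (simp add: Inr crd_form_bundle same_jet_const)
    qed
  qed
  then show ?thesis unfolding tangent_wedge_def length_map some Let_def .
qed

end

section \<open>The flip\<close>

definition join :: "real ^ 'k \<Rightarrow> real ^ 'm \<Rightarrow> real ^ ('k::finite + 'm::finite)" where
  "join a b = (\<chi> s. case s of Inl k \<Rightarrow> a $ k | Inr l \<Rightarrow> b $ l)"

lemma join_nth [simp]: "join a b $ Inl k = a $ k" "join a b $ Inr l = b $ l"
  by (simp_all add: join_def)

lemma join_coord_space: "a \<in> coord_space K \<Longrightarrow> b \<in> coord_space L \<Longrightarrow> join a b \<in> coord_space (K <+> L)"
  by (auto simp: coord_space_def join_def split: sum.split)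

lemma vec_eq_sum_iff:
  "v = w \<longleftrightarrow> (\<forall>k. v $ Inl k = w $ Inl k) \<and> (\<forall>k. v $ Inr k = w $ (Inr k :: 'k::finite + 'm::finite))"
  by (auto simp: vec_eq_iff split_sum_all)

context charted
begin

text \<open>The curve in the tangent bundle with coordinates \<open>(x + t b, a + t c)\<close>; its tangent vector
  has coordinates \<open>(x, a, b, c)\<close>.\<close>

definition vec_curve :: "'i \<Rightarrow> 'a \<Rightarrow> real ^ 'k \<Rightarrow> real ^ 'k \<Rightarrow> real ^ 'k \<Rightarrow> real \<Rightarrow> 'a tvec" where
  "vec_curve i p a b c = (\<lambda>t. line_vec N i (par N i (crd N i p + t *\<^sub>R b)) (a + t *\<^sub>R c))"

lemma vec_curve:
  assumes i: "i \<in> idx N" "p \<in> cdom N i" and abc: "a \<in> model N" "b \<in> model N" "c \<in> model N"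
  shows "curve (tangent_bundle N) (vec_curve i p a b c)"
    and "chart_vel (tangent_bundle N) i (vec_curve i p a b c) = join b c"
    and "vec_curve i p a b c 0 = line_vec N i p a"
    and "\<forall>\<^sub>F t in nhds 0. foot (vec_curve i p a b c t) = par N i (crd N i p + t *\<^sub>R b) \<and>
      vel N i (vec_curve i p a b c t) = a + t *\<^sub>R c \<and> vec_curve i p a b c t \<in> pts (tangent_bundle N)"
proof -
  interpret TN: charted "tangent_bundle N" by (rule charted_tangent_bundle)
  obtain e where e: "e > 0" "\<forall>t. \<bar>t\<bar> < e \<longrightarrow> crd N i p + t *\<^sub>R b \<in> crd N i ` cdom N i"
    using line_eventually[OF i abc(2)] by blast
  have m: "a + t *\<^sub>R c \<in> model N" for t
    using abc subspace_coord_space by (auto intro!: subspace_add subspace_scale)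
  have *: "par N i (crd N i p + t *\<^sub>R b) \<in> cdom N i" "crd N i (par N i (crd N i p + t *\<^sub>R b)) = crd N i p + t *\<^sub>R b"
    if "\<bar>t\<bar> < e" for t using that e par_mem crd_par i by auto
  have lv': "foot (vec_curve i p a b c t) = par N i (crd N i p + t *\<^sub>R b)"
      "vel N i (vec_curve i p a b c t) = a + t *\<^sub>R c" "vec_curve i p a b c t \<in> pts (tangent_bundle N)"
    if "\<bar>t\<bar> < e" for t using line_vec[OF i(1) *(1)[OF that] m[of t]] by (auto simp: vec_curve_def)
  have c: "vec_curve i p a b c t \<in> cdom (tangent_bundle N) i \<and>
      crd (tangent_bundle N) i (vec_curve i p a b c t) = join (crd N i p) a + t *\<^sub>R join b c" if "\<bar>t\<bar> < e" for t
    using lv'[OF that] *[OF that] i by (simp add: cdom_tangent_bundle vec_eq_sum_iff crd_tangent_bundle)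
  have "i \<in> idx (tangent_bundle N)" using i by simp
  note cc = TN.curveI[OF this e(1) c smooth_on_line]
  show "curve (tangent_bundle N) (vec_curve i p a b c)" by (rule cc(1)) auto
  have "chart_vel (tangent_bundle N) i (vec_curve i p a b c)
      = vector_derivative (\<lambda>t. join (crd N i p) a + t *\<^sub>R join b c) (at 0)" by (rule cc(2)) auto
  then show "chart_vel (tangent_bundle N) i (vec_curve i p a b c) = join b c"
    by (simp only: vector_derivative_line)
  show "vec_curve i p a b c 0 = line_vec N i p a" using i by (simp add: vec_curve_def)
  show "\<forall>\<^sub>F t in nhds 0. foot (vec_curve i p a b c t) = par N i (crd N i p + t *\<^sub>R b) \<and>
      vel N i (vec_curve i p a b c t) = a + t *\<^sub>R c \<and> vec_curve i p a b c t \<in> pts (tangent_bundle N)"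
    unfolding eventually_nhds0_interval using e lv' by blast
qed

text \<open>\<open>jac\<close> consists of first partial derivatives of a transition component, so
  both sides are mixed second derivatives of a single smooth function.\<close>

lemma jac_symmetric:
  assumes "i \<in> idx N" "j \<in> idx N" "x \<in> crd N i ` (cdom N i \<inter> cdom N j)" "l \<in> lbl N" "m \<in> lbl N"
  defines "U \<equiv> crd N i ` (cdom N i \<inter> cdom N j)"
  shows "dir_deriv U (jac i j k l) (axis m 1) x = dir_deriv U (jac i j k m) (axis l 1) x"
proof -
  note U = open_overlap[OF assms(1,2), folded U_def] and sm = smooth_transition[OF assms(1,2), folded U_def]
  let ?f = "\<lambda>y. (crd N j \<circ> par N i) y $ k"
  have smf: "smooth_on (model N) U ?f" by (rule smooth_on_vec_nth[OF U sm])
  have j: "dir_deriv U ?f (axis l 1) y = jac i j k l y" if "y \<in> U" "l \<in> lbl N" for y l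
  proof -
    have "dir_deriv U ?f (axis l 1) y = frechet_derivative (crd N j \<circ> par N i) (at y within U) (axis l 1) $ k"
      by (rule dir_deriv_eq[OF U that(1) _ bounded_linear.has_derivative[OF bounded_linear_vec_nth
            smooth_on_derivative[OF sm that(1)]]]) (use that in simp)
    then show ?thesis by (simp add: jac_def transition_jacobian_def U_def)
  qed
  have x: "x \<in> U" using assms by simp
  have "dir_deriv U (jac i j k l) (axis m 1) x = dir_deriv U (dir_deriv U ?f (axis l 1)) (axis m 1) x"
    using frechet_derivative_cong[of U "jac i j k l" "dir_deriv U ?f (axis l 1)" x] j x assms(4) by simp
  also have "\<dots> = dir_deriv U (dir_deriv U ?f (axis m 1)) (axis l 1) x"
    using assms by (intro dir_deriv_symmetric[OF U smf x]) auto
  also have "\<dots> = dir_deriv U (jac i j k m) (axis l 1) x"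
    using frechet_derivative_cong[of U "jac i j k m" "dir_deriv U ?f (axis m 1)" x] j x assms(5) by simp
  finally show ?thesis .
qed

lemma dir_deriv_expansion:
  assumes "smooth_on (model N) U f" "x \<in> U" "v \<in> model N"
  shows "dir_deriv U f v x = (\<Sum>m\<in>lbl N. (v $ m) *\<^sub>R dir_deriv U f (axis m 1) x)"
proof -
  note L = linear_dir_deriv[OF assms(1,2)]
  have "dir_deriv U f v x = dir_deriv U f (\<Sum>m\<in>lbl N. (v $ m) *\<^sub>R axis m 1) x"
    using coord_space_expansion[OF assms(3)] by simp
  then show ?thesis by (simp only: linear_sum[OF L] linear_cmul[OF L])
qed

text \<open>The velocity in chart \<open>j\<close> is the Jacobian at \<open>x + t b\<close> applied
  to \<open>a + t c\<close>. By the product rule its derivative consists of a second derivative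
  paired with \<open>a\<close> and \<open>b\<close>, and of the Jacobian applied to
  \<open>c\<close>.\<close>

lemma vec_curve_transition:
  assumes i: "i \<in> idx N" "p \<in> cdom N i" and abc: "a \<in> model N" "b \<in> model N" "c \<in> model N"
    and j: "j \<in> idx N" "p \<in> cdom N j"
  defines "U \<equiv> crd N i ` (cdom N i \<inter> cdom N j)" and "x \<equiv> crd N i p"
  shows "chart_vel (tangent_bundle N) j (vec_curve i p a b c) $ Inl k = transition_jacobian N i j b x $ k"
    and "chart_vel (tangent_bundle N) j (vec_curve i p a b c) $ Inr k =
      (\<Sum>l\<in>lbl N. \<Sum>m\<in>lbl N. b $ m * a $ l * dir_deriv U (jac i j k l) (axis m 1) x)
      + transition_jacobian N i j c x $ k"
proof -
  interpret TN: charted "tangent_bundle N" by (rule charted_tangent_bundle)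
  let ?u = "vec_curve i p a b c"
  note u = vec_curve[OF i abc]
  have lv: "line_vec N i p a \<in> pts (tangent_bundle N)" "foot (line_vec N i p a) = p"
    using line_vec[OF i abc(1)] by auto
  have 0: "?u 0 \<in> cdom (tangent_bundle N) i" "?u 0 \<in> cdom (tangent_bundle N) j"
    using u(3) lv i j by (auto simp: cdom_tangent_bundle)
  have "\<forall>\<^sub>F t in nhds 0. ?u t \<in> cdom (tangent_bundle N) i" "\<forall>\<^sub>F t in nhds 0. ?u t \<in> cdom (tangent_bundle N) j"
    using TN.curve_eventually_chart[OF u(1)] 0 i j by auto
  then have ev: "\<forall>\<^sub>F t in nhds 0. foot (?u t) \<in> cdom N i \<and> foot (?u t) \<in> cdom N j \<and>
      crd N i (foot (?u t)) = x + t *\<^sub>R b \<and> vel N i (?u t) = a + t *\<^sub>R c \<and> ?u t \<in> pts (tangent_bundle N)"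
    using u(4) line_eventually[OF i abc(2), folded eventually_nhds0_interval]
    by eventually_elim (use i j in \<open>auto simp: cdom_tangent_bundle x_def\<close>)
  have evU: "\<forall>\<^sub>F t in nhds 0. x + t *\<^sub>R b \<in> U"
    using ev by eventually_elim (metis IntI U_def image_eqI)
  have xU: "x \<in> U" using i j by (auto simp: U_def x_def)
  note U = open_overlap[OF i(1) j(1), folded U_def]
  have line: "((\<lambda>t. x + t *\<^sub>R b) has_vector_derivative b) (at 0)"
    by (auto intro!: derivative_eq_intros simp: has_vector_derivative_def)
  have der: "((\<lambda>t. f (x + t *\<^sub>R b)) has_vector_derivative dir_deriv U f b x) (at 0)"
    if "smooth_on (model N) U f" for f :: "real ^ 'k \<Rightarrow> 'z::real_normed_vector"
    by (rule has_derivative_along_curve[OF U that xU _ line evU]) simp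
  have d: "((\<lambda>t. crd (tangent_bundle N) j (?u t) $ s) has_real_derivative chart_vel (tangent_bundle N) j ?u $ s) (at 0)" for s
    by (rule TN.curve_component_derivative[OF u(1)]) (use 0 j in auto)
  show "chart_vel (tangent_bundle N) j ?u $ Inl k = transition_jacobian N i j b x $ k"
  proof (rule DERIV_unique[OF d])
    have "((\<lambda>t. (crd N j \<circ> par N i) (x + t *\<^sub>R b) $ k) has_real_derivative transition_jacobian N i j b x $ k) (at 0)"
      using bounded_linear.has_vector_derivative[OF bounded_linear_vec_nth
          der[OF smooth_transition[OF i(1) j(1), folded U_def]], of k]
      by (simp add: has_real_derivative_iff_has_vector_derivative transition_jacobian_def U_def)
    then show "((\<lambda>t. crd (tangent_bundle N) j (?u t) $ Inl k) has_real_derivative transition_jacobian N i j b x $ k) (at 0)"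
    proof (rule DERIV_cong_ev[THEN iffD1, OF refl _ refl, rotated])
      show "\<forall>\<^sub>F t in nhds 0. (crd N j \<circ> par N i) (x + t *\<^sub>R b) $ k = crd (tangent_bundle N) j (?u t) $ Inl k"
        using ev
      proof eventually_elim
        case (elim t)
        then show ?case using par_crd[OF i(1), of "foot (?u t)"] by (simp add: crd_tangent_bundle)
      qed
    qed
  qed
  show "chart_vel (tangent_bundle N) j ?u $ Inr k =
      (\<Sum>l\<in>lbl N. \<Sum>m\<in>lbl N. b $ m * a $ l * dir_deriv U (jac i j k l) (axis m 1) x)
      + transition_jacobian N i j c x $ k"
  proof (rule DERIV_unique[OF d])
    have "((\<lambda>t. jac i j k l (x + t *\<^sub>R b)) has_real_derivative (\<Sum>m\<in>lbl N. b $ m * dir_deriv U (jac i j k l) (axis m 1) x)) (at 0)"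
      if "l \<in> lbl N" for l
    proof -
      note sj = smooth_on_jac[OF i(1) j(1) that, folded U_def, of k]
      show ?thesis using der[OF sj] dir_deriv_expansion[OF sj xU abc(2)]
        by (simp add: has_real_derivative_iff_has_vector_derivative)
    qed
    moreover have "((\<lambda>t. a $ l + t * c $ l) has_real_derivative c $ l) (at 0)" for l
      by (auto intro!: derivative_eq_intros)
    ultimately have "((\<lambda>t. jac i j k l (x + t *\<^sub>R b) * (a $ l + t * c $ l)) has_real_derivative
        (\<Sum>m\<in>lbl N. b $ m * dir_deriv U (jac i j k l) (axis m 1) x) * a $ l + c $ l * jac i j k l x) (at 0)"
      if "l \<in> lbl N" for l
      using DERIV_mult[of "\<lambda>t. jac i j k l (x + t *\<^sub>R b)" _ 0 UNIV "\<lambda>t. a $ l + t * c $ l" "c $ l"] that by fastforce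
    then have "((\<lambda>t. \<Sum>l\<in>lbl N. jac i j k l (x + t *\<^sub>R b) * (a $ l + t * c $ l)) has_real_derivative
        (\<Sum>l\<in>lbl N. (\<Sum>m\<in>lbl N. b $ m * dir_deriv U (jac i j k l) (axis m 1) x) * a $ l + c $ l * jac i j k l x)) (at 0)"
      by (intro DERIV_sum) auto
    also have "(\<Sum>l\<in>lbl N. (\<Sum>m\<in>lbl N. b $ m * dir_deriv U (jac i j k l) (axis m 1) x) * a $ l + c $ l * jac i j k l x)
       = (\<Sum>l\<in>lbl N. \<Sum>m\<in>lbl N. b $ m * a $ l * dir_deriv U (jac i j k l) (axis m 1) x) + transition_jacobian N i j c x $ k"
      unfolding x_def transition_jacobian_expansion[OF i(1) j(1) i(2) j(2) abc(3)]
      by (simp add: sum.distrib sum_distrib_right sum_distrib_left mult_ac)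
    finally show "((\<lambda>t. crd (tangent_bundle N) j (?u t) $ Inr k) has_real_derivative
        (\<Sum>l\<in>lbl N. \<Sum>m\<in>lbl N. b $ m * a $ l * dir_deriv U (jac i j k l) (axis m 1) x)
        + transition_jacobian N i j c x $ k) (at 0)"
    proof (rule DERIV_cong_ev[THEN iffD1, OF refl _ refl, rotated])
      show "\<forall>\<^sub>F t in nhds 0. (\<Sum>l\<in>lbl N. jac i j k l (x + t *\<^sub>R b) * (a $ l + t * c $ l))
          = crd (tangent_bundle N) j (?u t) $ Inr k"
        using ev
      proof eventually_elim
        case (elim t)
        then have "?u t \<in> tangent_space N (foot (?u t))" by (simp add: tangent_space_def)
        from vel_jac[OF this i(1) j(1)] elim show ?case by (simp add: crd_tangent_bundle)
      qed
    qed
  qed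
qed

abbreviation vec2 :: "'i \<Rightarrow> 'a \<Rightarrow> real ^ 'k \<Rightarrow> real ^ 'k \<Rightarrow> real ^ 'k \<Rightarrow> 'a tvec tvec" where
  "vec2 i p a b c \<equiv> tangent (tangent_bundle N) (vec_curve i p a b c)"

lemma vec2_pts:
  assumes i: "i \<in> idx N" "p \<in> cdom N i" and abc: "a \<in> model N" "b \<in> model N" "c \<in> model N"
  shows "vec2 i p a b c \<in> pts (tangent_bundle (tangent_bundle N))"
    "foot (vec2 i p a b c) = line_vec N i p a"
    "vel (tangent_bundle N) i (vec2 i p a b c) = join b c"
proof -
  interpret TN: charted "tangent_bundle N" by (rule charted_tangent_bundle)
  note u = vec_curve[OF i abc]
  show "vec2 i p a b c \<in> pts (tangent_bundle (tangent_bundle N))" by (rule TN.tangent_pts[OF u(1)])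
  show "foot (vec2 i p a b c) = line_vec N i p a" using TN.foot_tangent[OF u(1)] u(3) by simp
  show "vel (tangent_bundle N) i (vec2 i p a b c) = join b c"
    using TN.vel_tangent[OF u(1), of i] u(2,3) line_vec[OF i abc(1)] i by (simp add: cdom_tangent_bundle)
qed

text \<open>In chart \<open>j\<close> the two middle coordinates are the Jacobian applied to
  \<open>a\<close> and to \<open>b\<close>, so they trade places with \<open>a\<close> and
  \<open>b\<close>. The last coordinate contains \<open>a\<close> and \<open>b\<close> only through
  the second derivative of the transition, which is symmetric.\<close>

lemma vec2_flip:
  assumes i: "i \<in> idx N" "p \<in> cdom N i" and abc: "a \<in> model N" "b \<in> model N" "c \<in> model N"
    and j: "j \<in> idx N" "p \<in> cdom N j"
  shows "crd (tangent_bundle (tangent_bundle N)) j (vec2 i p b a c)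
    = flip_coords (crd (tangent_bundle (tangent_bundle N)) j (vec2 i p a b c))"
proof -
  interpret TN: charted "tangent_bundle N" by (rule charted_tangent_bundle)
  let ?U = "crd N i ` (cdom N i \<inter> cdom N j)" and ?x = "crd N i p"
  have vt: "vel N j (line_vec N i p a) = transition_jacobian N i j a ?x" if "a \<in> model N" for a
    using vel_transition[of "line_vec N i p a" i j] line_vec[OF i that] i j by simp
  have v2: "vel (tangent_bundle N) j (vec2 i p a b c) = chart_vel (tangent_bundle N) j (vec_curve i p a b c)"
    if "a \<in> model N" "b \<in> model N" for a b
    using TN.vel_tangent[OF vec_curve(1)[OF i that abc(3)], of j] vec_curve(3)[OF i that abc(3)]
      line_vec[OF i that(1)] j by (simp add: cdom_tangent_bundle)
  \<comment> \<open>Symmetry of the second derivatives exchanges the two indices of the summand;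
    exchanging the sums restores the original order.\<close>
  have sym: "(\<Sum>l\<in>lbl N. \<Sum>m\<in>lbl N. a $ m * b $ l * dir_deriv ?U (jac i j k l) (axis m 1) ?x)
      = (\<Sum>l\<in>lbl N. \<Sum>m\<in>lbl N. b $ m * a $ l * dir_deriv ?U (jac i j k l) (axis m 1) ?x)" for k
  proof -
    have "(\<Sum>l\<in>lbl N. \<Sum>m\<in>lbl N. a $ m * b $ l * dir_deriv ?U (jac i j k l) (axis m 1) ?x)
        = (\<Sum>l\<in>lbl N. \<Sum>m\<in>lbl N. a $ m * b $ l * dir_deriv ?U (jac i j k m) (axis l 1) ?x)"
      using i j by (intro sum.cong refl arg_cong[of _ _ "(*) _"] jac_symmetric) auto
    also have "\<dots> = (\<Sum>m\<in>lbl N. \<Sum>l\<in>lbl N. a $ m * b $ l * dir_deriv ?U (jac i j k m) (axis l 1) ?x)"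
      by (rule sum.swap)
    finally show ?thesis by (simp add: mult_ac)
  qed
  note t1 = vec_curve_transition[OF i abc j] and t2 = vec_curve_transition[OF i abc(2,1,3) j]
  show ?thesis
    unfolding vec_eq_sum_iff
    using vec2_pts[OF i abc] vec2_pts[OF i abc(2,1,3)] line_vec[OF i abc(1)] line_vec[OF i abc(2)]
    by (auto simp: TN.crd_tangent_bundle crd_tangent_bundle flip_coords_def split_sum_all vt abc v2 t1 t2 sym)
qed

lemma cdom_TTM:
  "i \<in> idx N \<Longrightarrow> cdom (tangent_bundle (tangent_bundle N)) i
    = {w \<in> pts (tangent_bundle (tangent_bundle N)). foot (foot w) \<in> cdom N i}"
proof -
  assume i: "i \<in> idx N"
  interpret TN: charted "tangent_bundle N" by (rule charted_tangent_bundle)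
  show ?thesis using TN.cdom_tangent_bundle[of i] TN.rep_pts(4) i by (auto simp: cdom_tangent_bundle)
qed

text \<open>The exchange of coordinates holds in all charts by \<open>vec2_flip\<close>, and chart
  \<open>i\<close> alone pins the vector down, so the definite description denotes it.\<close>

lemma flip_map_vec2:
  assumes i: "i \<in> idx N" "p \<in> cdom N i" and abc: "a \<in> model N" "b \<in> model N" "c \<in> model N"
  shows "flip_map N (vec2 i p a b c) = vec2 i p b a c"
proof -
  interpret TN: charted "tangent_bundle N" by (rule charted_tangent_bundle)
  interpret TTN: charted "tangent_bundle (tangent_bundle N)" by (rule TN.charted_tangent_bundle)
  let ?T = "tangent_bundle (tangent_bundle N)"
  note P = vec2_pts[OF i abc] and Q = vec2_pts[OF i abc(2,1,3)]
  have ft: "foot (foot (vec2 i p a b c)) = p" "foot (foot (vec2 i p b a c)) = p"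
    using P Q line_vec[OF i] abc by auto
  show ?thesis
    unfolding flip_map_def Let_def
  proof (rule the_equality, intro conjI ballI impI)
    show "vec2 i p b a c \<in> pts ?T" by (rule Q(1))
    fix j assume j: "j \<in> idx N" "vec2 i p a b c \<in> cdom ?T j"
    then have pj: "p \<in> cdom N j" using ft by (simp add: cdom_TTM)
    show "vec2 i p b a c \<in> cdom ?T j" using j ft pj Q by (simp add: cdom_TTM)
    show "crd ?T j (vec2 i p b a c) = flip_coords (crd ?T j (vec2 i p a b c))"
      by (rule vec2_flip[OF i abc j(1) pj])
  next
    fix w assume w: "w \<in> pts ?T \<and> (\<forall>j\<in>idx N. vec2 i p a b c \<in> cdom ?T j \<longrightarrow>
        w \<in> cdom ?T j \<and> crd ?T j w = flip_coords (crd ?T j (vec2 i p a b c)))"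
    have c: "vec2 i p a b c \<in> cdom ?T i" "vec2 i p b a c \<in> cdom ?T i" using P Q ft i by (simp_all add: cdom_TTM)
    show "w = vec2 i p b a c"
      by (rule TTN.crd_eqD[of i]) (use w c i vec2_flip[OF i abc i] in auto)
  qed
qed

text \<open>The first two coordinates of \<open>z\<close> are those of \<open>v\<close> and the
  other two are read off its velocity; foot and velocity in one chart determine a tangent
  vector.\<close>

lemma vec2_exhaust:
  assumes "z \<in> tangent_space (tangent_bundle N) v" "v \<in> pts (tangent_bundle N)" "i \<in> idx N" "foot v \<in> cdom N i"
  shows "\<exists>b\<in>model N. \<exists>c\<in>model N. z = vec2 i (foot v) (vel N i v) b c \<and> vel (tangent_bundle N) i z = join b c"
proof -
  interpret TN: charted "tangent_bundle N" by (rule charted_tangent_bundle)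
  have z: "z \<in> pts (tangent_bundle (tangent_bundle N))" "foot z = v" using assms(1) by (auto simp: tangent_space_def)
  have i: "i \<in> idx (tangent_bundle N)" "foot z \<in> cdom (tangent_bundle N) i"
    using assms z by (auto simp: cdom_tangent_bundle)
  let ?b = "\<chi> k. vel (tangent_bundle N) i z $ Inl k" and ?c = "\<chi> k. vel (tangent_bundle N) i z $ Inr k"
  have m: "vel (tangent_bundle N) i z \<in> coord_space (lbl N <+> lbl N)"
    using TN.vel_model[OF z(1) i] by simp
  have bc: "?b \<in> model N" "?c \<in> model N" using m by (auto simp: coord_space_def)
  have a: "vel N i v \<in> model N" using vel_model assms by simp
  have jn: "vel (tangent_bundle N) i z = join ?b ?c" by (simp add: vec_eq_sum_iff)
  note P = vec2_pts[OF assms(3,4) a bc]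
  have "line_vec N i (foot v) (vel N i v) = v"
    by (rule line_vec_vel) (use assms in \<open>auto simp: tangent_space_def\<close>)
  then have "z = vec2 i (foot v) (vel N i v) ?b ?c"
    using P z i jn by (intro TN.tvec_eqI[OF z(1) P(1) _ i]) auto
  then show ?thesis using bc jn by blast
qed

end

section \<open>The maps epsilon in a chart\<close>

text \<open>Below, \<open>lift_vec t\<close> is \<open>A\<^sub>t\<close>. The line is frozen by \<open>base_time\<close> where it would leave the chart,
  because the representatives chosen in \<^const>\<open>tangent_pairing\<close> and its relatives have to lie over
  the same point for all times, not only for small ones.\<close>

definition lift_coeff :: "real \<Rightarrow> 'k + 'k \<Rightarrow> 'k \<Rightarrow> real" where
  "lift_coeff t s k = (case s of Inl l \<Rightarrow> if l = k then t else 0 | Inr l \<Rightarrow> if l = k then 1 else 0)"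

text \<open>\<open>lift_coeff t\<close> is the matrix of A_t in coordinate frames: the
  \<open>k\<close>-th coordinate vector goes to \<open>t\<close> times the base direction plus the
  velocity direction. Its entries are \<open>t\<close>, 1 and 0, so the minors are polynomials in
  \<open>t\<close>.\<close>

lemma smooth_on_lift_minor:
  assumes "length ss = length ks" "open W"
  shows "smooth_on UNIV W (\<lambda>t. minor (lift_coeff t) ss ks)"
proof (rule smooth_on_minor[OF rel_open_UNIV[OF assms(2)] assms(1)])
  show "smooth_on UNIV W (\<lambda>t. lift_coeff t s k)" for s :: "'a + 'a" and k
  proof (cases s)
    case (Inl l)
    then show ?thesis using smooth_on_id smooth_on_const rel_open_UNIV[OF assms(2)]
      by (cases "l = k") (simp_all add: lift_coeff_def)
  qed (simp add: lift_coeff_def smooth_on_const rel_open_UNIV[OF assms(2)])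
qed

context charted
begin

context
  fixes i :: 'i and v :: "'a tvec"
  assumes i: "i \<in> idx N" and v: "v \<in> pts (tangent_bundle N)" and fv: "foot v \<in> cdom N i"
begin

definition base_time :: "real \<Rightarrow> real" where
  "base_time t = (if crd N i (foot v) + t *\<^sub>R vel N i v \<in> crd N i ` cdom N i then t else 0)"

definition base_curve :: "real \<Rightarrow> 'a" where
  "base_curve t = par N i (crd N i (foot v) + base_time t *\<^sub>R vel N i v)"

definition lift_vec :: "real \<Rightarrow> 'a tvec \<Rightarrow> 'a tvec tvec" where
  "lift_vec t u = line_vec (tangent_bundle N) i v (join (t *\<^sub>R vel N i u) (vel N i u))"

definition form_lift :: "real \<Rightarrow> 'a tvec form \<Rightarrow> 'a form" where
  "form_lift t \<omega> = (\<lambda>vs. if set vs \<subseteq> tangent_space N (base_curve t)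
     then \<omega> (map (lift_vec (base_time t)) vs) else 0)"

definition form_curve :: "'a tvec form \<Rightarrow> real \<Rightarrow> 'a \<times> 'a form" where
  "form_curve \<omega> t = (base_curve t, form_lift t \<omega>)"

section \<open>The curve of pulled back forms\<close>

lemma vel_v: "vel N i v \<in> model N"
  by (rule vel_model[OF v i fv])

lemma v_cdom: "i \<in> idx (tangent_bundle N)" "v \<in> cdom (tangent_bundle N) i"
  using i v fv by (auto simp: cdom_tangent_bundle)

lemma base_line_mem: "crd N i (foot v) + base_time t *\<^sub>R vel N i v \<in> crd N i ` cdom N i"
  using fv by (simp add: base_time_def)

lemma base_curve_mem: "base_curve t \<in> cdom N i"
  unfolding base_curve_def by (rule par_mem[OF i base_line_mem])

lemma crd_base_curve: "crd N i (base_curve t) = crd N i (foot v) + base_time t *\<^sub>R vel N i v"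
  unfolding base_curve_def by (rule crd_par[OF i base_line_mem])

lemma eventually_base_time: "\<forall>\<^sub>F t in nhds 0. base_time t = t"
  using line_eventually[OF i fv vel_v, folded eventually_nhds0_interval]
  by eventually_elim (simp add: base_time_def)

lemma base_time_0 [simp]: "base_time 0 = 0"
  by (simp add: base_time_def)

lemma base_curve: "curve N base_curve" "tangent N base_curve = v" "base_curve 0 = foot v"
proof -
  have ev: "\<forall>\<^sub>F t in nhds 0. base_curve t = par N i (crd N i (foot v) + t *\<^sub>R vel N i v)"
    using eventually_base_time by eventually_elim (simp add: base_curve_def)
  note l = curve_cong[OF line_curve(1)[OF i fv vel_v] ev]
  show "curve N base_curve" by (rule l(1))
  show "tangent N base_curve = v"
    using l(2) line_vec_vel[of v "foot v" i] i v fv by (simp add: line_vec_def tangent_space_def)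
  show "base_curve 0 = foot v" using i fv by (simp add: base_curve_def)
qed

lemma lift_vec:
  assumes "p \<in> cdom N i" "u \<in> tangent_space N p"
  shows "lift_vec t u \<in> tangent_space (tangent_bundle N) v"
    and "vel (tangent_bundle N) i (lift_vec t u) = join (t *\<^sub>R vel N i u) (vel N i u)"
proof -
  interpret TN: charted "tangent_bundle N" by (rule charted_tangent_bundle)
  have u: "vel N i u \<in> model N" using vel_model i assms by (simp add: tangent_space_def)
  have m: "join (t *\<^sub>R vel N i u) (vel N i u) \<in> model (tangent_bundle N)"
    using u subspace_scale[OF subspace_coord_space u, of t] by (simp add: join_coord_space)
  show "lift_vec t u \<in> tangent_space (tangent_bundle N) v"
    and "vel (tangent_bundle N) i (lift_vec t u) = join (t *\<^sub>R vel N i u) (vel N i u)"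
    using TN.line_vec[OF v_cdom m] by (simp_all add: lift_vec_def)
qed

lemma lift_vec_lincomb:
  assumes "p \<in> cdom N i" "u \<in> tangent_space N p" "w \<in> tangent_space N p"
  shows "lift_vec t (lincomb N a u b w) = lincomb (tangent_bundle N) a (lift_vec t u) b (lift_vec t w)"
proof -
  interpret TN: charted "tangent_bundle N" by (rule charted_tangent_bundle)
  note l = lincomb[OF assms(2,3)] and L = lift_vec[OF assms(1)]
  show ?thesis
    by (rule TN.tangent_space_eqI[OF L(1)[OF l(1)] TN.lincomb(1)[OF L(1)[OF assms(2)] L(1)[OF assms(3)]] v_cdom])
      (simp add: L l assms i TN.lincomb(2)[OF L(1)[OF assms(2)] L(1)[OF assms(3)] v_cdom] vec_eq_sum_iff algebra_simps)
qed

lemma form_lift_forms: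
  assumes "\<omega> \<in> forms (tangent_bundle N) r v"
  shows "form_lift t \<omega> \<in> forms N r (base_curve t)"
  unfolding forms_alt_forms
proof (rule alt_formsI)
  note \<omega> = assms[unfolded forms_alt_forms]
  show "form_lift t \<omega> vs = 0" if "length vs \<noteq> r" for vs
    using that alt_forms_off[OF \<omega>] by (simp add: form_lift_def)
  show "form_lift t \<omega> vs = 0" if "length vs = r" "\<not> set vs \<subseteq> tangent_space N (base_curve t)" for vs
    using that by (simp add: form_lift_def)
  show "form_lift t \<omega> vs = 0" if "length vs = r" "\<not> distinct vs" for vs
    using that alt_forms_nondistinct[OF \<omega>] by (simp add: form_lift_def distinct_map)
  fix vs j a u b w
  assume vs: "length vs = r" "set vs \<subseteq> tangent_space N (base_curve t)" "j < r"
    "u \<in> tangent_space N (base_curve t)" "w \<in> tangent_space N (base_curve t)"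
  let ?A = "lift_vec (base_time t)"
  have sub: "set (vs[j := x]) \<subseteq> tangent_space N (base_curve t)" if "x \<in> tangent_space N (base_curve t)" for x
    using vs that by (intro set_update_subsetI) auto
  have A: "?A u \<in> tangent_space (tangent_bundle N) v" if "u \<in> tangent_space N (base_curve t)" for u
    by (rule lift_vec(1)[OF base_curve_mem that])
  have "\<omega> ((map ?A vs)[j := lincomb (tangent_bundle N) a (?A u) b (?A w)])
      = a * \<omega> ((map ?A vs)[j := ?A u]) + b * \<omega> ((map ?A vs)[j := ?A w])"
    by (rule alt_forms_multilinear[OF \<omega>]) (use vs A in auto)
  then show "form_lift t \<omega> (vs[j := lincomb N a u b w])
      = a * form_lift t \<omega> (vs[j := u]) + b * form_lift t \<omega> (vs[j := w])"
    using sub[OF vs(4)] sub[OF vs(5)] sub[OF lincomb(1)[OF vs(4,5)]]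
    by (simp add: form_lift_def map_update lift_vec_lincomb[OF base_curve_mem vs(4,5)])
qed

lemma form_lift_lincomb:
  "form_lift t (\<lambda>vs. a * \<omega> vs + b * \<eta> vs) = (\<lambda>vs. a * form_lift t \<omega> vs + b * form_lift t \<eta> vs)"
  by (simp add: form_lift_def fun_eq_iff)

text \<open>On lists of vectors in the domain this is \<open>wedge_map\<close>; elsewhere both sides
  are forced to vanish, the right one because it is again a form.\<close>

lemma form_lift_wedge:
  assumes "\<omega> \<in> forms (tangent_bundle N) p v" "\<eta> \<in> forms (tangent_bundle N) q v"
  shows "form_lift t (wedge p q \<omega> \<eta>) = wedge p q (form_lift t \<omega>) (form_lift t \<eta>)"
proof
  fix vs
  let ?A = "lift_vec (base_time t)" and ?T = "tangent_space N (base_curve t)"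
  have w: "wedge p q (form_lift t \<omega>) (form_lift t \<eta>) \<in> forms N (p + q) (base_curve t)"
    by (intro wedge_forms form_lift_forms assms)
  show "form_lift t (wedge p q \<omega> \<eta>) vs = wedge p q (form_lift t \<omega>) (form_lift t \<eta>) vs"
  proof (cases "length vs = p + q \<and> set vs \<subseteq> ?T")
    case True
    then have "form_lift t (wedge p q \<omega> \<eta>) vs = wedge p q (\<lambda>us. \<omega> (map ?A us)) (\<lambda>us. \<eta> (map ?A us)) vs"
      by (simp add: form_lift_def wedge_map)
    also have "\<dots> = wedge p q (form_lift t \<omega>) (form_lift t \<eta>) vs"
      by (rule wedge_cong) (use True in \<open>auto simp: form_lift_def\<close>)
    finally show ?thesis .
  next
    case False
    then have "wedge p q (form_lift t \<omega>) (form_lift t \<eta>) vs = 0"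
      using alt_forms_off[OF w[unfolded forms_alt_forms]] by simp
    moreover have "form_lift t (wedge p q \<omega> \<eta>) vs = 0"
      using False by (auto simp: form_lift_def wedge_def)
    ultimately show ?thesis by simp
  qed
qed

lemma form_lift_wedge_list:
  "set as \<subseteq> forms (tangent_bundle N) 1 v \<Longrightarrow> form_lift t (wedge_list as) = wedge_list (map (form_lift t) as)"
proof (induction as)
  case Nil
  then show ?case by (auto simp: form_lift_def fun_eq_iff)
next
  case (Cons a as)
  have "form_lift t (wedge_list (a # as)) = wedge 1 (length as) (form_lift t a) (form_lift t (wedge_list as))"
    using Cons.prems charted.wedge_list_forms[OF charted_tangent_bundle, of as v]
    by (simp only: wedge_list.simps) (intro form_lift_wedge; simp)
  then show ?case using Cons by simp
qed

text \<open>Expansion in the coordinate coframe of the tangent bundle at \<open>v\<close> separates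
  the constant components of the form from the minors of A_t, which carry all dependence on
  time.\<close>

lemma form_lift_coords:
  assumes \<omega>: "\<omega> \<in> forms (tangent_bundle N) r v" and I: "I \<in> index_sets (lbl N) r"
  shows "form_lift t \<omega> (basis_vecs N i (base_curve t) I) = (\<Sum>S\<in>index_sets (lbl N <+> lbl N) r.
    \<omega> (basis_vecs (tangent_bundle N) i v S) * minor (lift_coeff (base_time t)) (enum S) (enum I))"
proof -
  interpret TN: charted "tangent_bundle N" by (rule charted_tangent_bundle)
  note Is = enum_index_sets[OF I]
  let ?A = "lift_vec (base_time t)" and ?c = "coord_vec N i (base_curve t)"
  have c: "?c k \<in> tangent_space N (base_curve t)" "vel N i (?c k) = axis k 1" if "k \<in> lbl N" for k
    using coord_vec[OF i base_curve_mem that] by auto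
  have "set (basis_vecs N i (base_curve t) I) \<subseteq> tangent_space N (base_curve t)" using Is c by auto
  then have "form_lift t \<omega> (basis_vecs N i (base_curve t) I) = \<omega> (map (\<lambda>k. ?A (?c k)) (enum I))"
    by (simp add: form_lift_def comp_def)
  also have "\<dots> = (\<Sum>S\<in>index_sets (lbl N <+> lbl N) r. \<omega> (basis_vecs (tangent_bundle N) i v S)
      * basis_form (tangent_bundle N) i v S (map (\<lambda>k. ?A (?c k)) (enum I)))"
    by (rule fun_cong[OF TN.form_expansion[OF v_cdom \<omega>], unfolded tangent_bundle_simps])
  also have "\<dots> = (\<Sum>S\<in>index_sets (lbl N <+> lbl N) r.
      \<omega> (basis_vecs (tangent_bundle N) i v S) * minor (lift_coeff (base_time t)) (enum S) (enum I))"
  proof (intro sum.cong refl arg_cong[of _ _ "(*) _"])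
    fix S assume S: "S \<in> index_sets (lbl N <+> lbl N) r"
    note Ss = enum_index_sets[OF S]
    have "basis_form (tangent_bundle N) i v S (map (\<lambda>k. ?A (?c k)) (enum I))
        = minor (\<lambda>s k. coord_covec (tangent_bundle N) i v s [?A (?c k)]) (enum S) (enum I)"
      using Is Ss by (simp add: wedge_list_eq_minor minor_map)
    also have "\<dots> = minor (lift_coeff (base_time t)) (enum S) (enum I)"
    proof (rule minor_cong)
      fix s k assume "s \<in> set (enum S)" "k \<in> set (enum I)"
      then have k: "k \<in> lbl N" using Is by auto
      note A = lift_vec[OF base_curve_mem c(1)[OF k], of "base_time t"]
      show "coord_covec (tangent_bundle N) i v s [?A (?c k)] = lift_coeff (base_time t) s k"
        unfolding TN.coord_covec_apply[OF A(1)] A(2) c(2)[OF k]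
        by (cases s) (auto simp: lift_coeff_def axis_def)
    qed (use Is Ss in simp)
    finally show "basis_form (tangent_bundle N) i v S (map (\<lambda>k. ?A (?c k)) (enum I))
        = minor (lift_coeff (base_time t)) (enum S) (enum I)" .
  qed
  finally show ?thesis .
qed

lemma form_curve:
  assumes \<omega>: "\<omega> \<in> forms (tangent_bundle N) r v"
  shows "curve (form_bundle N r) (form_curve \<omega>)"
    and "tangent (form_bundle N r) (form_curve \<omega>) \<in> tangent_fibre N r v"
proof -
  interpret F: charted "form_bundle N r" by (rule charted_form_bundle)
  obtain e where e: "e > 0" "\<And>t. \<bar>t\<bar> < e \<Longrightarrow> base_time t = t"
    using eventually_base_time unfolding eventually_nhds0_interval by blast
  have ro: "rel_open UNIV {-e<..<e}" by (simp add: rel_open_UNIV)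
  have cong: "smooth_on UNIV {-e<..<e} f" if "smooth_on UNIV {-e<..<e} g" "\<And>t. \<bar>t\<bar> < e \<Longrightarrow> g t = f t"
    for f g :: "real \<Rightarrow> real"
    using that(1) by (rule smooth_on_cong[THEN iffD1, rotated]) (use that(2) in \<open>simp add: abs_less_iff\<close>)
  show c: "curve (form_bundle N r) (form_curve \<omega>)"
  proof (rule curve_form_bundleI[OF i e(1)])
    show "fst (form_curve \<omega> t) \<in> cdom N i \<and> snd (form_curve \<omega> t) \<in> forms N r (fst (form_curve \<omega> t))" for t
      using base_curve_mem form_lift_forms[OF \<omega>] by (simp add: form_curve_def)
    have "smooth_on UNIV {-e<..<e} (\<lambda>t. (crd N i (foot v) + t *\<^sub>R vel N i v) $ k)" for k
      by (intro smooth_on_vec_nth ro smooth_on_line) simp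
    then show "smooth_on UNIV {-e<..<e} (\<lambda>t. crd N i (fst (form_curve \<omega> t)) $ k)" for k
      by (rule cong) (simp add: form_curve_def crd_base_curve e(2))
    fix I assume I: "I \<in> index_sets (lbl N) r"
    have "smooth_on UNIV {-e<..<e} (\<lambda>t. \<Sum>S\<in>index_sets (lbl N <+> lbl N) r.
        \<omega> (basis_vecs (tangent_bundle N) i v S) * minor (lift_coeff t) (enum S) (enum I))"
      using enum_index_sets[OF I] enum_index_sets
      by (intro smooth_on_sum smooth_on_mult smooth_on_const smooth_on_lift_minor ro) (auto, blast)
    then show "smooth_on UNIV {-e<..<e} (\<lambda>t. snd (form_curve \<omega> t) (basis_vecs N i (fst (form_curve \<omega> t)) I))"
      by (rule cong) (simp add: form_curve_def form_lift_coords[OF \<omega> I] e(2))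
  qed
  have "tmap N fst (tangent (form_bundle N r) (form_curve \<omega>)) = tangent N (fst \<circ> form_curve \<omega>)"
    by (rule tmap_tangent[OF charted_form_bundle charted_axioms smooth_map_fst_form_bundle c])
  also have "fst \<circ> form_curve \<omega> = base_curve" by (simp add: form_curve_def fun_eq_iff)
  finally show "tangent (form_bundle N r) (form_curve \<omega>) \<in> tangent_fibre N r v"
    using base_curve(2) F.tangent_pts[OF c] by (simp add: tangent_fibre_def)
qed

text \<open>The flip turns \<open>z\<close> with velocity \<open>(b, c)\<close> into the 1-jet of
  the vectors \<open>b + t c\<close> along the base curve. Their images under A_t have coordinates
  \<open>(t (b + t c), b + t c)\<close>, whose derivative at 0 is \<open>(b, c)\<close> again; so
  pairing with \<open>form_curve a\<close> and differentiating gives \<open>a [z]\<close>.\<close>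

lemma alpha_form_curve:
  assumes a: "a \<in> forms (tangent_bundle N) 1 v"
  shows "alpha N (tangent (form_bundle N 1) (form_curve a)) = (v, a)"
proof -
  interpret TN: charted "tangent_bundle N" by (rule charted_tangent_bundle)
  let ?w = "tangent (form_bundle N 1) (form_curve a)"
  have u: "tmap N fst ?w = v" using form_curve(2)[OF a] by (simp add: tangent_fibre_def)
  have "tangent_pairing1 (flip_map N z) ?w = a [z]" if z: "z \<in> tangent_space (tangent_bundle N) v" for z
  proof -
    obtain b c where b: "b \<in> model N" and c: "c \<in> model N" and zz: "z = vec2 i (foot v) (vel N i v) b c"
      and vz: "vel (tangent_bundle N) i z = join b c"
      using vec2_exhaust[OF z v i fv] by blast
    have flip: "flip_map N z = vec2 i (foot v) b (vel N i v) c"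
      unfolding zz by (rule flip_map_vec2[OF i fv vel_v b c])
    \<comment> \<open>This agrees with \<open>vec_curve\<close> near 0 but runs on
      \<open>base_time\<close>, so that its foot is \<open>base_curve t\<close> at every time, as
      the choice of representatives demands.\<close>
    define \<gamma> where "\<gamma> t = line_vec N i (base_curve t) (b + base_time t *\<^sub>R c)" for t
    have m: "b + s *\<^sub>R c \<in> model N" for s
      using b c subspace_coord_space by (auto intro!: subspace_add subspace_scale)
    note \<gamma>l = line_vec[OF i base_curve_mem m, of t "base_time t" for t, folded \<gamma>_def]
    have ev: "\<forall>\<^sub>F t in nhds 0. \<gamma> t = vec_curve i (foot v) b (vel N i v) c t"
      using eventually_base_time by eventually_elim (simp add: \<gamma>_def vec_curve_def base_curve_def)
    note \<gamma> = TN.curve_cong[OF vec_curve(1)[OF i fv b vel_v c] ev]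
    have "tangent_pairing1 (flip_map N z) ?w = vector_derivative (\<lambda>t. snd (form_curve a t) [\<gamma> t]) (at 0)"
      unfolding flip \<gamma>(2)[symmetric]
      by (rule tangent_pairing1_eq[OF \<gamma>(1) form_curve(1)[OF a]]) (simp add: \<gamma>l form_curve_def)
    also have "\<dots> = vector_derivative (\<lambda>t. \<Sum>s\<in>lbl N <+> lbl N. join (t *\<^sub>R (b + t *\<^sub>R c)) (b + t *\<^sub>R c) $ s
        * a [coord_vec (tangent_bundle N) i v s]) (at 0)"
    proof (rule vector_derivative_eventually_cong)
      show "\<forall>\<^sub>F t in nhds 0. snd (form_curve a t) [\<gamma> t] = (\<Sum>s\<in>lbl N <+> lbl N.
          join (t *\<^sub>R (b + t *\<^sub>R c)) (b + t *\<^sub>R c) $ s * a [coord_vec (tangent_bundle N) i v s])"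
        using eventually_base_time
      proof eventually_elim
        case (elim t)
        note A = lift_vec[OF base_curve_mem \<gamma>l(1)[of t], of "base_time t"]
        have "snd (form_curve a t) [\<gamma> t] = a [lift_vec (base_time t) (\<gamma> t)]"
          using \<gamma>l(1)[of t] by (simp add: form_curve_def form_lift_def)
        also have "\<dots> = (\<Sum>s\<in>lbl N <+> lbl N. vel (tangent_bundle N) i (lift_vec (base_time t) (\<gamma> t)) $ s
            * a [coord_vec (tangent_bundle N) i v s])"
          using TN.one_form_expansion[OF v_cdom a A(1)] by simp
        finally show ?case by (simp only: A(2)[unfolded elim] \<gamma>l(2) elim)
      qed
    qed
    also have "\<dots> = (\<Sum>s\<in>lbl N <+> lbl N. join b c $ s * a [coord_vec (tangent_bundle N) i v s])"
    proof (rule vector_derivative_at)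
      \<comment> \<open>The term quadratic in \<open>t\<close> has derivative zero at 0, so the
        first component contributes exactly \<open>b\<close>.\<close>
      have J: "((\<lambda>t. join (t *\<^sub>R (b + t *\<^sub>R c)) (b + t *\<^sub>R c) $ s) has_real_derivative join b c $ s) (at 0)" for s
        by (cases s) (auto intro!: derivative_eq_intros)
      have "((\<lambda>t. \<Sum>s\<in>lbl N <+> lbl N. join (t *\<^sub>R (b + t *\<^sub>R c)) (b + t *\<^sub>R c) $ s
          * a [coord_vec (tangent_bundle N) i v s]) has_real_derivative
          (\<Sum>s\<in>lbl N <+> lbl N. join b c $ s * a [coord_vec (tangent_bundle N) i v s])) (at 0)"
        by (intro DERIV_sum DERIV_cmult_right J)
      then show "((\<lambda>t. \<Sum>s\<in>lbl N <+> lbl N. join (t *\<^sub>R (b + t *\<^sub>R c)) (b + t *\<^sub>R c) $ s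
          * a [coord_vec (tangent_bundle N) i v s]) has_vector_derivative
          (\<Sum>s\<in>lbl N <+> lbl N. join b c $ s * a [coord_vec (tangent_bundle N) i v s])) (at 0)"
        by (simp add: has_real_derivative_iff_has_vector_derivative)
    qed
    also have "\<dots> = a [z]" using TN.one_form_expansion[OF v_cdom a z] vz by simp
    finally show ?thesis .
  qed note pairing = this
  have off: "a vs = 0" if "\<not> (length vs = 1 \<and> set vs \<subseteq> tangent_space (tangent_bundle N) v)" for vs
    using alt_forms_off[OF a[unfolded forms_alt_forms] that] .
  have "(if length vs = 1 \<and> set vs \<subseteq> tangent_space (tangent_bundle N) v
      then tangent_pairing1 (flip_map N (hd vs)) ?w else 0) = a vs" for vs
  proof (cases "length vs = 1 \<and> set vs \<subseteq> tangent_space (tangent_bundle N) v")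
    case True
    then obtain z where "vs = [z]" by (auto simp: length_Suc_conv)
    then show ?thesis using True pairing by simp
  qed (use off in auto)
  then show ?thesis unfolding alpha_def Let_def u by (simp add: fun_eq_iff del: One_nat_def)
qed

text \<open>The coordinate formula of \<open>alpha\<close> read backwards: a tangent vector with
  fibre position p and fibre velocity dp arises from the covector with base part dp and velocity
  part p. The pullback of that covector is p + t dp, over a base curve with the right 1-jet.\<close>

lemma tangent_fibre_form_curve:
  assumes w: "w \<in> tangent_fibre N 1 v"
  shows "\<exists>a\<in>forms (tangent_bundle N) 1 v. w = tangent (form_bundle N 1) (form_curve a)"
proof -
  interpret TN: charted "tangent_bundle N" by (rule charted_tangent_bundle)
  interpret F: charted "form_bundle N 1" by (rule charted_form_bundle)
  let ?F = "form_bundle N 1"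
  define \<delta> where "\<delta> = rep w"
  have wp: "w \<in> pts (tangent_bundle ?F)" and wv: "tmap N fst w = v"
    using w by (auto simp: tangent_fibre_def)
  note \<delta> = F.rep_pts[OF wp, folded \<delta>_def]
  have cd: "curve N (fst \<circ> \<delta>)"
    by (rule smooth_map_curve(1)[OF charted_form_bundle charted_axioms smooth_map_fst_form_bundle \<delta>(1)])
  have tv: "tangent N (fst \<circ> \<delta>) = v" using wv by (simp add: tmap_def \<delta>_def)
  have base: "base_curve \<in> tangent N (fst \<circ> \<delta>)"
    using tangent_self[OF base_curve(1)] base_curve(2) tv by simp
  have f0: "fst (\<delta> 0) = foot v" using tangent_memD(2)[OF base] base_curve(3) by simp
  have \<delta>0: "\<delta> 0 \<in> cdom ?F i"
    using F.curve_pts[OF \<delta>(1)] f0 fv by (cases "\<delta> 0") (auto simp: cdom_form_bundle pts_form_bundle)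
  \<comment> \<open>Position and velocity of the fibre coordinates of \<open>w\<close>. Their roles
    cross over below: \<open>P\<close> goes with the velocity labels \<open>Inr\<close> and
    \<open>Q\<close> with the base labels \<open>Inl\<close>.\<close>
  define P where "P k = crd ?F i (\<delta> 0) $ Inr {k}" for k
  define Q where "Q k = chart_vel ?F i \<delta> $ Inr {k}" for k
  define a where "a = (\<lambda>vs. \<Sum>k\<in>lbl N. P k * coord_covec (tangent_bundle N) i v (Inr k) vs)"
  define b where "b = (\<lambda>vs. \<Sum>k\<in>lbl N. Q k * coord_covec (tangent_bundle N) i v (Inl k) vs)"
  define \<omega> where "\<omega> = (\<lambda>vs. 1 * a vs + 1 * b vs)"
  have "a \<in> forms (tangent_bundle N) 1 v" "b \<in> forms (tangent_bundle N) 1 v"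
    unfolding a_def b_def by (intro forms_sum TN.coord_covec_form v_cdom; auto)+
  then have \<omega>: "\<omega> \<in> forms (tangent_bundle N) 1 v" unfolding \<omega>_def by (rule forms_lincomb)
  have val: "form_lift t \<omega> [coord_vec N i (base_curve t) l] = P l + base_time t * Q l" if l: "l \<in> lbl N" for t l
  proof -
    note c = coord_vec[OF i base_curve_mem[of t] l]
    note A = lift_vec[OF base_curve_mem c(1), of "base_time t"]
    have "form_lift t \<omega> [coord_vec N i (base_curve t) l] = \<omega> [lift_vec (base_time t) (coord_vec N i (base_curve t) l)]"
      using c by (simp add: form_lift_def)
    also have "\<dots> = (\<Sum>k\<in>lbl N. P k * axis l 1 $ k) + (\<Sum>k\<in>lbl N. Q k * (base_time t * axis l 1 $ k))"
      unfolding \<omega>_def a_def b_def TN.coord_covec_apply[OF A(1)] A(2) c(2) by simp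
    also have "\<dots> = P l + base_time t * Q l"
      using l by (simp add: axis_def if_distrib[of "(*) _"] cong: if_cong)
    finally show ?thesis .
  qed
  have "tangent ?F (form_curve \<omega>) = tangent ?F \<delta>"
  proof (rule F.tangent_eqI_jet[where i = i])
    show "curve ?F (form_curve \<omega>)" by (rule form_curve(1)[OF \<omega>])
    show "curve ?F \<delta>" by (rule \<delta>(1))
    show "i \<in> idx ?F" using i by simp
    have c0: "form_curve \<omega> 0 \<in> cdom ?F i"
      using base_curve_mem form_lift_forms[OF \<omega>] by (simp add: form_curve_def cdom_form_bundle)
    then show "form_curve \<omega> 0 \<in> cdom ?F i" .
    have crd0: "crd ?F i (form_curve \<omega> 0) $ s = crd ?F i (\<delta> 0) $ s" for s
    proof (cases s)
      case (Inl k)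
      then show ?thesis using f0 base_curve(3) by (simp add: crd_form_bundle form_curve_def)
    next
      case (Inr I)
      show ?thesis
      proof (cases "I \<in> index_sets (lbl N) 1")
        case True
        then obtain l where l: "I = {l}" "l \<in> lbl N" by (auto simp: index_sets_def card_1_singleton_iff)
        then show ?thesis using crd_one_form[OF l(2), of i "form_curve \<omega> 0"] val[OF l(2), of 0] Inr
          by (simp add: form_curve_def P_def)
      next
        case False
        then show ?thesis using Inr by (simp add: crd_form_bundle)
      qed
    qed
    show "form_curve \<omega> 0 = \<delta> 0"
      by (rule F.crd_eqD[of i]) (use i c0 \<delta>0 crd0 in \<open>auto simp: vec_eq_iff\<close>)
    fix s
    show "same_jet (\<lambda>t. crd ?F i (form_curve \<omega> t) $ s) (\<lambda>t. crd ?F i (\<delta> t) $ s)"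
    proof (cases s)
      case (Inl k)
      have "(fst \<circ> \<delta>) 0 \<in> cdom N i" using f0 fv by simp
      from tangent_same_jet[OF base cd i this, of k] show ?thesis
        using Inl by (simp add: crd_form_bundle form_curve_def)
    next
      case (Inr I)
      show ?thesis
      proof (cases "I \<in> index_sets (lbl N) 1")
        case True
        then obtain l where l: "I = {l}" "l \<in> lbl N" by (auto simp: index_sets_def card_1_singleton_iff)
        have "crd ?F i (form_curve \<omega> t) $ s = P l + base_time t * Q l" for t
          using crd_one_form[OF l(2), of i "form_curve \<omega> t"] val[OF l(2), of t] Inr l
          by (simp add: form_curve_def)
        moreover have "same_jet (\<lambda>t. P l + base_time t * Q l) (\<lambda>t. crd ?F i (\<delta> t) $ s)"
        proof (rule same_jet_cong[of "\<lambda>t. P l + t * Q l"])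
          have "((\<lambda>t. P l + t * Q l) has_real_derivative Q l) (at 0)"
            by (auto intro!: derivative_eq_intros)
          moreover have "((\<lambda>t. crd ?F i (\<delta> t) $ s) has_real_derivative Q l) (at 0)"
            using F.curve_component_derivative[OF \<delta>(1) _ \<delta>0, of s] i Inr l by (simp add: Q_def)
          ultimately show "same_jet (\<lambda>t. P l + t * Q l) (\<lambda>t. crd ?F i (\<delta> t) $ s)"
            using Inr l by (auto simp: same_jet_def P_def)
        qed (use eventually_base_time in \<open>auto elim: eventually_mono\<close>)
        ultimately show ?thesis by simp
      qed (simp add: Inr crd_form_bundle same_jet_const)
    qed
  qed
  then show ?thesis using \<omega> \<delta>(2) by blast
qed

end

section \<open>Inverting alpha\<close>

lemma tmap_fst_pts:
  assumes "w \<in> pts (tangent_bundle (form_bundle N r))"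
  shows "tmap N fst w \<in> pts (tangent_bundle N)"
proof -
  interpret F: charted "form_bundle N r" by (rule charted_form_bundle)
  have "curve N (fst \<circ> rep w)"
    by (rule smooth_map_curve(1)[OF charted_form_bundle charted_axioms smooth_map_fst_form_bundle F.rep_pts(1)[OF assms]])
  then show ?thesis unfolding tmap_def by (rule tangent_pts)
qed

text \<open>Equal values share the first component \<open>v\<close>, so both vectors lie over
  \<open>v\<close> and come from covectors. \<open>alpha\<close> returns these covectors, which must
  therefore coincide.\<close>

lemma inj_on_alpha: "inj_on (alpha N) (pts (tangent_bundle (form_bundle N 1)))"
proof (rule inj_onI)
  fix w w' assume w: "w \<in> pts (tangent_bundle (form_bundle N 1))" "w' \<in> pts (tangent_bundle (form_bundle N 1))"
    and eq: "alpha N w = alpha N w'"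
  define v where "v = tmap N fst w"
  have v': "tmap N fst w' = v" using eq by (simp add: alpha_def Let_def v_def)
  have v: "v \<in> pts (tangent_bundle N)" using tmap_fst_pts[OF w(1)] by (simp add: v_def)
  obtain i where i: "i \<in> idx N" "foot v \<in> cdom N i" using pts_chart[OF rep_pts(4)[OF v]] by blast
  have f: "w \<in> tangent_fibre N 1 v" "w' \<in> tangent_fibre N 1 v"
    using w v' by (auto simp: tangent_fibre_def v_def)
  obtain a where a: "a \<in> forms (tangent_bundle N) 1 v" "w = tangent (form_bundle N 1) (form_curve i v a)"
    using tangent_fibre_form_curve[OF i(1) v i(2) f(1)] by blast
  obtain a' where a': "a' \<in> forms (tangent_bundle N) 1 v" "w' = tangent (form_bundle N 1) (form_curve i v a')"
    using tangent_fibre_form_curve[OF i(1) v i(2) f(2)] by blast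
  show "w = w'"
    using eq alpha_form_curve[OF i(1) v i(2) a(1)] alpha_form_curve[OF i(1) v i(2) a'(1)] a(2) a'(2) by simp
qed

lemma epsilon_eq:
  assumes "i \<in> idx N" "v \<in> pts (tangent_bundle N)" "foot v \<in> cdom N i" "a \<in> forms (tangent_bundle N) 1 v"
  shows "epsilon N (v, a) = tangent (form_bundle N 1) (form_curve i v a)"
proof -
  have "tangent (form_bundle N 1) (form_curve i v a) \<in> pts (tangent_bundle (form_bundle N 1))"
    using form_curve(2)[OF assms] by (simp add: tangent_fibre_def)
  from inv_into_f_f[OF inj_on_alpha this] show ?thesis
    using alpha_form_curve[OF assms] by (simp add: epsilon_def)
qed

end

context charted
begin

text \<open>The definition carries a constant along \<open>rep v\<close>, while
  \<open>form_curve\<close> carries it along the straight line. Both base curves represent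
  \<open>v\<close>, and the fibre component is the same constant, so the 1-jets agree.\<close>

lemma epsilon_pow_zero:
  assumes i: "i \<in> idx N" and v: "v \<in> pts (tangent_bundle N)" and fv: "foot v \<in> cdom N i"
    and \<omega>: "\<omega> \<in> forms (tangent_bundle N) 0 v"
  shows "epsilon_pow N 0 (v, \<omega>) = tangent (form_bundle N 0) (form_curve i v \<omega>)"
proof -
  interpret F: charted "form_bundle N 0" by (rule charted_form_bundle)
  let ?F = "form_bundle N 0"
  note bc = base_curve[OF i v fv]
  have fl: "form_lift i v t \<omega> = (\<lambda>vs. if vs = [] then \<omega> [] else 0)" for t
    using alt_forms_off[OF \<omega>[unfolded forms_alt_forms]] by (auto simp: form_lift_def[OF i v fv] fun_eq_iff)
  let ?\<gamma> = "\<lambda>t. (rep v t, \<lambda>vs :: 'a tvec list. if vs = [] then \<omega> [] else 0)"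
  note r = rep_pts[OF v]
  have r0: "rep v 0 \<in> cdom N i" using r fv by simp
  obtain e where e: "e > 0" "\<And>t. \<bar>t\<bar> < e \<Longrightarrow> rep v t \<in> cdom N i" "smooth_on UNIV {-e<..<e} (crd N i \<circ> rep v)"
    using curve_chart[OF r(1) i r0] unfolding image_interval_subset by blast
  have ro: "rel_open UNIV {-e<..<e}" by (simp add: rel_open_UNIV)
  have const: "(\<lambda>vs. if vs = [] then c else 0) \<in> forms N 0 p" for c p
    unfolding forms_alt_forms by (rule alt_formsI) auto
  have empty: "enum I = []" if "I \<in> index_sets (lbl N) 0" for I
    using enum_index_sets[OF that] by simp
  have c: "curve ?F ?\<gamma>"
    by (rule curve_form_bundleI[OF i e(1)])
      (use e smooth_on_vec_nth[OF ro e(3)] const empty smooth_on_const[OF ro] in auto)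
  have "tangent ?F ?\<gamma> = tangent ?F (form_curve i v \<omega>)"
  proof (rule F.tangent_eqI_jet[OF c form_curve(1)[OF i v fv \<omega>]])
    show "?\<gamma> 0 = form_curve i v \<omega> 0" using bc(3) r(3) by (simp add: form_curve_def[OF i v fv] fl)
    show "i \<in> idx ?F" using i by simp
    show "?\<gamma> 0 \<in> cdom ?F i" using r0 const by (simp add: cdom_form_bundle)
    fix s
    have "rep v \<in> tangent N (base_curve i v)" using tangent_self[OF r(1)] r(2) bc(2) by simp
    from tangent_same_jet[OF this bc(1) i] bc(3) fv
    have "same_jet (\<lambda>t. crd N i (rep v t) $ k) (\<lambda>t. crd N i (base_curve i v t) $ k)" for k by simp
    then show "same_jet (\<lambda>t. crd ?F i (?\<gamma> t) $ s) (\<lambda>t. crd ?F i (form_curve i v \<omega> t) $ s)"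
    proof (cases s)
      case (Inr I)
      then show ?thesis
        by (cases "I \<in> index_sets (lbl N) 0")
          (simp_all add: crd_form_bundle form_curve_def[OF i v fv] fl empty same_jet_const)
    qed (simp add: crd_form_bundle form_curve_def[OF i v fv])
  qed
  then show ?thesis by (simp add: epsilon_pow_def)
qed

text \<open>Pullback is linear and respects wedges of covectors, so \<open>L0\<close> meets the
  requirements of the definite description. Any other candidate agrees with \<open>L0\<close> on
  basis forms, because these are decomposable, and then everywhere by linearity.\<close>

lemma epsilon_pow_pos:
  assumes i: "i \<in> idx N" and v: "v \<in> pts (tangent_bundle N)" and fv: "foot v \<in> cdom N i"
    and \<omega>: "\<omega> \<in> forms (tangent_bundle N) r v" and r: "r > 0"
  shows "epsilon_pow N r (v, \<omega>) = tangent (form_bundle N r) (form_curve i v \<omega>)"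
proof -
  interpret TN: charted "tangent_bundle N" by (rule charted_tangent_bundle)
  let ?FT = "forms (tangent_bundle N) r v" and ?F = "form_bundle N r"
  let ?P = "\<lambda>L. L \<in> ?FT \<rightarrow>\<^sub>E tangent_fibre N r v \<and>
     (\<forall>a b. \<forall>\<omega>\<in>?FT. \<forall>\<eta>\<in>?FT. L (\<lambda>vs. a * \<omega> vs + b * \<eta> vs) = tangent_lincomb N r a (L \<omega>) b (L \<eta>)) \<and>
     (\<forall>as. length as = r \<and> set as \<subseteq> forms (tangent_bundle N) 1 v \<longrightarrow>
        L (wedge_list as) = tangent_wedge N (map (\<lambda>a. epsilon N (v, a)) as))"
  define L0 where "L0 = (\<lambda>\<omega>\<in>?FT. tangent ?F (form_curve i v \<omega>))"
  note fc = form_curve[OF i v fv] and fcd = form_curve_def[OF i v fv]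
  have lin: "L0 (\<lambda>vs. a * \<omega> vs + b * \<eta> vs) = tangent_lincomb N r a (L0 \<omega>) b (L0 \<eta>)"
    if "\<omega> \<in> ?FT" "\<eta> \<in> ?FT" for a b \<omega> \<eta>
  proof -
    have "tangent_lincomb N r a (L0 \<omega>) b (L0 \<eta>) = tangent ?F (\<lambda>t. (fst (form_curve i v \<omega> t),
        \<lambda>vs. a * snd (form_curve i v \<omega> t) vs + b * snd (form_curve i v \<eta> t) vs))"
      using tangent_lincomb_eq[OF fc(1)[OF that(1)] fc(1)[OF that(2)]] that by (simp add: L0_def fcd)
    also have "\<dots> = L0 (\<lambda>vs. a * \<omega> vs + b * \<eta> vs)"
      using forms_lincomb[OF that] form_lift_lincomb[OF i v fv] by (simp add: L0_def fcd[abs_def])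
    finally show ?thesis by simp
  qed
  have wedge: "L0 (wedge_list as) = tangent_wedge N (map (\<lambda>a. epsilon N (v, a)) as)"
    if as: "length as = r" "set as \<subseteq> forms (tangent_bundle N) 1 v" for as
  proof -
    have e1: "map (\<lambda>a. epsilon N (v, a)) as = map (tangent (form_bundle N 1)) (map (form_curve i v) as)"
      using epsilon_eq[OF i v fv] as(2) by (auto simp: subset_iff)
    have e2: "tangent_wedge N (map (tangent (form_bundle N 1)) (map (form_curve i v) as))
        = tangent (form_bundle N (length (map (form_curve i v) as)))
          (\<lambda>t. (fst (hd (map (form_curve i v) as) t), wedge_list (map (\<lambda>\<gamma>. snd (\<gamma> t)) (map (form_curve i v) as))))"
      by (rule tangent_wedge_eq) (use as r fc(1) in \<open>auto simp: fcd\<close>)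
    have e3: "(\<lambda>t. (fst (hd (map (form_curve i v) as) t), wedge_list (map (\<lambda>\<gamma>. snd (\<gamma> t)) (map (form_curve i v) as))))
        = form_curve i v (wedge_list as)"
      using as r form_lift_wedge_list[OF i v fv as(2)]
      by (cases as) (auto simp: fcd fun_eq_iff comp_def)
    have "wedge_list as \<in> ?FT" using TN.wedge_list_forms[OF as(2)] as(1) by simp
    then show ?thesis unfolding e1 e2 e3 using as(1) by (simp add: L0_def)
  qed
  have P0: "?P L0" using lin wedge fc(2) by (auto simp: L0_def)
  have uniq: "L = L0" if L: "?P L" for L
  proof -
    note Ll = conjunct1[OF conjunct2[OF L], rule_format] and Lw = conjunct2[OF conjunct2[OF L], rule_format]
    note bf = TN.basis_form(1)[OF v_cdom[OF i v fv]]
    have W: "L (basis_form (tangent_bundle N) i v S) = L0 (basis_form (tangent_bundle N) i v S)"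
      if S: "S \<in> index_sets (lbl (tangent_bundle N)) r" for S
    proof -
      have "set (map (coord_covec (tangent_bundle N) i v) (enum S)) \<subseteq> forms (tangent_bundle N) 1 v"
        using enum_index_sets[OF S] TN.coord_covec_form[OF v_cdom[OF i v fv]] by auto
      then show ?thesis using L wedge enum_index_sets(3)[OF S] by simp
    qed
    have sum: "L (\<lambda>vs. \<Sum>S\<in>A. c S * basis_form (tangent_bundle N) i v S vs)
        = L0 (\<lambda>vs. \<Sum>S\<in>A. c S * basis_form (tangent_bundle N) i v S vs)"
      if "A \<subseteq> index_sets (lbl (tangent_bundle N)) r" for A c
      using finite_subset[OF that index_sets_finite] that
    proof (induction A rule: finite_induct)
      case empty
      \<comment> \<open>The zero form is produced as a wedge of \<open>r\<close> zero covectors,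
        which takes \<open>r > 0\<close>; the condition on wedges then fixes its image.\<close>
      let ?as = "replicate r (\<lambda>vs. 0) :: 'a tvec form list"
      have "wedge_list ?as = (\<lambda>vs. 0)"
        using r by (cases r) (auto simp: wedge_def fun_eq_iff)
      moreover have "set ?as \<subseteq> forms (tangent_bundle N) 1 v" using forms_zero by auto
      ultimately have "L (\<lambda>vs. 0) = L0 (\<lambda>vs. 0)"
        using Lw[of ?as] wedge[of ?as] by simp
      then show ?case by simp
    next
      case (insert S A)
      let ?W = "basis_form (tangent_bundle N) i v S" and ?R = "\<lambda>vs. \<Sum>S\<in>A. c S * basis_form (tangent_bundle N) i v S vs"
      have m: "?W \<in> ?FT" "?R \<in> ?FT"
        by (rule bf, use insert in blast) (rule forms_sum, rule bf, use insert in blast)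
      have "L (\<lambda>vs. c S * ?W vs + 1 * ?R vs) = tangent_lincomb N r (c S) (L ?W) 1 (L ?R)"
        by (rule Ll[OF m])
      also have "\<dots> = L0 (\<lambda>vs. c S * ?W vs + 1 * ?R vs)"
        using lin[OF m, of "c S" 1] insert.IH insert.prems W[of S] by simp
      finally show ?case using insert by simp
    qed
    have "L \<omega> = L0 \<omega>" if "\<omega> \<in> ?FT" for \<omega>
      using sum[OF subset_refl, of "\<lambda>S. \<omega> (basis_vecs (tangent_bundle N) i v S)"]
      unfolding TN.form_expansion[OF v_cdom[OF i v fv] that, symmetric] .
    then show ?thesis by (rule PiE_ext[OF conjunct1[OF L] conjunct1[OF P0]])
  qed
  have "(THE L. ?P L) = L0" using P0 uniq by (rule the_equality)
  then show ?thesis using \<omega> r by (simp add: epsilon_pow_def L0_def)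
qed

lemma epsilon_pow_eq:
  assumes "i \<in> idx N" "v \<in> pts (tangent_bundle N)" "foot v \<in> cdom N i" "\<omega> \<in> forms (tangent_bundle N) r v"
  shows "epsilon_pow N r (v, \<omega>) = tangent (form_bundle N r) (form_curve i v \<omega>)"
  using epsilon_pow_zero[OF assms(1-3)] epsilon_pow_pos[OF assms] assms(4) by (cases "r = 0") auto

section \<open>The tangent lift of a multivector field\<close>

definition lift_value :: "('a \<Rightarrow> 'a \<times> 'a mvec) \<Rightarrow> 'i \<Rightarrow> 'a tvec \<Rightarrow> 'a tvec form \<Rightarrow> real" where
  "lift_value X i v \<eta> = vector_derivative (\<lambda>t. snd (X (base_curve i v t)) (form_lift i v t \<eta>)) (at 0)"

text \<open>The tangent map can be computed on the curve of pulled back forms because it does not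
  depend on the representative, and the pairing on two such curves because both lie over
  \<open>base_curve\<close> at all times.\<close>

lemma contraction_lift:
  assumes i: "i \<in> idx N" and v: "v \<in> pts (tangent_bundle N)" and fv: "foot v \<in> cdom N i"
    and X: "X \<in> mvec_fields N r" and m: "m \<le> r" and \<omega>: "\<omega> \<in> forms (tangent_bundle N) m v"
  shows "(epsilon_dual N (r - m) \<circ> tmap (mvec_bundle N (r - m)) (contraction N r X m) \<circ> epsilon_pow N m) (v, \<omega>)
    = (v, \<lambda>b. if b \<in> forms (tangent_bundle N) (r - m) v then lift_value X i v (wedge m (r - m) \<omega> b) else 0)"
proof -
  let ?V = "mvec_bundle N (r - m)" and ?C = "contraction N r X m"
  note fc = form_curve[OF i v fv] and fcd = form_curve_def[OF i v fv]
  note ep = epsilon_pow_eq[OF i v fv]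
  let ?w = "tangent ?V (?C \<circ> form_curve i v \<omega>)"
  have tm: "tmap ?V ?C (epsilon_pow N m (v, \<omega>)) = ?w"
    unfolding ep[OF \<omega>]
    by (rule tmap_tangent[OF charted_form_bundle charted_mvec_bundle smooth_map_contraction[OF X m] fc(1)[OF \<omega>]])
  have cw: "curve ?V (?C \<circ> form_curve i v \<omega>)"
    by (rule smooth_map_curve(1)[OF charted_form_bundle charted_mvec_bundle smooth_map_contraction[OF X m] fc(1)[OF \<omega>]])
  have "tmap N fst ?w = tangent N (fst \<circ> (?C \<circ> form_curve i v \<omega>))"
    by (rule tmap_tangent[OF charted_mvec_bundle charted_axioms smooth_map_fst_mvec_bundle cw])
  also have "fst \<circ> (?C \<circ> form_curve i v \<omega>) = base_curve i v" by (simp add: fun_eq_iff fcd)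
  finally have fw: "tmap N fst ?w = v" unfolding base_curve(2)[OF i v fv] .
  have "tangent_pairing ?w (epsilon_pow N (r - m) (v, b)) = lift_value X i v (wedge m (r - m) \<omega> b)"
    if b: "b \<in> forms (tangent_bundle N) (r - m) v" for b
  proof -
    have "tangent_pairing ?w (epsilon_pow N (r - m) (v, b))
        = vector_derivative (\<lambda>t. snd ((?C \<circ> form_curve i v \<omega>) t) (snd (form_curve i v b t))) (at 0)"
      unfolding ep[OF b] by (rule tangent_pairing_eq[OF cw fc(1)[OF b]]) (simp add: fcd)
    also have "(\<lambda>t. snd ((?C \<circ> form_curve i v \<omega>) t) (snd (form_curve i v b t)))
        = (\<lambda>t. snd (X (base_curve i v t)) (form_lift i v t (wedge m (r - m) \<omega> b)))"
      using form_lift_forms[OF i v fv b]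
      by (simp add: fun_eq_iff fcd snd_contraction form_lift_wedge[OF i v fv \<omega> b])
    finally show ?thesis unfolding lift_value_def .
  qed
  then show ?thesis by (simp add: tm epsilon_dual_def fw cong: if_cong)
qed

lemma wedge_one_forms:
  assumes "p \<in> pts N" "\<omega> \<in> forms N r p"
  shows "wedge 0 r (\<lambda>vs. if vs = [] then 1 else 0) \<omega> = \<omega>"
proof -
  obtain i where i: "i \<in> idx N" "p \<in> cdom N i" using pts_chart[OF assms(1)] by blast
  interpret linear_frame "tangent_space N p" "lincomb N" "lbl N" "\<lambda>u k. vel N i u $ k"
    "coord_vec N i p" "coord_covec N i p" by (rule frame[OF i])
  show ?thesis using wedge_one assms(2) by (simp add: forms_alt_forms)
qed

text \<open>The composite evaluated in \<open>contraction_lift\<close> mentions no chart. Taking the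
  constant 0-form 1 there gives \<open>lift_value\<close> on the \<open>r\<close>-form itself, in
  either chart.\<close>

lemma lift_value_chart_indep:
  assumes "i \<in> idx N" "foot v \<in> cdom N i" "j \<in> idx N" "foot v \<in> cdom N j"
    and v: "v \<in> pts (tangent_bundle N)" and X: "X \<in> mvec_fields N r" and \<eta>: "\<eta> \<in> forms (tangent_bundle N) r v"
  shows "lift_value X i v \<eta> = lift_value X j v \<eta>"
proof -
  let ?one = "\<lambda>vs. if vs = [] then 1 else 0 :: real"
  have one: "?one \<in> forms (tangent_bundle N) 0 v" unfolding forms_alt_forms by (rule alt_forms_one)
  have w: "wedge 0 r ?one \<eta> = \<eta>"
    using charted.wedge_one_forms[OF charted_tangent_bundle v \<eta>] .
  show ?thesis
    using contraction_lift[OF assms(1) v assms(2) X le0 one] contraction_lift[OF assms(3) v assms(4) X le0 one] \<eta> w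
    by (auto dest!: fun_cong[of _ _ \<eta>])
qed

text \<open>These are constants, the same for all points and charts: the coefficients of first order
  in \<open>t\<close> of the minors of A_t.\<close>

definition minor_deriv :: "('k + 'k) set \<Rightarrow> 'k set \<Rightarrow> real" where
  "minor_deriv S K = vector_derivative (\<lambda>t. minor (lift_coeff t) (enum S) (enum K)) (at 0)"

text \<open>The product rule gives two contributions: the derivative of the minors of A_t with the
  components \<open>h K\<close> of \<open>X\<close> at the foot, and the derivative of
  \<open>h K\<close> along \<open>v\<close>. Linearity in the form and smooth dependence on
  \<open>v\<close> can both be read off.\<close>

lemma lift_value_formula:
  assumes j: "j \<in> idx N" and v: "v \<in> pts (tangent_bundle N)" and fv: "foot v \<in> cdom N j"
    and X: "X \<in> mvec_fields N r" and \<eta>: "\<eta> \<in> forms (tangent_bundle N) r v"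
    and W: "crd N j (foot v) \<in> W" "rel_open (model N) W"
    and s: "\<forall>K\<in>index_sets (lbl N) r.
      smooth_on (model N) W (\<lambda>y. snd (X (par N j y)) (basis_form N j (par N j y) K))"
  defines "h \<equiv> \<lambda>K y. snd (X (par N j y)) (basis_form N j (par N j y) K)"
  shows "((\<lambda>t. snd (X (base_curve j v t)) (form_lift j v t \<eta>)) has_vector_derivative
    (\<Sum>S\<in>index_sets (lbl N <+> lbl N) r. \<eta> (basis_vecs (tangent_bundle N) j v S) *
      (\<Sum>K\<in>index_sets (lbl N) r. minor_deriv S K * h K (crd N j (foot v)) +
         minor (lift_coeff 0) (enum S) (enum K) * dir_deriv W (h K) (vel N j v) (crd N j (foot v))))) (at 0)"
proof -
  let ?x = "crd N j (foot v)" and ?u = "vel N j v"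
  let ?L = "index_sets (lbl N <+> lbl N) r" and ?M = "index_sets (lbl N) r"
  let ?e = "\<lambda>S. \<eta> (basis_vecs (tangent_bundle N) j v S)"
  let ?g = "\<lambda>S K t. minor (lift_coeff t) (enum S) (enum K)"
  have u: "?u \<in> model N" by (rule vel_v[OF j v fv])
  have evW: "\<forall>\<^sub>F t in nhds 0. ?x + t *\<^sub>R ?u \<in> W"
    unfolding eventually_nhds0_interval by (rule rel_open_line[OF W(2,1) u])
  have line: "((\<lambda>t. ?x + t *\<^sub>R ?u) has_vector_derivative ?u) (at 0)"
    by (auto intro!: derivative_eq_intros simp: has_vector_derivative_def)
  have dh: "((\<lambda>t. h K (?x + t *\<^sub>R ?u)) has_real_derivative dir_deriv W (h K) ?u ?x) (at 0)" if "K \<in> ?M" for K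
    unfolding has_real_derivative_iff_has_vector_derivative
    by (rule has_derivative_along_curve[OF W(2) _ W(1) _ line evW]) (use bspec[OF s that] in \<open>simp_all add: h_def\<close>)
  have dg: "(?g S K has_real_derivative minor_deriv S K) (at 0)" if "S \<in> ?L" "K \<in> ?M" for S K
    unfolding has_real_derivative_iff_has_vector_derivative minor_deriv_def
    by (rule smooth_curve_derivative[of 1], rule smooth_on_lift_minor)
      (use enum_index_sets[OF that(1)] enum_index_sets[OF that(2)] in auto)
  have "((\<lambda>t. \<Sum>S\<in>?L. ?e S * (\<Sum>K\<in>?M. ?g S K t * h K (?x + t *\<^sub>R ?u))) has_real_derivative
      (\<Sum>S\<in>?L. ?e S * (\<Sum>K\<in>?M. minor_deriv S K * h K (?x + 0 *\<^sub>R ?u) + dir_deriv W (h K) ?u ?x * ?g S K 0))) (at 0)"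
    by (intro DERIV_sum DERIV_cmult DERIV_mult dg dh)
  then have D: "((\<lambda>t. \<Sum>S\<in>?L. ?e S * (\<Sum>K\<in>?M. ?g S K t * h K (?x + t *\<^sub>R ?u))) has_vector_derivative
      (\<Sum>S\<in>?L. ?e S * (\<Sum>K\<in>?M. minor_deriv S K * h K ?x + ?g S K 0 * dir_deriv W (h K) ?u ?x))) (at 0)"
    by (simp add: has_real_derivative_iff_has_vector_derivative mult.commute)
  \<comment> \<open>This is exact at all times as long as \<open>base_time\<close> is kept; near 0
    it may be replaced by \<open>t\<close>.\<close>
  have val: "snd (X (base_curve j v t)) (form_lift j v t \<eta>)
      = (\<Sum>S\<in>?L. ?e S * (\<Sum>K\<in>?M. ?g S K (base_time j v t) * h K (?x + base_time j v t *\<^sub>R ?u)))" for t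
  proof -
    note bm = base_curve_mem[OF j v fv, of t]
    have "snd (X (base_curve j v t)) (form_lift j v t \<eta>)
        = (\<Sum>K\<in>?M. form_lift j v t \<eta> (basis_vecs N j (base_curve j v t) K) * h K (?x + base_time j v t *\<^sub>R ?u))"
      using mvec_pairing[OF j bm mvec_field_mem(2)[OF X cdom_pts[OF j bm]] form_lift_forms[OF j v fv \<eta>]]
      by (simp add: h_def flip: base_curve_def[OF j v fv])
    also have "\<dots> = (\<Sum>K\<in>?M. \<Sum>S\<in>?L. ?e S * ?g S K (base_time j v t) * h K (?x + base_time j v t *\<^sub>R ?u))"
      by (intro sum.cong refl) (simp add: form_lift_coords[OF j v fv \<eta>] sum_distrib_right)
    also have "\<dots> = (\<Sum>S\<in>?L. \<Sum>K\<in>?M. ?e S * ?g S K (base_time j v t) * h K (?x + base_time j v t *\<^sub>R ?u))"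
      by (rule sum.swap)
    finally show ?thesis by (simp add: sum_distrib_left mult.assoc)
  qed
  have "\<forall>\<^sub>F t in nhds 0. snd (X (base_curve j v t)) (form_lift j v t \<eta>)
      = (\<Sum>S\<in>?L. ?e S * (\<Sum>K\<in>?M. ?g S K t * h K (?x + t *\<^sub>R ?u)))"
    using eventually_base_time[OF j v fv] by eventually_elim (simp only: val)
  then have "((\<lambda>t. snd (X (base_curve j v t)) (form_lift j v t \<eta>)) has_vector_derivative d) (at 0)
    \<longleftrightarrow> ((\<lambda>t. \<Sum>S\<in>?L. ?e S * (\<Sum>K\<in>?M. ?g S K t * h K (?x + t *\<^sub>R ?u))) has_vector_derivative d) (at 0)" for d
    by (intro has_vector_derivative_cong_ev) (auto elim: eventually_mono dest: eventually_nhds_x_imp_x)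
  then show ?thesis using D by simp
qed

text \<open>A chart is fixed for every foot so that the lift becomes a global definition; by
  \<open>lift_value_chart_indep\<close> any other chart around the foot gives the same
  values.\<close>

definition chart_at :: "'a \<Rightarrow> 'i" where
  "chart_at p = (SOME i. i \<in> idx N \<and> p \<in> cdom N i)"

lemma chart_at: "p \<in> pts N \<Longrightarrow> chart_at p \<in> idx N \<and> p \<in> cdom N (chart_at p)"
  unfolding chart_at_def by (rule someI_ex) (use pts_chart in blast)

definition tangent_lift :: "nat \<Rightarrow> ('a \<Rightarrow> 'a \<times> 'a mvec) \<Rightarrow> 'a tvec \<Rightarrow> 'a tvec \<times> 'a tvec mvec" where
  "tangent_lift r X = (\<lambda>v\<in>pts (tangent_bundle N). (v, \<lambda>\<eta>.
     if \<eta> \<in> forms (tangent_bundle N) r v then lift_value X (chart_at (foot v)) v \<eta> else 0))"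

lemma tangent_lift_eq:
  assumes "i \<in> idx N" "v \<in> pts (tangent_bundle N)" "foot v \<in> cdom N i" "X \<in> mvec_fields N r"
  shows "tangent_lift r X v = (v, \<lambda>\<eta>. if \<eta> \<in> forms (tangent_bundle N) r v then lift_value X i v \<eta> else 0)"
  using lift_value_chart_indep[OF _ _ assms(1,3,2,4)] chart_at[OF rep_pts(4)[OF assms(2)]] assms(2)
  by (auto simp: tangent_lift_def)

text \<open>By \<open>lift_value_formula\<close> the values are linear in the form, and the
  components are sums of products of constants, components of \<open>X\<close>, their derivatives in
  coordinate directions, and velocity coordinates of \<open>v\<close>.\<close>

lemma tangent_lift_field:
  assumes X: "X \<in> mvec_fields N r"
  shows "tangent_lift r X \<in> mvec_fields (tangent_bundle N) r"
proof -
  interpret TN: charted "tangent_bundle N" by (rule charted_tangent_bundle)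
  let ?L = "index_sets (lbl N <+> lbl N) r" and ?M = "index_sets (lbl N) r"
  show ?thesis
  proof (rule TN.mvec_fieldI)
    show "tangent_lift r X \<in> extensional (pts (tangent_bundle N))" by (simp add: tangent_lift_def)
    show "fst (tangent_lift r X v) = v" if "v \<in> pts (tangent_bundle N)" for v
      using that by (simp add: tangent_lift_def)
    fix v assume v: "v \<in> pts (tangent_bundle N)"
    obtain j W where j: "j \<in> idx N" and fv: "foot v \<in> cdom N j"
      and W: "crd N j (foot v) \<in> W" "W \<subseteq> crd N j ` cdom N j" "rel_open (model N) W"
      and s: "\<forall>I\<in>?M. smooth_on (model N) W (\<lambda>y. snd (X (par N j y)) (basis_form N j (par N j y) I))"
      using mvec_field_smooth[OF X rep_pts(4)[OF v]] by (elim exE conjE)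
    let ?h = "\<lambda>K y. snd (X (par N j y)) (basis_form N j (par N j y) K)"
    note D = lift_value_formula[OF j _ _ X _ _ W(3) s]
    show "snd (tangent_lift r X v) \<in> mvecs (tangent_bundle N) r v"
    proof -
      have "lift_value X j v (\<lambda>vs. a * \<omega> vs + b * \<eta> vs) = a * lift_value X j v \<omega> + b * lift_value X j v \<eta>"
        if "\<omega> \<in> forms (tangent_bundle N) r v" "\<eta> \<in> forms (tangent_bundle N) r v" for a b \<omega> \<eta>
      proof -
        note val = vector_derivative_at[OF D[OF v fv _ W(1)], folded lift_value_def]
        show ?thesis
          unfolding val[OF that(1)] val[OF that(2)] val[OF forms_lincomb[OF that]]
          by (simp only: distrib_right sum.distrib mult.assoc sum_distrib_left)
      qed
      then show ?thesis
        by (simp add: tangent_lift_eq[OF j v fv X] mvecs_def forms_lincomb)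
    qed
    let ?W = "over (lbl N) (lbl N) W :: (real ^ ('k + 'k)) set"
    have ro: "rel_open (model (tangent_bundle N)) ?W" using rel_open_over[OF W(3)] by simp
    have sub: "?W \<subseteq> crd (tangent_bundle N) j ` cdom (tangent_bundle N) j"
      using W(2) by (auto simp: crd_tangent_bundle_image[OF j] over_def)
    have j': "j \<in> idx (tangent_bundle N)" using j by simp
    have vW: "v \<in> cdom (tangent_bundle N) j" "crd (tangent_bundle N) j v \<in> ?W"
    proof -
      show vc: "v \<in> cdom (tangent_bundle N) j" using v fv j by (simp add: cdom_tangent_bundle)
      have "base_part (crd (tangent_bundle N) j v) = crd N j (foot v)"
        by (simp add: vec_eq_iff crd_tangent_bundle)
      then show "crd (tangent_bundle N) j v \<in> ?W"
        using W(1) TN.crd_model[OF j' vc] by (simp add: over_def)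
    qed
    have "smooth_on (model (tangent_bundle N)) ?W
        (\<lambda>y. snd (tangent_lift r X (par (tangent_bundle N) j y)) (basis_form (tangent_bundle N) j (par (tangent_bundle N) j y) S))"
      if S: "S \<in> ?L" for S
    proof -
      have h: "smooth_on (model (tangent_bundle N)) ?W (\<lambda>y. ?h K (base_part y))" if "K \<in> ?M" for K
        using smooth_on_over[OF W(3) s[rule_format, OF that]] by simp
      have dh: "smooth_on (model (tangent_bundle N)) ?W (\<lambda>y. dir_deriv W (?h K) (axis m 1) (base_part y))"
        if "K \<in> ?M" "m \<in> lbl N" for K m
        using smooth_on_over[OF W(3) smooth_on_dir_deriv[OF s[rule_format, OF that(1)]], of "axis m 1"] that by simp
      \<comment> \<open>The derivative along \<open>v\<close> is expanded in the fixed directions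
        \<open>axis m 1\<close>, for which smoothness is available; the velocity coordinates
        \<open>y $ Inr m\<close> appear as factors.\<close>
      have "smooth_on (model (tangent_bundle N)) ?W (\<lambda>y. \<Sum>K\<in>?M. minor_deriv S K * ?h K (base_part y) +
          minor (lift_coeff 0) (enum S) (enum K) * (\<Sum>m\<in>lbl N. y $ Inr m * dir_deriv W (?h K) (axis m 1) (base_part y)))"
        by (intro smooth_on_sum smooth_on_add smooth_on_mult smooth_on_const smooth_on_nth ro h dh)
      then show ?thesis
      proof (rule smooth_on_cong[THEN iffD1, rotated])
        fix y assume y: "y \<in> ?W"
        define u where "u = par (tangent_bundle N) j y"
        have uc: "u \<in> cdom (tangent_bundle N) j" "crd (tangent_bundle N) j u = y"
          using y sub j' TN.par_mem TN.crd_par unfolding u_def by auto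
        have u: "u \<in> pts (tangent_bundle N)" "foot u \<in> cdom N j"
          using uc(1) j by (auto simp: cdom_tangent_bundle)
        have x: "crd N j (foot u) = base_part y" and vu: "\<And>m. vel N j u $ m = y $ Inr m"
          using crd_tangent_bundle[of j u] uc(2) by (simp_all add: vec_eq_iff)
        have xW: "crd N j (foot u) \<in> W" using y x by (simp add: over_def)
        have bS: "basis_form (tangent_bundle N) j u S \<in> forms (tangent_bundle N) r u"
          by (rule TN.basis_form(1)[OF j' uc(1)]) (use S in simp)
        let ?t = "\<lambda>S. \<Sum>K\<in>?M. minor_deriv S K * ?h K (crd N j (foot u)) +
            minor (lift_coeff 0) (enum S) (enum K) * dir_deriv W (?h K) (vel N j u) (crd N j (foot u))"
        have "snd (tangent_lift r X u) (basis_form (tangent_bundle N) j u S)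
            = (\<Sum>S'\<in>?L. basis_form (tangent_bundle N) j u S (basis_vecs (tangent_bundle N) j u S') * ?t S')"
          unfolding tangent_lift_eq[OF j u X] using bS
          by (simp add: lift_value_def vector_derivative_at[OF D[OF u bS xW]])
        \<comment> \<open>Basis forms are dual to basis lists, so evaluating the formula on the
          basis form of \<open>S\<close> keeps a single term.\<close>
        also have "\<dots> = (\<Sum>S'\<in>?L. if S' = S then ?t S' else 0)"
          by (intro sum.cong refl) (use TN.basis_form(2)[OF j' uc(1)] S in auto)
        also have "\<dots> = ?t S" using S by (simp add: index_sets_finite)
        also have "\<dots> = (\<Sum>K\<in>?M. minor_deriv S K * ?h K (base_part y) +
          minor (lift_coeff 0) (enum S) (enum K) * (\<Sum>m\<in>lbl N. y $ Inr m * dir_deriv W (?h K) (axis m 1) (base_part y)))"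
          using dir_deriv_expansion[OF s[rule_format] xW vel_model[OF u(1) j u(2)]]
          by (intro sum.cong refl) (simp add: x vu)
        finally show "(\<Sum>K\<in>?M. minor_deriv S K * ?h K (base_part y) +
          minor (lift_coeff 0) (enum S) (enum K) * (\<Sum>m\<in>lbl N. y $ Inr m * dir_deriv W (?h K) (axis m 1) (base_part y)))
          = snd (tangent_lift r X (par (tangent_bundle N) j y)) (basis_form (tangent_bundle N) j (par (tangent_bundle N) j y) S)"
          by (simp add: u_def)
      qed
    qed
    then show "\<exists>j W. j \<in> idx (tangent_bundle N) \<and> v \<in> cdom (tangent_bundle N) j \<and> crd (tangent_bundle N) j v \<in> W \<and>
      W \<subseteq> crd (tangent_bundle N) j ` cdom (tangent_bundle N) j \<and> rel_open (model (tangent_bundle N)) W \<and>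
      (\<forall>I\<in>index_sets (lbl (tangent_bundle N)) r. smooth_on (model (tangent_bundle N)) W
        (\<lambda>y. snd (tangent_lift r X (par (tangent_bundle N) j y)) (basis_form (tangent_bundle N) j (par (tangent_bundle N) j y) I)))"
      using vW sub ro j' by (intro exI[of _ j] exI[of _ ?W] conjI) simp_all
  qed
qed

section \<open>Existence and uniqueness of the lift\<close>

lemma contraction_tangent_lift:
  assumes X: "X \<in> mvec_fields N r" and m: "m \<le> r" and a: "a \<in> pts (form_bundle (tangent_bundle N) m)"
  shows "contraction (tangent_bundle N) r (tangent_lift r X) m a =
    (epsilon_dual N (r - m) \<circ> tmap (mvec_bundle N (r - m)) (contraction N r X m) \<circ> epsilon_pow N m) a"
proof -
  obtain v \<omega> where vo: "a = (v, \<omega>)" "v \<in> pts (tangent_bundle N)" "\<omega> \<in> forms (tangent_bundle N) m v"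
    using a by (auto simp: form_bundle_def)
  obtain i where i: "i \<in> idx N" "foot v \<in> cdom N i" using pts_chart[OF rep_pts(4)[OF vo(2)]] by blast
  have "wedge m (r - m) \<omega> b \<in> forms (tangent_bundle N) r v" if "b \<in> forms (tangent_bundle N) (r - m) v" for b
    using wedge_forms[OF vo(3) that] m by simp
  then show ?thesis
    unfolding vo(1) contraction_lift[OF i(1) vo(2) i(2) X m vo(3)]
    by (auto simp: contraction_def tangent_lift_eq[OF i(1) vo(2) i(2) X])
qed

text \<open>Wedging with the constant 0-form 1 changes nothing, so contraction with it recovers the
  field.\<close>

lemma mvec_field_eqI:
  assumes Y: "Y \<in> mvec_fields N r" and Z: "Z \<in> mvec_fields N r"
    and eq: "\<And>a. a \<in> pts (form_bundle N 0) \<Longrightarrow> contraction N r Y 0 a = contraction N r Z 0 a"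
  shows "Y = Z"
proof (rule extensionalityI)
  show "Y \<in> extensional (pts N)" "Z \<in> extensional (pts N)" using Y Z by (auto simp: mvec_fields_def)
  fix p assume p: "p \<in> pts N"
  let ?one = "\<lambda>vs. if vs = [] then 1 else 0 :: real"
  have "?one \<in> forms N 0 p" unfolding forms_alt_forms by (rule alt_forms_one)
  then have e: "contraction N r Y 0 (p, ?one) = contraction N r Z 0 (p, ?one)"
    using p by (intro eq) (simp add: pts_form_bundle)
  have "snd (Y p) b = snd (Z p) b" for b
  proof (cases "b \<in> forms N r p")
    case True
    then show ?thesis
      using fun_cong[OF arg_cong[OF e, of snd], of b] by (simp add: contraction_def wedge_one_forms[OF p True])
  qed (use mvecs_off mvec_field_mem(2)[OF Y p] mvec_field_mem(2)[OF Z p] in metis)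
  then show "Y p = Z p" using mvec_field_mem(1)[OF Y p] mvec_field_mem(1)[OF Z p] by (simp add: prod_eq_iff fun_eq_iff)
qed

end

theorem theorem2p2:
  fixes M :: "('a, 'i, 'k::finite) manifold"
    and r :: nat
    and X :: "'a \<Rightarrow> 'a \<times> 'a mvec"
  assumes "smooth_manifold M"
    and "X \<in> mvec_fields M r"
  shows "\<exists>!Y. Y \<in> mvec_fields (tangent_bundle M) r \<and>
    (\<forall>i\<le>r. \<forall>a\<in>pts (form_bundle (tangent_bundle M) i).
       contraction (tangent_bundle M) r Y i a =
       (epsilon_dual M (r - i) \<circ>
        tmap (mvec_bundle M (r - i)) (contraction M r X i) \<circ>
        epsilon_pow M i) a)"
proof -
  interpret M: charted M by (rule smooth_manifold_charted[OF assms(1)])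
  show ?thesis
  proof (rule ex1I[of _ "M.tangent_lift r X"], intro conjI allI impI ballI)
    show "M.tangent_lift r X \<in> mvec_fields (tangent_bundle M) r"
      by (rule M.tangent_lift_field[OF assms(2)])
  next
    fix i a assume "i \<le> r" "a \<in> pts (form_bundle (tangent_bundle M) i)"
    then show "contraction (tangent_bundle M) r (M.tangent_lift r X) i a =
       (epsilon_dual M (r - i) \<circ> tmap (mvec_bundle M (r - i)) (contraction M r X i) \<circ> epsilon_pow M i) a"
      by (rule M.contraction_tangent_lift[OF assms(2)])
  next
    fix Y assume Y: "Y \<in> mvec_fields (tangent_bundle M) r \<and>
      (\<forall>i\<le>r. \<forall>a\<in>pts (form_bundle (tangent_bundle M) i). contraction (tangent_bundle M) r Y i a =
       (epsilon_dual M (r - i) \<circ> tmap (mvec_bundle M (r - i)) (contraction M r X i) \<circ> epsilon_pow M i) a)"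
    show "Y = M.tangent_lift r X"
    proof (rule charted.mvec_field_eqI[OF M.charted_tangent_bundle])
      show "Y \<in> mvec_fields (tangent_bundle M) r" using Y by blast
      show "M.tangent_lift r X \<in> mvec_fields (tangent_bundle M) r" by (rule M.tangent_lift_field[OF assms(2)])
      fix a assume a: "a \<in> pts (form_bundle (tangent_bundle M) 0)"
      then show "contraction (tangent_bundle M) r Y 0 a = contraction (tangent_bundle M) r (M.tangent_lift r X) 0 a"
        using Y M.contraction_tangent_lift[OF assms(2) le0 a] by simp
    qed
  qed
qed

end
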